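(* Let $\mathcal{P}_1=(P_1,d\mu_1,d\sigma_1)$ and $\mathcal{P}_2=(P_2,d\mu_2,d\sigma_2)$ be systems and let $T\ge0$. Then the $\mu$-canonical distribution of temperature $T$ of the composite system $\mathcal{P}_1\times\mathcal{P}_2$ is the product $u_1\times u_2$, $(x,y)\mapsto u_1(x)u_2(y)$, where $u_1$ and $u_2$ are the $\mu$-canonical distributions of temperature $T$ of $\mathcal{P}_1$ and $\mathcal{P}_2$ respectively.
   Context: An $n$-dimensional system is a triple $\mathcal{P}=(P,d\mu,d\sigma)$ where $P$ is a simple polytope in an $n$-dimensional real affine space $V$ (a compact subset with non-empty interior that is a finite intersection of closed half spaces, such that every vertex is the intersection of exactly $n$ facets), $d\mu$ is the restriction to $P$ of a translation-invariant measure on $V$ that is positive and finite on bounded non-empty open sets (i.e. a positive multiple of Lebesgue measure), and $d\sigma$ is a measure on the boundary $\partial P$ whose restriction to each facet is a positive multiple of the Lebesgue measure of the affine hyperplane spanned by that facet. For $p\ge1$, $\mathcal{M}^p(P)$ is the set of lower semicontinuous functions $u:P\to(0,\infty]$ that are log-convex ($u((1-t)x+ty)\le u(x)^{1-t}u(y)^t$ for $x,y\in P$, $t\in[0,1]$) and satisfy $\int_P u\,d\mu=\int_P d\mu$ and $\int_P u^p\,d\mu<\infty$. For $u\in\mathcal{M}^1(P)$: entropy $S_{\mathcal{P}}(u):=-\frac{1}{\int_Pd\mu}\int_P u\log u\,d\mu\in[-\infty,0]$; internal $\mu$-energy $U_{\mathcal{P}}(u):=\frac{1}{\int_Pd\mu}\int_{\partial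 P}u\,d\sigma\in(0,\infty]$; and for $T\in\mathbb{R}$, free $\mu$-energy $F_{\mathcal{P}}(T,u):=U_{\mathcal{P}}(u)-TS_{\mathcal{P}}(u)$ if $S_{\mathcal{P}}(u)>-\infty$, and $F_{\mathcal{P}}(T,u):=+\infty$ if $S_{\mathcal{P}}(u)=-\infty$. The $\mu$-canonical distribution of temperature $T>0$ is the unique minimizer $u^{\mathrm{can}}_T$ of $F_{\mathcal{P}}(T,\cdot)$ on $\mathcal{M}^1(P)$; for $T=0$, $u^{\mathrm{can}}_0$ is the unique minimizer of $U_{\mathcal{P}}$ on $\mathcal{M}^1(P)$ which has maximal entropy $S_{\mathcal{P}}$ among all minimizers of $U_{\mathcal{P}}$ (both exist and are unique). The composite system is $\mathcal{P}_1\times\mathcal{P}_2:=(P_1\times P_2,\ d\mu_1\times d\mu_2,\ d\sigma_1\times d\mu_2+d\mu_1\times d\sigma_2)$, where the last measure lives on $\partial(P_1\times P_2)=\partial P_1\times P_2\cup P_1\times\partial P_2$; it is again a system. *)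

theory Defs
  imports "HOL-Analysis.Analysis"
begin

definition simple_polytope :: "'a::euclidean_space set \<Rightarrow> bool" where
  "simple_polytope P \<longleftrightarrow> polytope P \<and> interior P \<noteq> {} \<and>
     (\<forall>v. v extreme_point_of P \<longrightarrow>
        card {F. F facet_of P \<and> v \<in> F} = DIM('a) \<and>
        \<Inter>{F. F facet_of P \<and> v \<in> F} = {v})"

text \<open>For an affine hyperplane H with unit normal a, the (n-1)-dimensional Lebesgue
  measure of a subset A of H is the n-dimensional Lebesgue measure of the right
  cylinder of height 1 over A.\<close>

definition unit_normal :: "'a::euclidean_space set \<Rightarrow> 'a" where
  "unit_normal H = (SOME a. norm a = 1 \<and> (\<exists>b. H = {x. inner a x = b}))"

definition cylinder :: "'a::euclidean_space \<Rightarrow> 'a set \<Rightarrow> 'a set" where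
  "cylinder a A = (\<lambda>(x, t). x + t *\<^sub>R a) ` (A \<times> {0..1})"

definition hyperplane_measure :: "'a::euclidean_space set \<Rightarrow> 'a measure" where
  "hyperplane_measure H =
     measure_of H {A. A \<subseteq> H \<and> cylinder (unit_normal H) A \<in> sets lebesgue}
       (\<lambda>A. emeasure lebesgue (cylinder (unit_normal H) A))"

definition is_system :: "'a::euclidean_space set \<Rightarrow> 'a measure \<Rightarrow> 'a measure \<Rightarrow> bool" where
  "is_system P mu sg \<longleftrightarrow>
     simple_polytope P \<and>
     (\<exists>c::real. c > 0 \<and> mu = density lborel (\<lambda>x. ennreal c * indicator P x)) \<and>
     sets sg = sets borel \<and>
     emeasure sg (- frontier P) = 0 \<and>
     (\<forall>F. F facet_of P \<longrightarrow>
        (\<exists>w::real. w > 0 \<and> (\<forall>A. A \<in> sets borel \<longrightarrow> A \<subseteq> F \<longrightarrow>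
            emeasure sg A = ennreal w * emeasure (hyperplane_measure (affine hull F)) A)))"

definition measure_add :: "'a measure \<Rightarrow> 'a measure \<Rightarrow> 'a measure" where
  "measure_add M N = measure_of (space M) (sets M) (\<lambda>A. emeasure M A + emeasure N A)"

definition comp_set :: "'a set \<Rightarrow> 'b set \<Rightarrow> ('a \<times> 'b) set" where
  "comp_set P1 P2 = P1 \<times> P2"

definition comp_mu :: "'a measure \<Rightarrow> 'b measure \<Rightarrow> ('a \<times> 'b) measure" where
  "comp_mu mu1 mu2 = mu1 \<Otimes>\<^sub>M mu2"

definition comp_sigma :: "'a measure \<Rightarrow> 'a measure \<Rightarrow> 'b measure \<Rightarrow> 'b measure \<Rightarrow> ('a \<times> 'b) measure" where
  "comp_sigma mu1 sg1 mu2 sg2 = measure_add (sg1 \<Otimes>\<^sub>M mu2) (mu1 \<Otimes>\<^sub>M sg2)"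

text \<open>Real powers on (0,\<infinity>] with \<infinity>^0 = 1 and \<infinity>^e = \<infinity> for e > 0.\<close>

definition epow :: "ennreal \<Rightarrow> real \<Rightarrow> ennreal" where
  "epow a e = (if a = \<infinity> then (if e = 0 then 1 else \<infinity>) else ennreal (enn2real a powr e))"

definition log_convex_on :: "'a::real_vector set \<Rightarrow> ('a \<Rightarrow> ennreal) \<Rightarrow> bool" where
  "log_convex_on P u \<longleftrightarrow>
     (\<forall>x\<in>P. \<forall>y\<in>P. \<forall>t\<in>{0..1::real}.
        u ((1 - t) *\<^sub>R x + t *\<^sub>R y) \<le> epow (u x) (1 - t) * epow (u y) t)"

definition lsc_on :: "'a::topological_space set \<Rightarrow> ('a \<Rightarrow> ennreal) \<Rightarrow> bool" where
  "lsc_on P u \<longleftrightarrow> (\<forall>x\<in>P. \<forall>c. c < u x \<longrightarrow> eventually (\<lambda>y. c < u y) (at x within P))"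

definition M1 :: "'a::euclidean_space set \<Rightarrow> 'a measure \<Rightarrow> ('a \<Rightarrow> ennreal) set" where
  "M1 P mu = {u. lsc_on P u \<and> (\<forall>x\<in>P. u x > 0) \<and> log_convex_on P u \<and>
                 (\<integral>\<^sup>+ x. u x * indicator P x \<partial>mu) = emeasure mu P}"

definition vol :: "'a set \<Rightarrow> 'a measure \<Rightarrow> real" where
  "vol P mu = enn2real (emeasure mu P)"

definition xlogx_pos :: "ennreal \<Rightarrow> ennreal" where
  "xlogx_pos a = (if a = \<infinity> then \<infinity> else ennreal (max 0 (enn2real a * ln (enn2real a))))"

definition xlogx_neg :: "ennreal \<Rightarrow> ennreal" where
  "xlogx_neg a = (if a = \<infinity> then 0 else ennreal (max 0 (- (enn2real a * ln (enn2real a)))))"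

definition entropy :: "'a set \<Rightarrow> 'a measure \<Rightarrow> ('a \<Rightarrow> ennreal) \<Rightarrow> ereal" where
  "entropy P mu u = ereal (- 1 / vol P mu) *
     (enn2ereal (\<integral>\<^sup>+ x. xlogx_pos (u x) * indicator P x \<partial>mu)
      - enn2ereal (\<integral>\<^sup>+ x. xlogx_neg (u x) * indicator P x \<partial>mu))"

definition internal_energy :: "'a::topological_space set \<Rightarrow> 'a measure \<Rightarrow> 'a measure \<Rightarrow> ('a \<Rightarrow> ennreal) \<Rightarrow> ennreal" where
  "internal_energy P mu sg u =
     ennreal (1 / vol P mu) * (\<integral>\<^sup>+ x. u x * indicator (frontier P) x \<partial>sg)"

definition free_energy :: "'a::topological_space set \<Rightarrow> 'a measure \<Rightarrow> 'a measure \<Rightarrow> real \<Rightarrow> ('a \<Rightarrow> ennreal) \<Rightarrow> ereal" where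
  "free_energy P mu sg T u =
     (if entropy P mu u = - \<infinity> then \<infinity>
      else enn2ereal (internal_energy P mu sg u) - ereal T * entropy P mu u)"

definition is_canonical :: "'a::euclidean_space set \<Rightarrow> 'a measure \<Rightarrow> 'a measure \<Rightarrow> real \<Rightarrow> ('a \<Rightarrow> ennreal) \<Rightarrow> bool" where
  "is_canonical P mu sg T u \<longleftrightarrow> u \<in> M1 P mu \<and>
     (if T > 0 then (\<forall>v\<in>M1 P mu. free_energy P mu sg T u \<le> free_energy P mu sg T v)
      else T = 0 \<and>
        (\<forall>v\<in>M1 P mu. internal_energy P mu sg u \<le> internal_energy P mu sg v) \<and>
        (\<forall>v\<in>M1 P mu. (\<forall>w\<in>M1 P mu. internal_energy P mu sg v \<le> internal_energy P mu sg w)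
            \<longrightarrow> entropy P mu v \<le> entropy P mu u))"

end

(*
With psi a = a ln a - a + 1, a normalised density u satisfies - vol P * S(u) = D(u), where D(u) is the
integral of psi (u x), so entropy and free energy become statements about nonnegative integrals.

For a density v on P1 x P2 let v1 and v2 be its marginals. They are log-convex by Hoelder's inequality and
lower semicontinuous by Fatou's lemma. By Fubini the internal energy is additive, U(v) = U(v1) + U(v2), and by
Gibbs' inequality S(v) <= S(v1) + S(v2), with equality for products. Hence u1 x u2 is canonical.

Uniqueness follows from strict convexity: for another canonical v the midpoint of v and u1 x u2 is a
competitor, which forces v = u1 x u2 almost everywhere, and log-convex lower semicontinuous densities that
agree almost everywhere on P agree on P. This needs finite entropy. For T > 0 it holds because the constant
density has finite free energy. For T = 0 it follows from finite internal energy: in polar coordinates at an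
interior point x0 log-convexity bounds u along the ray to a boundary point y by a multiple of u(y)^t, and
the integral of b^t ln b over 0 <= t <= 1 is b - 1, so the integral of u ln u over P is controlled by the
integral of u over the boundary.
*)

theory Submission
  imports Defs
begin

section \<open>Extended nonnegative reals\<close>

text \<open>\<open>psi\<close> is \<open>a ln a\<close> minus its tangent line at 1, hence convex,
  nonnegative and zero at 1, and the tangent terms integrate to the same value for all normalised
  densities. This allows the whole argument to run in \<open>ennreal\<close>, where integrals always
  exist, at the price that nothing may be subtracted freely. Identities between logarithms therefore
  appear with their negative terms moved to the other side; they are integrated and finite masses
  are cancelled afterwards.

  Uniqueness does not analyse equality in Gibbs' inequality. The internal energy is affine and only
  the entropy term is strictly convex, so comparing two minimisers with their midpoint isolates
  \<open>psi\<close>. This says nothing if the integral of \<open>psi\<close> is infinite, and at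
  \<open>T = 0\<close> the minimality of the energy gives no direct bound on it: this is the
  obstacle behind the geometric part.

  There the facet measures are given through right cylinders, while rays from a point sweep out
  oblique cones. Since only finiteness is wanted, an inequality between the two suffices.\<close>

definition psi :: "ennreal \<Rightarrow> ennreal" where
  "psi a = (if a = \<infinity> then \<infinity> else ennreal (enn2real a * ln (enn2real a) - enn2real a + 1))"

lemma psi_top [simp]: "psi \<infinity> = \<infinity>" "psi top = top"
  by (simp_all add: psi_def)

lemma psi_ennreal: "0 \<le> r \<Longrightarrow> psi (ennreal r) = ennreal (r * ln r - r + 1)"
  by (simp add: psi_def)

lemma psi_one [simp]: "psi 1 = 0"
  by (simp add: psi_def)

lemma ennreal_plus3:
  "0 \<le> a \<Longrightarrow> 0 \<le> b \<Longrightarrow> 0 \<le> c \<Longrightarrow> ennreal (a + b + c) = ennreal a + ennreal b + ennreal c"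
  by (simp add: ennreal_plus)

lemma ennreal_plus4:
  "0 \<le> a \<Longrightarrow> 0 \<le> b \<Longrightarrow> 0 \<le> c \<Longrightarrow> 0 \<le> d
    \<Longrightarrow> ennreal (a + b + c + d) = ennreal a + ennreal b + ennreal c + ennreal d"
  by (simp add: ennreal_plus)

text \<open>The tangent line of \<open>x ln x\<close> at 1 lies below the graph: this is
  \<open>ln s \<le> s - 1\<close> at \<open>s = 1/r\<close>, multiplied by \<open>r\<close>.\<close>

lemma mult_ln_nonneg:
  assumes "0 \<le> (r::real)" shows "0 \<le> r * ln r - r + 1"
proof (cases "r = 0")
  case False
  then have "r > 0" using assms by simp
  then have "ln (1/r) \<le> 1/r - 1" by (intro ln_le_minus_one) simp
  then have "r * ln (1/r) \<le> r * (1/r - 1)" using \<open>r>0\<close> by (intro mult_left_mono) auto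
  then show ?thesis using \<open>r > 0\<close> by (simp add: ln_div algebra_simps)
qed simp

lemma psi_measurable [measurable]: "psi \<in> borel_measurable borel"
  unfolding psi_def by measurable

lemma xlogx_pos_measurable [measurable]: "xlogx_pos \<in> borel_measurable borel"
  unfolding xlogx_pos_def by measurable

lemma xlogx_neg_measurable [measurable]: "xlogx_neg \<in> borel_measurable borel"
  unfolding xlogx_neg_def by measurable

text \<open>The definition of entropy splits \<open>a ln a\<close> into positive and negative part.
  This is \<open>a ln a = psi a + a - 1\<close> with the negative part and the constant moved
  across, so that it also makes sense at infinity, where both sides are infinite.\<close>

lemma xlogx_pos_psi: "xlogx_pos a + 1 = psi a + a + xlogx_neg a"
proof (cases a)
  case (real r)
  have "ennreal (max 0 (r * ln r)) + ennreal 1 = ennreal (max 0 (r * ln r) + 1)"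
    by (rule ennreal_plus[symmetric]) auto
  also have "max 0 (r * ln r) + 1 = (r * ln r - r + 1) + r + max 0 (- (r * ln r))"
    by (auto simp: max_def)
  also have "ennreal \<dots> = ennreal (r * ln r - r + 1) + ennreal r + ennreal (max 0 (- (r * ln r)))"
    using real mult_ln_nonneg[of r] by (intro ennreal_plus3) auto
  finally have "ennreal (max 0 (r * ln r)) + ennreal 1
      = ennreal (r * ln r - r + 1) + ennreal r + ennreal (max 0 (- (r * ln r)))" .
  then show ?thesis using real by (simp add: xlogx_pos_def xlogx_neg_def psi_ennreal)
qed (simp add: xlogx_pos_def xlogx_neg_def)

text \<open>Weaker than the sharp bound \<open>1/e\<close>, but enough: the negative part has finite
  integral against a finite measure, so the difference in \<open>entropy\<close> never has the form
  infinity minus infinity.\<close>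

lemma xlogx_neg_le_1: "xlogx_neg a \<le> 1"
proof (cases a)
  case (real r)
  have "- (r * ln r) \<le> 1" using mult_ln_nonneg[of r] real by simp
  then show ?thesis using real by (simp add: xlogx_neg_def)
qed (simp add: xlogx_neg_def)

text \<open>The law \<open>ln (a * b) = ln a + ln b\<close>, multiplied by \<open>a * b\<close>,
  with every subtracted term moved to the other side. It is the source of the additivity of entropy
  on products.\<close>

lemma psi_mult:
  assumes "0 < a" "0 < b"
  shows "psi (a * b) + a + b = b * psi a + a * psi b + a * b + 1"
proof (cases a)
  case ra: (real r)
  show ?thesis
  proof (cases b)
    case rb: (real s)
    have rs: "r > 0" "s > 0" using assms ra rb by auto
    have "ennreal (r * s * ln (r * s) - r * s + 1) + ennreal r + ennreal s
      = ennreal ((r * s * ln (r * s) - r * s + 1) + r + s)"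
      using mult_ln_nonneg[of "r * s"] rs by (intro ennreal_plus3[symmetric]) auto
    also have "(r * s * ln (r * s) - r * s + 1) + r + s
      = s * (r * ln r - r + 1) + r * (s * ln s - s + 1) + r * s + 1"
      using rs by (simp add: ln_mult algebra_simps)
    also have "ennreal \<dots> = ennreal (s * (r * ln r - r + 1))
        + ennreal (r * (s * ln s - s + 1)) + ennreal (r * s) + ennreal 1"
      using mult_ln_nonneg[of r] mult_ln_nonneg[of s] rs
      by (intro ennreal_plus4 mult_nonneg_nonneg) auto
    also have "ennreal (s * (r * ln r - r + 1)) = ennreal s * ennreal (r * ln r - r + 1)"
      using rs by (simp add: ennreal_mult')
    also have "ennreal (r * (s * ln s - s + 1)) = ennreal r * ennreal (s * ln s - s + 1)"
      using rs by (simp add: ennreal_mult')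
    finally have "ennreal (r * s * ln (r * s) - r * s + 1) + ennreal r + ennreal s
      = ennreal s * ennreal (r * ln r - r + 1) + ennreal r * ennreal (s * ln s - s + 1)
        + ennreal (r * s) + ennreal 1" .
    moreover have "a * b = ennreal (r * s)" using ra rb by (simp add: ennreal_mult)
    ultimately show ?thesis
      using ra rb by (simp add: psi_ennreal)
  next
    case top
    with assms show ?thesis by (simp add: ennreal_mult_top)
  qed
next
  case top
  with assms show ?thesis by (simp add: ennreal_top_mult)
qed

text \<open>The inequality a ln (a / (b c)) - a + b c >= 0 with subtraction-free terms only.\<close>

lemma psi_gibbs:
  assumes "0 < b" "b < \<infinity>" "0 < c" "c < \<infinity>"
  shows "a * (psi b / b) + a * (psi c / c) + 2 * a + 1 \<le> psi a + b * c + a / b + a / c"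
proof (cases a)
  case ra: (real r)
  obtain s where s: "b = ennreal s" "s > 0" using assms by (cases b) auto
  obtain t where t: "c = ennreal t" "t > 0" using assms by (cases c) auto
  have ineq: "r * ((s * ln s - s + 1)/s) + r * ((t * ln t - t + 1) / t) + 2 * r + 1
     \<le> (r * ln r - r + 1) + s * t + r / s + r / t"
  proof -
    \<comment> \<open>\<open>x ln x - x + 1\<close> is taken at \<open>r / (s * t)\<close>, in the
      application the ratio of the joint density to the product of its marginals, and scaled by
      \<open>s * t\<close>.\<close>
    have "0 \<le> s * t * (r/(s*t) * ln (r/(s*t)) - r/(s*t) + 1)"
      using mult_ln_nonneg[of "r/(s*t)"] s t ra by (intro mult_nonneg_nonneg) auto
    also have "\<dots> = r * ln (r/(s*t)) - r + s * t" using s t by (simp add: field_simps)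
    finally have *: "0 \<le> r * ln (r/(s*t)) - r + s * t" .
    show ?thesis
    proof (cases "r = 0")
      case False
      then have "r > 0" using ra by simp
      then have "ln (r/(s*t)) = ln r - ln s - ln t" using s t by (simp add: ln_div ln_mult)
      with * have "r * ln s + r * ln t \<le> r * ln r - r + s * t" by (simp add: algebra_simps)
      moreover have "r * ((s * ln s - s + 1)/s) = r * ln s - r + r/s" using s by (simp add: field_simps)
      moreover have "r * ((t * ln t - t + 1)/t) = r * ln t - r + r/t" using t by (simp add: field_simps)
      ultimately show ?thesis by simp
    qed (use s t in simp)
  qed
  have nn: "0 \<le> (s * ln s - s + 1) / s" "0 \<le> (t * ln t - t + 1) / t"
    using mult_ln_nonneg[of s] mult_ln_nonneg[of t] s t by auto
  have "ennreal (r * ((s * ln s - s + 1)/s) + r * ((t * ln t - t + 1) / t) + 2 * r + 1)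
    = ennreal (r * ((s * ln s - s + 1)/s)) + ennreal (r * ((t * ln t - t + 1) / t)) + ennreal (2 * r) + ennreal 1"
    using nn ra by (intro ennreal_plus4 mult_nonneg_nonneg) auto
  also have "\<dots> = ennreal r * ennreal ((s * ln s - s + 1)/s) + ennreal r * ennreal ((t * ln t - t + 1) / t)
      + 2 * ennreal r + 1"
    using ra by (simp only: ennreal_mult') simp
  also have "\<dots> = a * (psi b / b) + a * (psi c / c) + 2 * a + 1"
    using ra s t mult_ln_nonneg[of s] mult_ln_nonneg[of t]
    by (simp add: psi_ennreal divide_ennreal)
  finally have "a * (psi b / b) + a * (psi c / c) + 2 * a + 1 =
     ennreal (r * ((s * ln s - s + 1)/s) + r * ((t * ln t - t + 1) / t) + 2 * r + 1)" by simp
  also have "\<dots> \<le> ennreal ((r * ln r - r + 1) + s * t + r / s + r / t)"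
    using ineq by (rule ennreal_leI)
  also have "\<dots> = ennreal (r * ln r - r + 1) + ennreal (s * t) + ennreal (r / s) + ennreal (r / t)"
    using ra s t mult_ln_nonneg[of r] by (intro ennreal_plus4) auto
  also have "\<dots> = psi a + b * c + a / b + a / c"
    using ra s t by (simp add: psi_ennreal divide_ennreal ennreal_mult')
  finally show ?thesis .
qed simp

lemma psi_midpoint_real:
  assumes "0 \<le> (r::real)" "0 \<le> s"
  defines "m \<equiv> (r + s) / 2" and "f \<equiv> \<lambda>x. x * ln x - x + (1::real)"
  shows "2 * f m \<le> f r + f s" "2 * f m = f r + f s \<Longrightarrow> r = s"
proof -
  \<comment> \<open>Tangent of \<open>x ln x\<close> at the midpoint \<open>m\<close>, touching the
    graph only at \<open>m\<close>. When it is added at \<open>r\<close> and \<open>s\<close>, the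
    terms \<open>x - m\<close> cancel. The bound \<open>x \<le> 2 * m\<close> serves to give
    \<open>m > 0\<close> when \<open>x > 0\<close>.\<close>
  have key: "x * ln x \<ge> x * ln m + x - m \<and> (x * ln x = x * ln m + x - m \<longrightarrow> x = m)"
    if "0 \<le> x" "x \<le> 2 * m" for x
  proof (cases "x = 0")
    case True then show ?thesis using that by auto
  next
    case False
    with that have "x > 0" "m > 0" by auto
    have le: "ln (m/x) \<le> m/x - 1" using \<open>x>0\<close> \<open>m>0\<close> by (intro ln_le_minus_one) simp
    have eq: "x * (m/x - 1) = m - x" using \<open>x>0\<close> by (simp add: field_simps)
    have ln: "ln (m/x) = ln m - ln x" using \<open>x>0\<close> \<open>m>0\<close> by (simp add: ln_div)
    have "x * ln (m/x) \<le> m - x" using mult_left_mono[OF le, of x] \<open>x>0\<close> eq by simp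
    moreover have "x = m" if "x * ln (m/x) = m - x"
    proof -
      have "x * ln (m/x) = x * (m/x - 1)" using that eq by simp
      then have "ln (m/x) = m/x - 1" using \<open>x>0\<close> by simp
      then have "m/x = 1" using ln_eq_minus_one[of "m/x"] \<open>x>0\<close> \<open>m>0\<close> by simp
      then show ?thesis using \<open>x > 0\<close> by simp
    qed
    ultimately show ?thesis using ln by (auto simp: algebra_simps)
  qed
  have r: "r \<le> 2 * m" and s: "s \<le> 2 * m" using assms by (auto simp: m_def)
  have sum: "r * ln m + s * ln m = 2 * (m * ln m)" by (simp add: m_def field_simps)
  have rs: "r + s = 2 * m" by (simp add: m_def)
  show "2 * f m \<le> f r + f s"
    using key[OF assms(1) r] key[OF assms(2) s] sum rs by (simp add: f_def algebra_simps)
  show "r = s" if "2 * f m = f r + f s"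
  proof -
    have "r = m" "s = m"
      using key[OF assms(1) r] key[OF assms(2) s] sum rs that by (auto simp: f_def algebra_simps)
    then show ?thesis by simp
  qed
qed

lemma psi_midpoint: "2 * psi ((a + b) / 2) \<le> psi a + psi b"
proof (cases "a = \<infinity> \<or> b = \<infinity>")
  case False
  then obtain r s where rs: "a = ennreal r" "b = ennreal s" "0 \<le> r" "0 \<le> s" by (cases a; cases b) auto
  have m: "(a + b) / 2 = ennreal ((r + s) / 2)"
    using rs by (simp flip: ennreal_plus ennreal_numeral add: divide_ennreal)
  have "2 * psi ((a + b) / 2) = ennreal (2 * ((r+s)/2 * ln ((r+s)/2) - (r+s)/2 + 1))"
    unfolding m using rs by (subst psi_ennreal, simp) (simp only: ennreal_mult' ennreal_numeral zero_le_numeral)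
  also have "\<dots> \<le> ennreal ((r * ln r - r + 1) + (s * ln s - s + 1))"
    using psi_midpoint_real(1)[OF rs(3,4)] by (rule ennreal_leI)
  also have "\<dots> = psi a + psi b"
    using rs mult_ln_nonneg[of r] mult_ln_nonneg[of s] by (subst ennreal_plus) (simp_all add: psi_ennreal)
  finally show ?thesis .
qed auto

text \<open>Strict convexity. Finite values of \<open>psi\<close> are required because two infinite
  sides are equal without \<open>a = b\<close>.\<close>

lemma psi_midpoint_eq:
  assumes "2 * psi ((a + b) / 2) = psi a + psi b" "psi a \<noteq> \<infinity>" "psi b \<noteq> \<infinity>"
  shows "a = b"
proof -
  have "a \<noteq> \<infinity>" "b \<noteq> \<infinity>" using assms by auto
  then obtain r s where rs: "a = ennreal r" "b = ennreal s" "0 \<le> r" "0 \<le> s" by (cases a; cases b) auto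
  have m: "(a + b) / 2 = ennreal ((r + s) / 2)"
    using rs by (simp flip: ennreal_plus ennreal_numeral add: divide_ennreal)
  have "ennreal (2 * ((r+s)/2 * ln ((r+s)/2) - (r+s)/2 + 1)) = 2 * psi ((a + b) / 2)"
    unfolding m using rs by (subst psi_ennreal, simp) (simp only: ennreal_mult' ennreal_numeral zero_le_numeral)
  also have "\<dots> = psi a + psi b" by fact
  also have "\<dots> = ennreal ((r * ln r - r + 1) + (s * ln s - s + 1))"
    using rs mult_ln_nonneg[of r] mult_ln_nonneg[of s] by (subst ennreal_plus) (simp_all add: psi_ennreal)
  finally have "2 * ((r+s)/2 * ln ((r+s)/2) - (r+s)/2 + 1) = (r * ln r - r + 1) + (s * ln s - s + 1)"
    using mult_ln_nonneg[of r] mult_ln_nonneg[of s] mult_ln_nonneg[of "(r+s)/2"] rs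
    by (subst (asm) ennreal_inj) (auto intro!: mult_nonneg_nonneg simp del: distrib_left_numeral right_diff_distrib_numeral)
  then show ?thesis using psi_midpoint_real(2)[OF rs(3,4)] rs by simp
qed

section \<open>Real powers and Hoelder's inequality for extended reals\<close>

lemma epow_0 [simp]: "a \<noteq> 0 \<Longrightarrow> epow a 0 = 1"
  by (cases a) (auto simp: epow_def)

lemma epow_1 [simp]: "epow a 1 = a"
  by (cases a) (auto simp: epow_def)

lemma epow_top [simp]: "0 < e \<Longrightarrow> epow \<infinity> e = \<infinity>" "0 < e \<Longrightarrow> epow top e = top"
  by (simp_all add: epow_def)

lemma epow_ennreal: "0 \<le> r \<Longrightarrow> epow (ennreal r) e = ennreal (r powr e)"
  by (simp add: epow_def)

lemma epow_pos: "0 < a \<Longrightarrow> 0 < epow a e"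
  by (cases a) (auto simp: epow_def)

lemma epow_mult:
  assumes "0 < a" "0 < b" "0 \<le> e"
  shows "epow (a * b) e = epow a e * epow b e"
proof (cases "e = 0")
  case False
  with assms have "e > 0" by simp
  then show ?thesis
  proof (cases "a = top \<or> b = top")
    case True
    moreover have "epow a e \<noteq> 0" "epow b e \<noteq> 0" "a \<noteq> 0" "b \<noteq> 0"
      using epow_pos[OF assms(1), of e] epow_pos[OF assms(2), of e] assms by simp_all
    ultimately show ?thesis
      using \<open>e > 0\<close> by (elim disjE) (simp_all add: ennreal_mult_top ennreal_top_mult)
  next
    case False
    then obtain r s where rs: "a = ennreal r" "b = ennreal s" "0 \<le> r" "0 \<le> s" by (cases a; cases b) auto
    then have *: "a * b = ennreal (r * s)" by (simp add: ennreal_mult)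
    have "epow (a * b) e = ennreal ((r * s) powr e)" unfolding * using rs by (intro epow_ennreal) simp
    then show ?thesis using rs by (simp add: epow_ennreal powr_mult ennreal_mult)
  qed
next
  case True
  have "a \<noteq> 0" "b \<noteq> 0" "a * b \<noteq> 0" using assms by (auto simp: zero_less_iff_neq_zero)
  then show ?thesis using assms True by simp
qed

lemma epow_mono:
  assumes "a \<le> b" "0 < e" shows "epow a e \<le> epow b e"
proof (cases "b = top")
  case False
  then obtain r s where rs: "a = ennreal r" "b = ennreal s" "0 \<le> r" "0 \<le> s"
    using assms by (cases a; cases b) (auto simp: top_unique)
  then have "r \<le> s" using assms by simp
  then show ?thesis using rs assms by (simp add: epow_ennreal powr_mono2 ennreal_leI)
qed (use assms in simp)

text \<open>Weighted inequality of arithmetic and geometric means for \<open>a / A\<close> and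
  \<open>b / B\<close>. When \<open>A\<close> and \<open>B\<close> are the two integrals, the
  bracket on the right integrates to 1, and this is Hoelder's inequality.\<close>

lemma epow_young:
  assumes "0 < A" "A < \<infinity>" "0 < B" "B < \<infinity>" "0 < t" "t < 1"
  shows "epow a (1 - t) * epow b t \<le> epow A (1 - t) * epow B t * (ennreal (1 - t) * (a / A) + ennreal t * (b / B))"
proof (cases "a = 0 \<or> b = 0")
  case True
  then show ?thesis using assms by (auto simp: epow_def)
next
  case nz: False
  obtain p where p: "A = ennreal p" "p > 0" using assms by (cases A) auto
  obtain q where q: "B = ennreal q" "q > 0" using assms by (cases B) auto
  show ?thesis
  proof (cases "a = \<infinity> \<or> b = \<infinity>")
    case True
    then have "ennreal (1 - t) * (a / A) + ennreal t * (b / B) = \<infinity>"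
      using assms p q by (auto simp: ennreal_top_divide ennreal_mult_top)
    moreover have "epow A (1 - t) * epow B t \<noteq> 0"
      using epow_pos[OF assms(1), of "1 - t"] epow_pos[OF assms(3), of t]
      by (simp add: less_imp_neq[symmetric] zero_less_iff_neq_zero)
    ultimately show ?thesis by (simp only: infinity_ennreal_def ennreal_mult_top top_greatest if_False)
  next
    case False
    then obtain r s where rs: "a = ennreal r" "r > 0" "b = ennreal s" "s > 0" using nz by (cases a; cases b) auto
    have "(r/p) powr (1-t) * (s/q) powr t \<le> (1-t) * (r/p) + t * (s/q)"
      using assms rs p q by (intro Youngs_inequality_0) auto
    then have "p powr (1-t) * q powr t * ((r/p) powr (1-t) * (s/q) powr t) \<le> p powr (1-t) * q powr t * ((1-t) * (r/p) + t * (s/q))"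
      by (intro mult_left_mono) auto
    moreover have "p powr (1-t) * q powr t * ((r/p) powr (1-t) * (s/q) powr t) = r powr (1-t) * s powr t"
      using p q rs by (simp add: powr_divide)
    ultimately have "ennreal (r powr (1-t) * s powr t) \<le> ennreal (p powr (1-t) * q powr t * ((1-t) * (r/p) + t * (s/q)))"
      by (simp add: ennreal_leI)
    also have "\<dots> = ennreal (p powr (1-t)) * ennreal (q powr t) * (ennreal (1-t) * ennreal (r/p) + ennreal t * ennreal (s/q))"
      using p q rs assms by (simp only: ennreal_mult' ennreal_plus powr_ge_zero mult_nonneg_nonneg
          divide_nonneg_nonneg less_imp_le diff_ge_0_iff_ge)
    finally show ?thesis using p q rs assms
      by (simp add: epow_ennreal divide_ennreal ennreal_mult')
  qed
qed

lemma nn_integral_Holder: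
  assumes [measurable]: "f \<in> borel_measurable M" "g \<in> borel_measurable M"
    and pos: "0 < (\<integral>\<^sup>+x. f x \<partial>M)" "0 < (\<integral>\<^sup>+x. g x \<partial>M)" and t: "0 < t" "t < 1"
  shows "(\<integral>\<^sup>+x. epow (f x) (1 - t) * epow (g x) t \<partial>M)
    \<le> epow (\<integral>\<^sup>+x. f x \<partial>M) (1 - t) * epow (\<integral>\<^sup>+x. g x \<partial>M) t"
proof -
  let ?A = "\<integral>\<^sup>+x. f x \<partial>M" and ?B = "\<integral>\<^sup>+x. g x \<partial>M"
  show ?thesis
  proof (cases "?A = \<infinity> \<or> ?B = \<infinity>")
    \<comment> \<open>Positivity keeps the other factor away from 0, so the right-hand side is
      infinite rather than \<open>0 * \<infinity> = 0\<close>.\<close>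
    case True
    moreover have "epow ?A (1 - t) \<noteq> 0" "epow ?B t \<noteq> 0"
      using epow_pos[OF pos(1), of "1 - t"] epow_pos[OF pos(2), of t] by simp_all
    ultimately have "epow ?A (1 - t) * epow ?B t = top"
      using t by (elim disjE) (simp_all add: ennreal_mult_top ennreal_top_mult)
    then show ?thesis by simp
  next
    case False
    then have fin: "?A < \<infinity>" "?B < \<infinity>" by (auto simp: less_top)
    have "(\<integral>\<^sup>+x. epow (f x) (1 - t) * epow (g x) t \<partial>M)
      \<le> (\<integral>\<^sup>+x. epow ?A (1 - t) * epow ?B t * (ennreal (1 - t) * (f x / ?A) + ennreal t * (g x / ?B)) \<partial>M)"
      by (intro nn_integral_mono epow_young pos fin t)
    also have "\<dots> = epow ?A (1 - t) * epow ?B t * (ennreal (1 - t) * (?A / ?A) + ennreal t * (?B / ?B))"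
      by (simp add: nn_integral_cmult nn_integral_add nn_integral_divide)
    also have "?A / ?A = 1" using pos fin by (intro ennreal_divide_self) auto
    also have "?B / ?B = 1" using pos fin by (intro ennreal_divide_self) auto
    also have "ennreal (1 - t) * 1 + ennreal t * 1 = 1" using t by (simp flip: ennreal_plus)
    finally show ?thesis by simp
  qed
qed

text \<open>Multiplication is continuous from below: each positive factor is the supremum of the
  smaller numbers, also when it is infinite, and suprema are taken in one factor at a time. This
  yields semicontinuity of products in \<open>lsc_on_mult\<close>.\<close>

lemma ennreal_less_mult_obtain:
  assumes "(c::ennreal) < a * b" "0 < a" "0 < b"
  obtains a' b' where "a' < a" "b' < b" "c < a' * b'"
proof -
  have sup: "x = (SUP y\<in>{..<x}. y)" if "0 < x" for x :: ennreal
    using that Sup_lessThan[of x] by simp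
  have "c < (SUP x\<in>{..<a}. x * b)"
    using assms(1) sup[OF assms(2)] SUP_mult_right_ennreal[of "\<lambda>x. x" "{..<a}" b] by simp
  then obtain a' where a': "a' < a" "c < a' * b" unfolding less_SUP_iff by blast
  have "c < (SUP x\<in>{..<b}. a' * x)"
    using a'(2) sup[OF assms(3)] SUP_mult_left_ennreal[of a' "\<lambda>x. x" "{..<b}"] by simp
  then obtain b' where b': "b' < b" "c < a' * b'" unfolding less_SUP_iff by blast
  show ?thesis using a' b' that by blast
qed

section \<open>Log-convex lower semicontinuous densities\<close>

lemma lsc_on_tendsto:
  assumes "lsc_on P u" "x \<in> P" "\<And>n. s n \<in> P" "s \<longlonglongrightarrow> x"
  shows "u x \<le> liminf (\<lambda>n. u (s n))"
  unfolding le_Liminf_iff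
proof safe
  fix c assume c: "c < u x"
  have "eventually (\<lambda>y. c < u y) (at x within P)" using assms(1,2) c by (auto simp: lsc_on_def)
  \<comment> \<open>The filter \<open>at x within P\<close> omits \<open>x\<close>, but the sequence
    may hit \<open>x\<close>. There the claim is the assumption \<open>c < u x\<close>, so full
    neighbourhoods can be used.\<close>
  then have "eventually (\<lambda>y. y \<in> P \<longrightarrow> c < u y) (nhds x)"
    unfolding eventually_at_filter by eventually_elim (use c in auto)
  with assms(4) have "eventually (\<lambda>n. s n \<in> P \<longrightarrow> c < u (s n)) sequentially"
    by (rule eventually_compose_filterlim[rotated])
  then show "eventually (\<lambda>n. c < u (s n)) sequentially" using assms(3) by simp
qed

lemma lsc_onI_sequentially:
  fixes u :: "'a::first_countable_topology \<Rightarrow> ennreal"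
  assumes "\<And>x s. x \<in> P \<Longrightarrow> (\<And>n. s n \<in> P) \<Longrightarrow> s \<longlonglongrightarrow> x \<Longrightarrow> u x \<le> liminf (\<lambda>n. u (s n))"
  shows "lsc_on P u"
  unfolding lsc_on_def
proof (intro ballI allI impI)
  fix x c assume x: "x \<in> P" and c: "c < u x"
  show "eventually (\<lambda>y. c < u y) (at x within P)"
  proof (rule sequentially_imp_eventually_within, intro allI impI)
    fix s assume "(\<forall>n. s n \<in> P \<and> s n \<noteq> x) \<and> s \<longlonglongrightarrow> x"
    then have "u x \<le> liminf (\<lambda>n. u (s n))" by (intro assms x) auto
    with c have "c < liminf (\<lambda>n. u (s n))" by (rule less_le_trans)
    then show "eventually (\<lambda>n. c < u (s n)) sequentially" by (rule less_LiminfD)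
  qed
qed

lemma closed_sublevel_lsc_on:
  fixes u :: "'a::first_countable_topology \<Rightarrow> ennreal"
  assumes "lsc_on P u" "closed P"
  shows "closed {x \<in> P. u x \<le> c}"
proof -
  have "l \<in> {x \<in> P. u x \<le> c}" if s: "\<And>n. s n \<in> {x \<in> P. u x \<le> c}" "s \<longlonglongrightarrow> l" for s l
  proof -
    have l: "l \<in> P" using closed_sequentially[OF assms(2), of s l] s by auto
    have "u l \<le> liminf (\<lambda>n. u (s n))" using lsc_on_tendsto[OF assms(1) l, of s] s by auto
    also have "\<dots> \<le> liminf (\<lambda>n. c)" using s by (intro Liminf_mono) (auto intro: eventuallyI)
    also have "\<dots> = c" by (simp add: Liminf_const)
    finally show ?thesis using l by auto
  qed
  then show ?thesis unfolding closed_sequential_limits by blast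
qed

text \<open>Membership in \<open>M1\<close> does not constrain a function off \<open>P\<close>, so only this extension is Borel.\<close>

definition ext :: "'a set \<Rightarrow> ('a \<Rightarrow> ennreal) \<Rightarrow> 'a \<Rightarrow> ennreal" where
  "ext P u x = (if x \<in> P then u x else 1)"

lemma ext_in [simp]: "x \<in> P \<Longrightarrow> ext P u x = u x"
  and ext_notin [simp]: "x \<notin> P \<Longrightarrow> ext P u x = 1"
  by (simp_all add: ext_def)

lemma ext_measurable:
  fixes u :: "'a::euclidean_space \<Rightarrow> ennreal"
  assumes "lsc_on P u" "closed P"
  shows "ext P u \<in> borel_measurable borel"
proof (rule borel_measurableI_le)
  fix c
  have "{x \<in> space borel. ext P u x \<le> c} = {x \<in> P. u x \<le> c} \<union> (if 1 \<le> c then - P else {})"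
    by (auto simp: ext_def)
  moreover have "- P \<in> sets borel" "{x \<in> P. u x \<le> c} \<in> sets borel"
    using assms closed_sublevel_lsc_on[OF assms] by (auto intro: borel_closed borel_open)
  ultimately show "{x \<in> space borel. ext P u x \<le> c} \<in> sets borel" by auto
qed

lemma log_convex_onD:
  assumes "log_convex_on P u" "x \<in> P" "y \<in> P" "0 \<le> t" "t \<le> 1"
  shows "u ((1 - t) *\<^sub>R x + t *\<^sub>R y) \<le> epow (u x) (1 - t) * epow (u y) t"
  using assms by (auto simp: log_convex_on_def)

text \<open>The end points \<open>t = 0\<close> and \<open>t = 1\<close> come from positivity: there
  one factor is \<open>epow a 0\<close>, which is 1 for \<open>a \<noteq> 0\<close> but 0 for
  \<open>a = 0\<close>, because \<open>0 powr 0 = 0\<close>.\<close>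

lemma log_convex_onI:
  assumes "\<And>x y t. x \<in> P \<Longrightarrow> y \<in> P \<Longrightarrow> 0 < t \<Longrightarrow> t < 1 \<Longrightarrow>
      u ((1 - t) *\<^sub>R x + t *\<^sub>R y) \<le> epow (u x) (1 - t) * epow (u y) t"
    and "\<And>x. x \<in> P \<Longrightarrow> 0 < u x"
  shows "log_convex_on P u"
  unfolding log_convex_on_def
proof (intro ballI)
  fix x y and t :: real assume *: "x \<in> P" "y \<in> P" "t \<in> {0..1}"
  then consider "t = 0" | "t = 1" | "0 < t" "t < 1" by fastforce
  then show "u ((1 - t) *\<^sub>R x + t *\<^sub>R y) \<le> epow (u x) (1 - t) * epow (u y) t"
    using assms *
    by cases (auto simp: zero_less_iff_neq_zero)
qed

text \<open>Marginals are the case of the other body's measure, midpoints the case of a measure on \<open>bool\<close>.\<close>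

lemma mixture:
  fixes f :: "'a::euclidean_space \<Rightarrow> 'i \<Rightarrow> ennreal"
  assumes M: "emeasure M (space M) \<noteq> 0" and cvx: "convex P"
    and meas: "\<And>x. x \<in> P \<Longrightarrow> f x \<in> borel_measurable M"
    and lsc: "\<And>i. i \<in> space M \<Longrightarrow> lsc_on P (\<lambda>x. f x i)"
    and pos: "\<And>x i. x \<in> P \<Longrightarrow> i \<in> space M \<Longrightarrow> 0 < f x i"
    and lc: "\<And>i. i \<in> space M \<Longrightarrow> log_convex_on P (\<lambda>x. f x i)"
  defines "F \<equiv> \<lambda>x. \<integral>\<^sup>+i. f x i \<partial>M"
  shows "lsc_on P F" "\<And>x. x \<in> P \<Longrightarrow> 0 < F x" "log_convex_on P F"
proof -
  show "lsc_on P F"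
  proof (rule lsc_onI_sequentially)
    fix x s assume x: "x \<in> P" and s: "\<And>n. s n \<in> P" "s \<longlonglongrightarrow> x"
    have "F x \<le> (\<integral>\<^sup>+i. liminf (\<lambda>n. f (s n) i) \<partial>M)"
      unfolding F_def using lsc_on_tendsto[OF lsc x] s by (intro nn_integral_mono) auto
    also have "\<dots> \<le> liminf (\<lambda>n. F (s n))"
      unfolding F_def using meas s by (intro nn_integral_liminf) auto
    finally show "F x \<le> liminf (\<lambda>n. F (s n))" .
  qed
  show Fpos: "0 < F x" if x: "x \<in> P" for x
  proof (rule ccontr)
    assume "\<not> 0 < F x"
    then have "AE i in M. f x i = 0"
      using meas[OF x] by (simp add: F_def nn_integral_0_iff_AE zero_less_iff_neq_zero)
    then have "AE i in M. False" using AE_space by eventually_elim (use pos[OF x] in force)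
    then have "emeasure M (space M) = 0" by (simp add: AE_iff_measurable[OF _ refl])
    with M show False by simp
  qed
  show "log_convex_on P F"
  proof (rule log_convex_onI[OF _ Fpos])
    fix x y and t :: real assume *: "x \<in> P" "y \<in> P" "0 < t" "t < 1"
    have "F ((1 - t) *\<^sub>R x + t *\<^sub>R y) \<le> (\<integral>\<^sup>+i. epow (f x i) (1 - t) * epow (f y i) t \<partial>M)"
      unfolding F_def using * by (intro nn_integral_mono log_convex_onD[OF lc]) auto
    also have "\<dots> \<le> epow (F x) (1 - t) * epow (F y) t"
      unfolding F_def using * meas Fpos by (intro nn_integral_Holder) (auto simp: F_def)
    finally show "F ((1 - t) *\<^sub>R x + t *\<^sub>R y) \<le> epow (F x) (1 - t) * epow (F y) t" .
  qed
qed

section \<open>Convex bodies with a multiple of Lebesgue measure\<close>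

lemma emeasure_lborel_pos:
  fixes A :: "'a::euclidean_space set"
  assumes "interior A \<noteq> {}" "A \<in> sets borel"
  shows "emeasure lborel A \<noteq> 0"
proof
  assume "emeasure lborel A = 0"
  then have "emeasure lborel (interior A) = 0"
    using emeasure_mono[of "interior A" A lborel] interior_subset assms(2) by auto
  then have "negligible (interior A)"
    by (simp add: negligible_iff_null_sets null_setsI null_sets_completionI)
  then show False using assms(1) open_not_negligible[of "interior A"] by simp
qed

text \<open>A notion stable under products by \<open>body_Times\<close>, so the composite is a
  \<open>body\<close> at once. The facets are used separately, in
  \<open>is_system_boundary_measure\<close> and \<open>finite_D\<close>.\<close>

locale body =
  fixes P :: "'a::euclidean_space set" and mu :: "'a measure" and c :: real
  assumes compact: "compact P" and convex: "convex P" and interior: "interior P \<noteq> {}"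
    and c_pos: "0 < c" and mu_def: "mu = density lborel (\<lambda>x. ennreal c * indicator P x)"
begin

lemma closed: "closed P" using compact by (rule compact_imp_closed)

lemma P_borel [measurable, simp]: "P \<in> sets borel" using closed by (rule borel_closed)

lemma sets_mu [measurable_cong, simp]: "sets mu = sets borel" by (simp add: mu_def)

lemma space_mu [simp]: "space mu = UNIV" by (simp add: mu_def)

lemma nn_integral_mu:
  "f \<in> borel_measurable borel \<Longrightarrow> (\<integral>\<^sup>+x. f x \<partial>mu) = ennreal c * (\<integral>\<^sup>+x. f x * indicator P x \<partial>lborel)"
  unfolding mu_def by (subst nn_integral_density) (auto simp: nn_integral_cmult[symmetric] ac_simps)

lemma AE_mu: "AE x in mu. x \<in> P"
  unfolding mu_def by (subst AE_density) (auto simp: indicator_def)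

lemma AE_mu_iff:
  assumes "Measurable.pred borel Q"
  shows "(AE x in mu. Q x) \<longleftrightarrow> (AE x in lborel. x \<in> P \<longrightarrow> Q x)"
  unfolding mu_def using c_pos by (subst AE_density) (auto simp: indicator_def)

definition V :: real where "V = vol P mu"

lemma emeasure_mu: "emeasure mu A = ennreal c * emeasure lborel (P \<inter> A)" if "A \<in> sets borel" for A
proof -
  have "emeasure mu A = (\<integral>\<^sup>+x. indicator A x \<partial>mu)" using that by simp
  also have "\<dots> = ennreal c * (\<integral>\<^sup>+x. indicator A x * indicator P x \<partial>lborel)"
    using that by (intro nn_integral_mu) auto
  also have "(\<integral>\<^sup>+x. indicator A x * indicator P x \<partial>lborel) = (\<integral>\<^sup>+x. indicator (P \<inter> A) x \<partial>lborel)"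
    by (intro nn_integral_cong) (auto simp: indicator_def)
  also have "\<dots> = emeasure lborel (P \<inter> A)" using that by simp
  finally show ?thesis .
qed

lemma mu_P: "emeasure mu P = ennreal V" "emeasure mu UNIV = ennreal V" and V_pos: "0 < V"
proof -
  have eq: "emeasure mu P = ennreal c * emeasure lborel P" "emeasure mu UNIV = ennreal c * emeasure lborel P"
    by (subst emeasure_mu; simp)+
  have fin: "emeasure lborel P < \<infinity>" using compact by (intro emeasure_bounded_finite compact_imp_bounded)
  have "0 < emeasure lborel P" using emeasure_lborel_pos[OF interior] by (simp add: zero_less_iff_neq_zero)
  then have *: "0 < emeasure mu P" "emeasure mu P < \<infinity>"
    unfolding eq using fin c_pos by (auto simp: ennreal_zero_less_mult_iff ennreal_mult_less_top)
  then show "0 < V" by (simp add: V_def vol_def enn2real_positive_iff)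
  show "emeasure mu P = ennreal V" using * by (simp add: V_def vol_def)
  then show "emeasure mu UNIV = ennreal V" using eq by simp
qed

lemma finite_measure_mu: "finite_measure mu" by (intro finite_measureI) (simp add: mu_P)

sublocale finite_measure mu by (rule finite_measure_mu)

lemma integral_ext: "(\<integral>\<^sup>+x. f (u x) * indicator P x \<partial>mu) = (\<integral>\<^sup>+x. f (ext P u x) \<partial>mu)"
  by (intro nn_integral_cong_AE eventually_mono[OF AE_mu]) auto

lemma M1_iff: "u \<in> M1 P mu \<longleftrightarrow> lsc_on P u \<and> (\<forall>x\<in>P. 0 < u x) \<and> log_convex_on P u
    \<and> (\<integral>\<^sup>+x. ext P u x \<partial>mu) = ennreal V"
  using integral_ext[of "\<lambda>x. x" u] by (auto simp: M1_def mu_P)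

lemma M1_D:
  assumes "u \<in> M1 P mu"
  shows "lsc_on P u" "\<And>x. x \<in> P \<Longrightarrow> 0 < u x" "log_convex_on P u" "(\<integral>\<^sup>+x. ext P u x \<partial>mu) = ennreal V"
    "ext P u \<in> borel_measurable borel" "\<And>x. 0 < ext P u x"
  using assms ext_measurable[OF _ closed] by (auto simp: M1_iff) (auto simp: ext_def)

definition D :: "('a \<Rightarrow> ennreal) \<Rightarrow> ennreal" where "D u = (\<integral>\<^sup>+x. psi (ext P u x) \<partial>mu)"

text \<open>When \<open>xlogx_pos_psi\<close> is integrated, the terms \<open>1\<close> and
  \<open>a\<close> both contribute the mass \<open>V\<close>, by the normalisation of
  \<open>u\<close>, and cancel. The negative part is finite, so cancelling it in
  \<open>ereal\<close> is safe even if \<open>D u\<close> is infinite.\<close>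

lemma entropy_eq:
  assumes "u \<in> M1 P mu"
  shows "entropy P mu u = - enn2ereal (ennreal (1 / V) * D u)"
proof -
  note [measurable] = M1_D(5)[OF assms]
  define Ip where "Ip = (\<integral>\<^sup>+x. xlogx_pos (ext P u x) \<partial>mu)"
  define In where "In = (\<integral>\<^sup>+x. xlogx_neg (ext P u x) \<partial>mu)"
  have "In \<le> (\<integral>\<^sup>+x. 1 \<partial>mu)" unfolding In_def by (intro nn_integral_mono xlogx_neg_le_1)
  then have "In \<noteq> top" using emeasure_finite[of UNIV] by (auto simp: mu_P top_unique)
  then obtain n where n: "In = ennreal n" "0 \<le> n" by (cases In) auto
  have "Ip + ennreal V = (\<integral>\<^sup>+x. xlogx_pos (ext P u x) + 1 \<partial>mu)"
    unfolding Ip_def by (subst nn_integral_add) (auto simp: mu_P)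
  also have "\<dots> = D u + ennreal V + In"
    unfolding D_def In_def xlogx_pos_psi M1_D(4)[OF assms, symmetric] by (simp add: nn_integral_add)
  finally have "ennreal V + Ip = ennreal V + (D u + In)" by (simp only: ac_simps)
  then have Ip: "Ip = D u + In" unfolding ennreal_add_left_cancel by simp
  have "enn2ereal Ip - enn2ereal In = enn2ereal (D u)"
    unfolding Ip n(1) plus_ennreal.rep_eq enn2ereal_ennreal[OF n(2)] by (cases "enn2ereal (D u)") auto
  then have "entropy P mu u = ereal (- 1 / V) * enn2ereal (D u)"
    unfolding entropy_def integral_ext V_def[symmetric] Ip_def In_def by simp
  also have "\<dots> = - (ereal (1 / V) * enn2ereal (D u))"
    using ereal_mult_minus_left[of "ereal (1 / V)" "enn2ereal (D u)"] by simp
  also have "ereal (1 / V) = enn2ereal (ennreal (1 / V))" using V_pos by (simp add: enn2ereal_ennreal)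
  finally show ?thesis by (simp add: times_ennreal.rep_eq)
qed

lemma entropy_le_iff:
  assumes "u \<in> M1 P mu" "v \<in> M1 P mu"
  shows "entropy P mu u \<le> entropy P mu v \<longleftrightarrow> D v \<le> D u"
proof -
  have "ennreal (1 / V) * D v \<le> ennreal (1 / V) * D u \<longleftrightarrow> D v \<le> D u"
    using V_pos by (intro ennreal_mult_le_mult_iff) auto
  then show ?thesis unfolding entropy_eq[OF assms(1)] entropy_eq[OF assms(2)]
    by (simp add: less_eq_ennreal.rep_eq)
qed

text \<open>Here \<open>T > 0\<close> matters when \<open>D u\<close> is infinite: the product with
  \<open>T / V\<close> is then infinite, in agreement with the value assigned to the free energy at
  entropy \<open>- \<infinity>\<close>. At \<open>T = 0\<close> the product would be 0.\<close>

lemma free_energy_eq: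
  assumes "u \<in> M1 P mu" "0 < T"
  shows "free_energy P mu sg T u = enn2ereal (internal_energy P mu sg u + ennreal (T / V) * D u)"
proof (cases "D u = top")
  case True
  then have "ennreal (1 / V) * D u = top" "ennreal (T / V) * D u = top"
    using V_pos assms(2) by (auto simp: ennreal_mult_top)
  then show ?thesis using assms V_pos by (simp add: free_energy_def entropy_eq)
next
  case False
  then obtain d where d: "D u = ennreal d" "0 \<le> d" by (cases "D u") auto
  have "ennreal (1 / V) * D u = ennreal (d / V)" "ennreal (T / V) * D u = ennreal (T * d / V)"
    using d V_pos assms by (simp_all flip: ennreal_mult)
  moreover have "x - ereal (- r) = x + ereal r" for x r by (cases x) auto
  ultimately show ?thesis using assms V_pos d
    by (simp add: free_energy_def entropy_eq plus_ennreal.rep_eq enn2ereal_ennreal)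
qed

lemma is_canonical_pos_iff:
  assumes "0 < T"
  shows "is_canonical P mu sg T u \<longleftrightarrow> u \<in> M1 P mu \<and> (\<forall>v\<in>M1 P mu.
     internal_energy P mu sg u + ennreal (T / V) * D u \<le> internal_energy P mu sg v + ennreal (T / V) * D v)"
  using assms by (auto simp: is_canonical_def free_energy_eq less_eq_ennreal.rep_eq)

lemma is_canonical_0_iff:
  "is_canonical P mu sg 0 u \<longleftrightarrow> u \<in> M1 P mu \<and>
     (\<forall>v\<in>M1 P mu. internal_energy P mu sg u \<le> internal_energy P mu sg v) \<and>
     (\<forall>v\<in>M1 P mu. (\<forall>w\<in>M1 P mu. internal_energy P mu sg v \<le> internal_energy P mu sg w) \<longrightarrow> D u \<le> D v)"
  by (auto simp: is_canonical_def entropy_le_iff)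

text \<open>The sublevel sets are convex and exhaust \<open>P\<close> up to a null set, so one of them is not negligible
  and therefore has interior.\<close>

lemma M1_bounded_on_ball:
  assumes u: "u \<in> M1 P mu"
  shows "\<exists>K e x0. 1 \<le> (K::real) \<and> 0 < e \<and> cball x0 e \<subseteq> P \<and> (\<forall>x\<in>cball x0 e. u x \<le> ennreal K)"
proof -
  \<comment> \<open>\<open>Suc n\<close> makes each bound at least 1; later estimates use
    \<open>ln K \<ge> 0\<close> and monotone powers of \<open>K\<close>.\<close>
  define S where "S n = {x \<in> P. u x \<le> ennreal (real (Suc n))}" for n
  have clS: "closed (S n)" for n
    unfolding S_def by (intro closed_sublevel_lsc_on M1_D(1)[OF u] closed)
  have "\<exists>n. emeasure lborel (S n) \<noteq> 0"
  proof (rule ccontr)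
    assume "\<nexists>n. emeasure lborel (S n) \<noteq> 0"
    then have "S n \<in> null_sets lborel" for n using borel_closed[OF clS, of n] by (intro null_setsI) auto
    then have "AE x in lborel. x \<notin> S n" for n by (rule AE_not_in)
    then have "AE x in lborel. \<forall>n. x \<notin> S n" by (simp add: AE_all_countable)
    then have "AE x in lborel. x \<in> P \<longrightarrow> ext P u x = top"
    proof eventually_elim
      case (elim x)
      show ?case
      proof
        assume x: "x \<in> P"
        show "ext P u x = top"
        proof (cases "u x")
          case (real r)
          obtain n where "r \<le> real n" using real_arch_simple by blast
          then have "r \<le> real (Suc n)" by simp
          then have "x \<in> S n" using real x by (auto simp: S_def simp del: of_nat_Suc intro!: ennreal_leI)
          with elim show ?thesis by blast
        qed (use x in auto)
      qed
    qed
    moreover have "Measurable.pred borel (\<lambda>x. ext P u x = top)"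
      using M1_D(5)[OF u] by measurable
    ultimately have "AE x in mu. ext P u x = top"
      by (simp only: AE_mu_iff)
    then have "(\<integral>\<^sup>+x. ext P u x \<partial>mu) = (\<integral>\<^sup>+x. top \<partial>mu)" by (intro nn_integral_cong_AE) auto
    also have "\<dots> = top" using V_pos by (simp add: mu_P ennreal_top_mult)
    finally show False using M1_D(4)[OF u] by simp
  qed
  then obtain n where n: "emeasure lborel (S n) \<noteq> 0" by blast
  have "convex (S n)"
    unfolding convex_alt
  proof (intro ballI allI impI)
    fix x y and t :: real assume *: "x \<in> S n" "y \<in> S n" "0 \<le> t \<and> t \<le> 1"
    then have P: "(1 - t) *\<^sub>R x + t *\<^sub>R y \<in> P" using convex unfolding convex_alt S_def by auto
    show "(1 - t) *\<^sub>R x + t *\<^sub>R y \<in> S n"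
    proof (cases "t = 0 \<or> t = 1")
      case False
      let ?k = "ennreal (real (Suc n))"
      have "u ((1 - t) *\<^sub>R x + t *\<^sub>R y) \<le> epow (u x) (1 - t) * epow (u y) t"
        using * by (intro log_convex_onD[OF M1_D(3)[OF u]]) (auto simp: S_def)
      also have "\<dots> \<le> epow ?k (1 - t) * epow ?k t"
        using * False by (intro mult_mono epow_mono) (auto simp: S_def)
      also have "\<dots> = ?k"
        by (simp add: epow_ennreal del: of_nat_Suc ennreal_plus flip: ennreal_mult powr_add)
      finally show ?thesis using P by (simp add: S_def)
    qed (use * in auto)
  qed
  moreover have "\<not> negligible (S n)"
    using n borel_closed[OF clS, of n] by (auto simp: negligible_iff_emeasure0)
  ultimately obtain x0 where "x0 \<in> interior (S n)" using negligible_convex_interior by blast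
  then obtain e where e: "0 < e" "cball x0 e \<subseteq> S n" by (meson mem_interior_cball)
  show ?thesis
    using e by (intro exI[of _ "real (Suc n)"] exI[of _ e] exI[of _ x0]) (auto simp: S_def)
qed

text \<open>The exceptional null set may contain \<open>x\<close>, so \<open>x\<close> is approached
  by points of agreement \<open>z n\<close>, obtained by moving from \<open>x\<close> by the
  fraction \<open>t n\<close> towards points \<open>y n\<close> of a ball on which
  \<open>w \<le> K\<close>. Log-convexity bounds \<open>w (z n)\<close> by
  \<open>r powr (1 - t n) * K powr t n\<close>, which tends to \<open>r = w x\<close>, and lower
  semicontinuity of \<open>v\<close> carries the bound to \<open>v x\<close>.\<close>

lemma M1_le_of_AE_eq:
  assumes v: "v \<in> M1 P mu" and w: "w \<in> M1 P mu" and eq: "AE x in mu. ext P v x = ext P w x" and x: "x \<in> P"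
  shows "v x \<le> w x"
proof (cases "w x")
  case (real r)
  have r: "0 < r" using M1_D(2)[OF w x] real by simp
  obtain K e x0 where K: "1 \<le> (K::real)" "0 < e" "cball x0 e \<subseteq> P" "\<And>x. x \<in> cball x0 e \<Longrightarrow> w x \<le> ennreal K"
    using M1_bounded_on_ball[OF w] by metis
  \<comment> \<open>\<open>Suc (Suc n)\<close> keeps \<open>t n\<close> strictly between 0 and 1
    from the start.\<close>
  define t where "t n = 1 / real (Suc (Suc n))" for n
  have t: "0 < t n" "t n < 1" for n by (auto simp: t_def)
  note [measurable] = M1_D(5)[OF v] M1_D(5)[OF w]
  have "Measurable.pred borel (\<lambda>x. ext P v x = ext P w x)" by measurable
  then have eq: "AE x in lborel. x \<in> P \<longrightarrow> ext P v x = ext P w x"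
    using eq by (simp only: AE_mu_iff)
  have "\<exists>y\<in>cball x0 e. v ((1 - t n) *\<^sub>R x + t n *\<^sub>R y) = w ((1 - t n) *\<^sub>R x + t n *\<^sub>R y)" for n
  proof (rule ccontr)
    assume neq: "\<not> ?thesis"
    \<comment> \<open>The image of \<open>cball x0 e\<close> under the homothety with centre
      \<open>x\<close> and ratio \<open>t n\<close>. It has positive measure, so it cannot lie in
      the exceptional null set.\<close>
    let ?B = "cball ((1 - t n) *\<^sub>R x + t n *\<^sub>R x0) (t n * e)"
    have "AE z in lborel. z \<notin> ?B"
      using eq
    proof eventually_elim
      case (elim z)
      show ?case
      proof
        assume z: "z \<in> ?B"
        define y where "y = x0 + (1 / t n) *\<^sub>R (z - ((1 - t n) *\<^sub>R x + t n *\<^sub>R x0))"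
        have "norm (z - ((1 - t n) *\<^sub>R x + t n *\<^sub>R x0)) \<le> t n * e"
          using z by (simp add: dist_norm norm_minus_commute)
        then have "(1 / t n) * norm (z - ((1 - t n) *\<^sub>R x + t n *\<^sub>R x0)) \<le> e"
          using t[of n] by (simp add: divide_le_eq mult.commute)
        then have y: "y \<in> cball x0 e" using t[of n] by (simp add: y_def dist_norm)
        have zy: "z = (1 - t n) *\<^sub>R x + t n *\<^sub>R y" using t[of n] by (simp add: y_def algebra_simps)
        have "y \<in> P" using y K by auto
        then have "z \<in> P" unfolding zy using x t[of n] convex unfolding convex_alt by simp
        with elim have "v z = w z" by simp
        with neq y zy show False by blast
      qed
    qed
    then have "?B \<in> null_sets lborel" by (subst AE_iff_null_sets) auto
    then have "emeasure lborel ?B = 0" by auto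
    moreover have "interior ?B \<noteq> {}" using t[of n] K(2) mult_pos_pos[of "t n" e] by (simp add: not_le)
    ultimately show False using emeasure_lborel_pos[of ?B] by auto
  qed
  then obtain y where y: "\<And>n. y n \<in> cball x0 e"
    "\<And>n. v ((1 - t n) *\<^sub>R x + t n *\<^sub>R y n) = w ((1 - t n) *\<^sub>R x + t n *\<^sub>R y n)" by metis
  define z where "z n = (1 - t n) *\<^sub>R x + t n *\<^sub>R y n" for n
  have zP: "z n \<in> P" for n
    using convex x y(1)[of n] K(3) t[of n] unfolding convex_alt z_def by (auto simp: less_imp_le)
  have t0: "t \<longlonglongrightarrow> 0"
    unfolding t_def using LIMSEQ_Suc[OF LIMSEQ_inverse_real_of_nat] by (simp add: inverse_eq_divide)
  have "norm (y n - x) \<le> e + norm (x0 - x)" for n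
    using norm_triangle_ineq[of "y n - x0" "x0 - x"] y(1)[of n] by (simp add: dist_norm norm_minus_commute)
  then have "(\<lambda>n. t n *\<^sub>R (y n - x)) \<longlonglongrightarrow> 0"
    by (intro lim_null_scaleR_bounded[OF t0, of _ "e + norm (x0 - x)"]) auto
  then have "(\<lambda>n. x + t n *\<^sub>R (y n - x)) \<longlonglongrightarrow> x + 0" by (intro tendsto_add tendsto_const)
  then have zx: "z \<longlonglongrightarrow> x" by (simp add: z_def[abs_def] algebra_simps)
  have le: "v (z n) \<le> ennreal (r powr (1 - t n) * K powr t n)" for n
  proof -
    have "v (z n) = w (z n)" using y(2)[of n] by (simp add: z_def)
    also have "\<dots> \<le> epow (w x) (1 - t n) * epow (w (y n)) (t n)"
      unfolding z_def using y(1)[of n] K(3) t[of n] x by (intro log_convex_onD[OF M1_D(3)[OF w]]) auto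
    also have "\<dots> \<le> epow (w x) (1 - t n) * epow (ennreal K) (t n)"
      using t[of n] K(4)[OF y(1)] by (intro mult_left_mono epow_mono) auto
    finally show ?thesis using real K by (simp add: epow_ennreal ennreal_mult)
  qed
  have "(\<lambda>n. r powr (1 - t n) * K powr t n) \<longlonglongrightarrow> r powr (1 - 0) * K powr 0"
    using r K(1) by (intro tendsto_mult tendsto_powr tendsto_diff tendsto_const t0) auto
  then have "(\<lambda>n. ennreal (r powr (1 - t n) * K powr t n)) \<longlonglongrightarrow> ennreal r"
    using r K(1) by (auto dest: tendsto_ennrealI)
  then have lim: "liminf (\<lambda>n. ennreal (r powr (1 - t n) * K powr t n)) = ennreal r"
    by (intro lim_imp_Liminf) auto
  have "v x \<le> liminf (\<lambda>n. v (z n))" by (rule lsc_on_tendsto[OF M1_D(1)[OF v] x zP zx])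
  also have "\<dots> \<le> liminf (\<lambda>n. ennreal (r powr (1 - t n) * K powr t n))"
    using le by (intro Liminf_mono) auto
  finally show ?thesis using lim real by simp
qed simp

lemma M1_eq_of_AE_eq:
  assumes "v \<in> M1 P mu" "w \<in> M1 P mu" "AE x in mu. ext P v x = ext P w x" "x \<in> P"
  shows "v x = w x"
proof (rule antisym)
  show "v x \<le> w x" using M1_le_of_AE_eq assms by blast
  have "AE x in mu. ext P w x = ext P v x" using assms(3) by eventually_elim simp
  then show "w x \<le> v x" using M1_le_of_AE_eq assms by blast
qed

lemma one_in_M1: "(\<lambda>_. 1) \<in> M1 P mu"
proof -
  have "epow 1 t = 1" for t using epow_ennreal[of 1 t] by simp
  then show ?thesis by (simp add: M1_iff lsc_on_def log_convex_on_def ext_def mu_P)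
qed

lemma D_one: "D (\<lambda>_. 1) = 0"
  by (simp add: D_def ext_def)

section \<open>Midpoints and strict convexity\<close>

definition mid :: "('a \<Rightarrow> ennreal) \<Rightarrow> ('a \<Rightarrow> ennreal) \<Rightarrow> 'a \<Rightarrow> ennreal" where
  "mid v w x = (v x + w x) / 2"

lemma ext_mid: "ext P (mid v w) x = (ext P v x + ext P w x) / 2"
proof -
  have "1 + 1 = (2::ennreal)" "2 / 2 = (1::ennreal)" by (simp_all add: ennreal_divide_self)
  then show ?thesis by (simp only: ext_def mid_def split: if_split) simp
qed

lemma mid_in_M1:
  assumes v: "v \<in> M1 P mu" and w: "w \<in> M1 P mu"
  shows "mid v w \<in> M1 P mu"
proof -
  define M where "M = density (count_space (UNIV :: bool set)) (\<lambda>_. 1 / 2)"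
  define f where "f x i = (if i then v x else w x)" for x i
  have F: "mid v w = (\<lambda>x. \<integral>\<^sup>+i. f x i \<partial>M)"
    unfolding M_def
    by (auto simp: nn_integral_density nn_integral_count_space_finite f_def mid_def UNIV_bool
        add_divide_distrib_ennreal ennreal_times_divide[symmetric] divide_ennreal_def algebra_simps fun_eq_iff)
  have "emeasure M (space M) \<noteq> 0"
    unfolding M_def by (subst emeasure_density)
      (auto simp: nn_integral_count_space_finite UNIV_bool ennreal_divide_eq_0_iff)
  moreover have "f x \<in> borel_measurable M" for x by (simp add: M_def)
  moreover have "lsc_on P (\<lambda>x. f x i)" "log_convex_on P (\<lambda>x. f x i)" "\<And>x. x \<in> P \<Longrightarrow> 0 < f x i" for i
    using M1_D(1-3)[OF v] M1_D(1-3)[OF w] by (cases i; simp add: f_def)+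
  ultimately have "lsc_on P (mid v w)" "\<And>x. x \<in> P \<Longrightarrow> 0 < mid v w x" "log_convex_on P (mid v w)"
    unfolding F by (intro mixture convex; simp)+
  moreover have "(\<integral>\<^sup>+x. ext P (mid v w) x \<partial>mu) = ennreal V"
  proof -
    have "(\<integral>\<^sup>+x. ext P (mid v w) x \<partial>mu) = (ennreal V + ennreal V) / 2"
      unfolding ext_mid M1_D(4)[OF v, symmetric] using M1_D(5)[OF v] M1_D(5)[OF w]
      by (simp add: nn_integral_divide nn_integral_add M1_D(4)[OF v] M1_D(4)[OF w])
    also have "\<dots> = ennreal V" using V_pos by (simp flip: ennreal_plus ennreal_numeral add: divide_ennreal)
    finally show ?thesis .
  qed
  ultimately show ?thesis by (simp add: M1_iff)
qed

text \<open>For the second claim the nonnegative gap \<open>g x - f x\<close> is integrated.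
  Equality of finite integrals makes it vanish almost everywhere, \<open>psi_midpoint_eq\<close>
  turns this into agreement almost everywhere, and \<open>M1_eq_of_AE_eq\<close> extends the
  agreement to every point of \<open>P\<close>.\<close>

lemma D_mid:
  assumes v: "v \<in> M1 P mu" and w: "w \<in> M1 P mu"
  shows "2 * D (mid v w) \<le> D v + D w"
    and "2 * D (mid v w) = D v + D w \<Longrightarrow> D v + D w < top \<Longrightarrow> x \<in> P \<Longrightarrow> v x = w x"
proof -
  note [measurable] = M1_D(5)[OF v] M1_D(5)[OF w]
  define f where "f x = 2 * psi ((ext P v x + ext P w x) / 2)" for x
  define g where "g x = psi (ext P v x) + psi (ext P w x)" for x
  have [measurable]: "f \<in> borel_measurable borel" "g \<in> borel_measurable borel"
    unfolding f_def g_def by measurable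
  have fg: "f x \<le> g x" for x unfolding f_def g_def by (rule psi_midpoint)
  have f: "(\<integral>\<^sup>+x. f x \<partial>mu) = 2 * D (mid v w)"
    unfolding f_def D_def ext_mid by (subst nn_integral_cmult) auto
  have g: "(\<integral>\<^sup>+x. g x \<partial>mu) = D v + D w"
    unfolding g_def D_def by (subst nn_integral_add) auto
  show "2 * D (mid v w) \<le> D v + D w"
    unfolding f[symmetric] g[symmetric] by (intro nn_integral_mono fg)
  show "v x = w x" if eq: "2 * D (mid v w) = D v + D w" and fin: "D v + D w < top" and x: "x \<in> P"
  proof (rule M1_eq_of_AE_eq[OF v w _ x])
    have "(\<integral>\<^sup>+x. g x - f x \<partial>mu) = (\<integral>\<^sup>+x. g x \<partial>mu) - (\<integral>\<^sup>+x. f x \<partial>mu)"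
      using fin fg by (intro nn_integral_diff) (auto simp: f eq)
    also have "\<dots> = 0" using fin unfolding f g eq by (intro diff_eq_0_ennreal) auto
    finally have 1: "AE x in mu. g x - f x = 0" by (subst (asm) nn_integral_0_iff_AE) auto
    have 2: "AE x in mu. g x \<noteq> \<infinity>"
      by (intro nn_integral_noteq_infinite) (use fin g in auto)
    from 1 2 show "AE x in mu. ext P v x = ext P w x"
    proof eventually_elim
      case (elim x)
      have "g x \<le> f x" using elim(1) by (rule ennreal_minus_eq_0)
      with fg[of x] have "f x = g x" by (rule antisym)
      moreover have "psi (ext P v x) \<noteq> \<infinity>" "psi (ext P w x) \<noteq> \<infinity>"
        using elim(2) by (simp_all add: g_def)
      ultimately show ?case unfolding f_def g_def by (rule psi_midpoint_eq)
    qed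
  qed
qed

end

lemma body_Times:
  assumes "body P1 mu1 c1" "body P2 mu2 c2"
  shows "body (P1 \<times> P2) (mu1 \<Otimes>\<^sub>M mu2) (c1 * c2)"
proof -
  interpret b1: body P1 mu1 c1 by fact
  interpret b2: body P2 mu2 c2 by fact
  show ?thesis
  proof
    have "mu1 \<Otimes>\<^sub>M mu2 = density lborel (\<lambda>x. ennreal c1 * indicator P1 x) \<Otimes>\<^sub>M density lborel (\<lambda>x. ennreal c2 * indicator P2 x)"
      by (simp only: b1.mu_def b2.mu_def)
    also have "\<dots> = density (lborel \<Otimes>\<^sub>M lborel)
        (\<lambda>(x, y). (ennreal c1 * indicator P1 x) * (ennreal c2 * indicator P2 y))"
      by (intro pair_measure_density lborel.sigma_finite_measure_axioms
          b2.sigma_finite_measure_axioms[unfolded b2.mu_def]) auto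
    also have "(\<lambda>(x, y). (ennreal c1 * indicator P1 x) * (ennreal c2 * indicator P2 y))
       = (\<lambda>z. ennreal (c1 * c2) * indicator (P1 \<times> P2) z :: ennreal)"
      using b1.c_pos b2.c_pos by (auto simp: indicator_def ennreal_mult fun_eq_iff)
    finally show "mu1 \<Otimes>\<^sub>M mu2 = density lborel (\<lambda>z. ennreal (c1 * c2) * indicator (P1 \<times> P2) z)"
      by (simp add: lborel_prod)
    show "compact (P1 \<times> P2)" using b1.compact b2.compact by (rule compact_Times)
    show "convex (P1 \<times> P2)" using b1.convex b2.convex by (rule convex_Times)
    show "interior (P1 \<times> P2) \<noteq> {}" using b1.interior b2.interior by (simp add: interior_Times)
    show "0 < c1 * c2" using b1.c_pos b2.c_pos by simp
  qed
qed

section \<open>Marginals and products\<close>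

lemma ennreal_mult_divide_cancel:
  "0 < b \<Longrightarrow> b < \<infinity> \<Longrightarrow> b * (a / b) = (a::ennreal)"
  by (metis ennreal_mult_divide_eq ennreal_times_divide infinity_ennreal_def mult.commute not_less_zero order_less_irrefl)

lemma nn_integral_add4:
  assumes "f \<in> borel_measurable M" "g \<in> borel_measurable M" "h \<in> borel_measurable M" "k \<in> borel_measurable M"
  shows "(\<integral>\<^sup>+x. f x + g x + h x + k x \<partial>M)
    = (\<integral>\<^sup>+x. f x \<partial>M) + (\<integral>\<^sup>+x. g x \<partial>M) + (\<integral>\<^sup>+x. h x \<partial>M) + (\<integral>\<^sup>+x. k x \<partial>M)"
  using assms by (simp add: nn_integral_add)

section \<open>Sums of measures\<close>

lemma emeasure_measure_add:
  assumes "sets M = sets N" "A \<in> sets M"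
  shows "emeasure (measure_add M N) A = emeasure M A + emeasure N A"
proof (rule emeasure_measure_of[OF measure_add_def])
  show "countably_additive (sets (measure_add M N)) (\<lambda>A. emeasure M A + emeasure N A)"
  proof (rule countably_additiveI)
    fix F :: "nat \<Rightarrow> 'a set" assume F: "range F \<subseteq> sets (measure_add M N)" "disjoint_family F"
    have "sets (measure_add M N) = sets M" by (simp add: measure_add_def)
    then have F': "range F \<subseteq> sets M" "range F \<subseteq> sets N" using F assms by auto
    then show "(\<Sum>i. emeasure M (F i) + emeasure N (F i)) = emeasure M (\<Union>i. F i) + emeasure N (\<Union>i. F i)"
      using F(2) by (simp add: suminf_add[symmetric] suminf_emeasure)
  qed
next
  have "sets (measure_add M N) = sets M" by (simp add: measure_add_def)
  then show "A \<in> sets (measure_add M N)" using assms by simp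
qed (use sets.space_closed in \<open>auto simp: positive_def\<close>)

lemma nn_integral_measure_add:
  assumes sets: "sets M = sets N" and f: "f \<in> borel_measurable M"
  shows "(\<integral>\<^sup>+x. f x \<partial>measure_add M N) = (\<integral>\<^sup>+x. f x \<partial>M) + (\<integral>\<^sup>+x. f x \<partial>N)"
proof -
  have s [measurable_cong]: "sets (measure_add M N) = sets M" by (simp add: measure_add_def)
  note [measurable_cong] = sets
  have sp: "space (measure_add M N) = space M" "space N = space M"
    using sets_eq_imp_space_eq[OF s] sets_eq_imp_space_eq[OF sets] by simp_all
  show ?thesis using f
  proof (induction rule: borel_measurable_induct)
    case (cong f g)
    have "(\<integral>\<^sup>+x. f x \<partial>K) = (\<integral>\<^sup>+x. g x \<partial>K)" if "space K = space M" for K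
      using cong that by (intro nn_integral_cong) auto
    then show ?case using cong sp by metis
  next
    case (set A)
    then have "A \<in> sets N" "A \<in> sets (measure_add M N)" using sets s by auto
    then show ?case using set by (simp add: emeasure_measure_add[OF sets])
  next
    case (mult u c)
    note [measurable] = mult(2)
    show ?case using mult by (simp add: nn_integral_cmult distrib_left)
  next
    case (add u v)
    note [measurable] = add(1,3)
    show ?case using add by (simp add: nn_integral_add ac_simps)
  next
    case (seq U)
    note [measurable] = seq(1)
    have "(\<integral>\<^sup>+x. (SUP i. U i) x \<partial>K) = (SUP i. \<integral>\<^sup>+x. U i x \<partial>K)" if [measurable_cong]: "sets K = sets M" for K
      unfolding SUP_apply using seq(3) by (intro nn_integral_monotone_convergence_SUP) auto
    note this[OF s] this[OF refl] this[OF sets[symmetric]]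
    moreover have inc: "incseq (\<lambda>i. \<integral>\<^sup>+x. U i x \<partial>K)" for K
      using seq(3) by (auto simp: mono_def le_fun_def intro!: nn_integral_mono)
    ultimately show ?case using seq ennreal_SUP_add[OF inc[of M] inc[of N]] by simp
  qed
qed

section \<open>Semicontinuity and log-convexity under composition and products\<close>

lemma lsc_on_const: "lsc_on P (\<lambda>_. k)"
  by (auto simp: lsc_on_def)

lemma log_convex_on_one: "log_convex_on P (\<lambda>_. 1)"
  using epow_ennreal[of 1] by (auto simp: log_convex_on_def)

lemma lsc_on_compose:
  fixes u :: "'b::first_countable_topology \<Rightarrow> ennreal" and h :: "'a::first_countable_topology \<Rightarrow> 'b"
  assumes "lsc_on Q u" "continuous_on UNIV h" "\<And>x. x \<in> P \<Longrightarrow> h x \<in> Q"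
  shows "lsc_on P (\<lambda>x. u (h x))"
proof (rule lsc_onI_sequentially)
  fix x s assume "x \<in> P" "\<And>n. s n \<in> P" "s \<longlonglongrightarrow> x"
  moreover have "(\<lambda>n. h (s n)) \<longlonglongrightarrow> h x"
    using continuous_on_tendsto_compose[OF assms(2) \<open>s \<longlonglongrightarrow> x\<close>] by simp
  ultimately show "u (h x) \<le> liminf (\<lambda>n. u (h (s n)))"
    using assms by (intro lsc_on_tendsto[OF assms(1)]) auto
qed

lemma log_convex_on_compose:
  assumes "log_convex_on Q u" "\<And>x. x \<in> P \<Longrightarrow> h x \<in> Q"
    and "\<And>x y t. h ((1 - t) *\<^sub>R x + t *\<^sub>R y) = (1 - t) *\<^sub>R h x + t *\<^sub>R h y"
  shows "log_convex_on P (\<lambda>x. u (h x))"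
  using assms by (auto simp: log_convex_on_def)

lemma lsc_on_mult:
  fixes u v :: "'a::topological_space \<Rightarrow> ennreal"
  assumes "lsc_on P u" "lsc_on P v" "\<And>x. x \<in> P \<Longrightarrow> 0 < u x" "\<And>x. x \<in> P \<Longrightarrow> 0 < v x"
  shows "lsc_on P (\<lambda>x. u x * v x)"
  unfolding lsc_on_def
proof (intro ballI allI impI)
  fix x c assume x: "x \<in> P" and c: "c < u x * v x"
  obtain a b where ab: "a < u x" "b < v x" "c < a * b"
    using ennreal_less_mult_obtain[OF c assms(3)[OF x] assms(4)[OF x]] by blast
  have "eventually (\<lambda>y. a < u y) (at x within P)" "eventually (\<lambda>y. b < v y) (at x within P)"
    using assms(1,2) x ab by (auto simp: lsc_on_def)
  then show "eventually (\<lambda>y. c < u y * v y) (at x within P)"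
  proof eventually_elim
    case (elim y)
    have "a * b \<le> u y * v y" using elim by (intro mult_mono) auto
    with ab(3) show ?case by (rule less_le_trans)
  qed
qed

lemma log_convex_on_mult:
  assumes "log_convex_on P u" "log_convex_on P v" "\<And>x. x \<in> P \<Longrightarrow> 0 < u x" "\<And>x. x \<in> P \<Longrightarrow> 0 < v x"
  shows "log_convex_on P (\<lambda>x. u x * v x)"
proof (rule log_convex_onI)
  fix x y and t :: real assume *: "x \<in> P" "y \<in> P" "0 < t" "t < 1"
  have "u ((1 - t) *\<^sub>R x + t *\<^sub>R y) * v ((1 - t) *\<^sub>R x + t *\<^sub>R y)
    \<le> (epow (u x) (1 - t) * epow (u y) t) * (epow (v x) (1 - t) * epow (v y) t)"
    using * by (intro mult_mono log_convex_onD[OF assms(1)] log_convex_onD[OF assms(2)]) auto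
  also have "\<dots> = epow (u x * v x) (1 - t) * epow (u y * v y) t"
    using * assms(3,4) by (simp add: epow_mult ac_simps)
  finally show "u ((1 - t) *\<^sub>R x + t *\<^sub>R y) * v ((1 - t) *\<^sub>R x + t *\<^sub>R y)
    \<le> epow (u x * v x) (1 - t) * epow (u y * v y) t" .
next
  fix x assume "x \<in> P"
  then have "0 < u x" "0 < v x" using assms by auto
  then show "0 < u x * v x" by (simp add: ennreal_zero_less_mult_iff)
qed

text \<open>Division by the volume of \<open>Q\<close> turns the marginal into an average against a
  probability measure, so \<open>mixture\<close> applies and the integral of the average over
  \<open>P\<close> is again the volume of \<open>P\<close>.\<close>

lemma marginal_in_M1:
  fixes g :: "'a::euclidean_space \<Rightarrow> 'b::euclidean_space \<Rightarrow> ennreal"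
  assumes "body P mu c" "body Q nu d"
    and meas: "\<And>x. g x \<in> borel_measurable borel" and pos: "\<And>x y. 0 < g x y"
    and lsc: "\<And>y. lsc_on P (\<lambda>x. g x y)" and lc: "\<And>y. log_convex_on P (\<lambda>x. g x y)"
    and int: "(\<integral>\<^sup>+x. \<integral>\<^sup>+y. g x y \<partial>nu \<partial>mu) = ennreal (vol P mu) * ennreal (vol Q nu)"
    and meas': "(\<lambda>x. \<integral>\<^sup>+y. g x y \<partial>nu) \<in> borel_measurable borel"
  shows "(\<lambda>x. (\<integral>\<^sup>+y. g x y \<partial>nu) / ennreal (vol Q nu)) \<in> M1 P mu"
proof -
  interpret p: body P mu c by fact
  interpret q: body Q nu d by fact
  define M where "M = density nu (\<lambda>_. 1 / ennreal q.V)"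
  have F: "(\<integral>\<^sup>+y. g x y \<partial>nu) / ennreal (vol Q nu) = (\<integral>\<^sup>+y. g x y \<partial>M)" for x
    unfolding M_def using meas
    by (subst nn_integral_density)
      (auto simp: nn_integral_multc q.V_def[symmetric] divide_ennreal_def mult.commute)
  have "emeasure M (space M) = 1 / ennreal q.V * ennreal q.V"
    unfolding M_def by (subst emeasure_density) (auto simp: q.mu_P nn_integral_cmult)
  also have "\<dots> \<noteq> 0" using q.V_pos by (simp add: ennreal_divide_times ennreal_divide_self)
  finally have "emeasure M (space M) \<noteq> 0" .
  then have "lsc_on P (\<lambda>x. \<integral>\<^sup>+y. g x y \<partial>M)" "\<And>x. x \<in> P \<Longrightarrow> 0 < (\<integral>\<^sup>+y. g x y \<partial>M)"
    "log_convex_on P (\<lambda>x. \<integral>\<^sup>+y. g x y \<partial>M)"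
    using meas pos lsc lc by (intro mixture p.convex; simp add: M_def)+
  moreover have "(\<integral>\<^sup>+x. ext P (\<lambda>x. \<integral>\<^sup>+y. g x y \<partial>M) x \<partial>mu) = ennreal p.V"
  proof -
    have "(\<integral>\<^sup>+x. ext P (\<lambda>x. \<integral>\<^sup>+y. g x y \<partial>M) x \<partial>mu) = (\<integral>\<^sup>+x. (\<integral>\<^sup>+y. g x y \<partial>M) \<partial>mu)"
      by (intro nn_integral_cong_AE eventually_mono[OF p.AE_mu]) auto
    also have "\<dots> = (\<integral>\<^sup>+x. (\<integral>\<^sup>+y. g x y \<partial>nu) / ennreal q.V \<partial>mu)"
      unfolding F[symmetric] q.V_def ..
    also have "\<dots> = ennreal p.V * ennreal q.V / ennreal q.V"
      using meas' by (simp add: nn_integral_divide int p.V_def q.V_def)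
    also have "\<dots> = ennreal p.V" using q.V_pos p.V_pos by (simp add: divide_ennreal flip: ennreal_mult)
    finally show ?thesis .
  qed
  ultimately show ?thesis unfolding F by (simp add: p.M1_iff)
qed

text \<open>The boundary measures enter only through finiteness and concentration on the frontier.\<close>

definition boundary_measure :: "'c::euclidean_space set \<Rightarrow> 'c measure \<Rightarrow> bool" where
  "boundary_measure P sg \<longleftrightarrow> sets sg = sets borel \<and> finite_measure sg \<and> emeasure sg (- frontier P) = 0"

lemma boundary_measure_AE:
  assumes "boundary_measure P sg" shows "AE x in sg. x \<in> frontier P"
proof -
  have "- frontier P \<in> null_sets sg"
    using assms by (intro null_setsI) (auto simp: boundary_measure_def intro: borel_open)
  then have "AE x in sg. x \<notin> - frontier P" by (rule AE_not_in)
  then show ?thesis by simp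
qed

text \<open>The closed set \<open>P\<close> contains its frontier, where \<open>ext P u\<close> and
  \<open>u\<close> agree, and \<open>ext P u\<close> is Borel for \<open>u\<close> in
  \<open>M1\<close>.\<close>

lemma internal_energy_eq:
  assumes "boundary_measure P sg" "closed P"
  shows "internal_energy P mu sg u = ennreal (1 / vol P mu) * (\<integral>\<^sup>+x. ext P u x \<partial>sg)"
proof -
  have "frontier P \<subseteq> P" using assms(2) by (simp add: frontier_subset_eq)
  then have "AE x in sg. u x * indicator (frontier P) x = ext P u x"
    using boundary_measure_AE[OF assms(1)] by (auto elim!: eventually_mono)
  then show ?thesis unfolding internal_energy_def by (simp add: nn_integral_cong_AE)
qed

lemma ext_ext: "ext A (ext A u) = ext A u"
  by (auto simp: ext_def)

section \<open>The composite of two bodies\<close>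

locale two_bodies = b1: body P1 mu1 c1 + b2: body P2 mu2 c2
  for P1 :: "'a::euclidean_space set" and mu1 c1 and P2 :: "'b::euclidean_space set" and mu2 c2
begin

abbreviation "PP \<equiv> P1 \<times> P2"
abbreviation "mm \<equiv> mu1 \<Otimes>\<^sub>M mu2"

sublocale b: body PP mm "c1 * c2"
  by (rule body_Times) unfold_locales

sublocale pair_sigma_finite mu1 mu2 ..

lemma V_eq: "ennreal b.V = ennreal b1.V * ennreal b2.V" "b.V = b1.V * b2.V"
proof -
  have "emeasure mm (P1 \<times> P2) = emeasure mu1 P1 * emeasure mu2 P2"
    by (intro b2.emeasure_pair_measure_Times) auto
  then show 1: "ennreal b.V = ennreal b1.V * ennreal b2.V"
    by (simp add: b.mu_P b1.mu_P b2.mu_P)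
  then show "b.V = b1.V * b2.V"
    using b.V_pos b1.V_pos b2.V_pos by (simp flip: ennreal_mult)
qed

lemma measurable_pair_iff:
  fixes f :: "'a \<times> 'b \<Rightarrow> ennreal"
  shows "f \<in> borel_measurable borel \<longleftrightarrow> f \<in> borel_measurable (mu1 \<Otimes>\<^sub>M mu2)"
proof -
  have "borel_measurable (borel :: ('a \<times> 'b) measure) = (borel_measurable mm :: ('a \<times> 'b \<Rightarrow> ennreal) set)"
    using b.sets_mu by (intro measurable_cong_sets) auto
  then show ?thesis by simp
qed

lemma nn_integral_fst':
  assumes "f \<in> borel_measurable borel"
  shows "(\<integral>\<^sup>+z. f z \<partial>mm) = (\<integral>\<^sup>+x. \<integral>\<^sup>+y. f (x, y) \<partial>mu2 \<partial>mu1)"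
  using assms b2.nn_integral_fst[of f mu1] by (simp add: measurable_pair_iff)

lemma nn_integral_snd':
  assumes "f \<in> borel_measurable borel"
  shows "(\<integral>\<^sup>+z. f z \<partial>mm) = (\<integral>\<^sup>+y. \<integral>\<^sup>+x. f (x, y) \<partial>mu1 \<partial>mu2)"
  using assms nn_integral_snd[of f] by (simp add: measurable_pair_iff)

definition marg1 :: "('a \<times> 'b \<Rightarrow> ennreal) \<Rightarrow> 'a \<Rightarrow> ennreal" where
  "marg1 v x = (\<integral>\<^sup>+y. ext PP v (x, y) \<partial>mu2) / ennreal b2.V"

definition marg2 :: "('a \<times> 'b \<Rightarrow> ennreal) \<Rightarrow> 'b \<Rightarrow> ennreal" where
  "marg2 v y = (\<integral>\<^sup>+x. ext PP v (x, y) \<partial>mu1) / ennreal b1.V"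

lemma int_marg: "(\<integral>\<^sup>+y. ext PP v (x, y) \<partial>mu2) = ennreal b2.V * marg1 v x"
  "(\<integral>\<^sup>+x. ext PP v (x, y) \<partial>mu1) = ennreal b1.V * marg2 v y"
proof -
  have "ennreal r * (x / ennreal r) = x" if "0 < r" for r x
    using that by (intro ennreal_mult_divide_cancel) auto
  then show "(\<integral>\<^sup>+y. ext PP v (x, y) \<partial>mu2) = ennreal b2.V * marg1 v x"
    "(\<integral>\<^sup>+x. ext PP v (x, y) \<partial>mu1) = ennreal b1.V * marg2 v y"
    unfolding marg1_def marg2_def using b1.V_pos b2.V_pos by simp_all
qed

text \<open>Off \<open>P1\<close> the slice of \<open>ext PP v\<close> is constantly 1, and so is
  its average. The default value 1 of \<open>ext\<close> thus reproduces itself, and marginals of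
  members of \<open>M1\<close> are Borel on the whole space.\<close>

lemma ext_marg: "ext P1 (marg1 v) = marg1 v" "ext P2 (marg2 v) = marg2 v"
  using b1.V_pos b2.V_pos
  by (auto simp: ext_def marg1_def marg2_def b1.mu_P b2.mu_P ennreal_divide_self fun_eq_iff)

lemma slice_measurable:
  assumes "f \<in> borel_measurable borel"
  shows "(\<lambda>y. f (x, y)) \<in> borel_measurable borel" "(\<lambda>x. f (x, y)) \<in> borel_measurable borel"
    "(\<lambda>x. \<integral>\<^sup>+y. f (x, y) \<partial>mu2) \<in> borel_measurable borel"
    "(\<lambda>y. \<integral>\<^sup>+x. f (x, y) \<partial>mu1) \<in> borel_measurable borel"
proof -
  have [measurable]: "f \<in> borel_measurable (borel \<Otimes>\<^sub>M borel)" using assms by (simp add: borel_prod)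
  show "(\<lambda>y. f (x, y)) \<in> borel_measurable borel" "(\<lambda>x. f (x, y)) \<in> borel_measurable borel"
    "(\<lambda>x. \<integral>\<^sup>+y. f (x, y) \<partial>mu2) \<in> borel_measurable borel"
    by measurable
  show "(\<lambda>y. \<integral>\<^sup>+x. f (x, y) \<partial>mu1) \<in> borel_measurable borel"
    by measurable
qed

lemma marg_in_M1:
  assumes v: "v \<in> M1 PP mm"
  shows "marg1 v \<in> M1 P1 mu1" "marg2 v \<in> M1 P2 mu2"
proof -
  note D = b.M1_D[OF v]
  \<comment> \<open>For \<open>y\<close> outside \<open>P2\<close> the slice is the constant 1,
    which has the required properties; hence \<open>marginal_in_M1\<close> may quantify over all
    \<open>y\<close>.\<close>
  have lsc1: "lsc_on P1 (\<lambda>x. ext PP v (x, y))" for y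
  proof (cases "y \<in> P2")
    case True
    have "lsc_on P1 (\<lambda>x. v (x, y))"
      using True by (intro lsc_on_compose[OF D(1)] continuous_intros) auto
    moreover have "lsc_on P1 (\<lambda>x. ext PP v (x, y)) = lsc_on P1 (\<lambda>x. v (x, y))"
      unfolding lsc_on_def using True by (intro ball_cong all_cong imp_cong refl) (auto simp: eventually_at_filter)
    ultimately show ?thesis by simp
  qed (simp add: lsc_on_const)
  have lsc2: "lsc_on P2 (\<lambda>y. ext PP v (x, y))" for x
  proof (cases "x \<in> P1")
    case True
    have "lsc_on P2 (\<lambda>y. v (x, y))"
      using True by (intro lsc_on_compose[OF D(1)] continuous_intros) auto
    moreover have "lsc_on P2 (\<lambda>y. ext PP v (x, y)) = lsc_on P2 (\<lambda>y. v (x, y))"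
      unfolding lsc_on_def using True by (intro ball_cong all_cong imp_cong refl) (auto simp: eventually_at_filter)
    ultimately show ?thesis by simp
  qed (simp add: lsc_on_const)
  have lc1: "log_convex_on P1 (\<lambda>x. ext PP v (x, y))" for y
  proof (cases "y \<in> P2")
    case True
    have "log_convex_on P1 (\<lambda>x. v (x, y))"
      using True by (intro log_convex_on_compose[OF D(3)]) (auto simp: algebra_simps)
    moreover have "(1 - t) *\<^sub>R x + t *\<^sub>R x' \<in> P1" if "x \<in> P1" "x' \<in> P1" "t \<in> {0..1}" for x x' t
      using b1.convex that by (auto simp: convex_alt)
    ultimately show ?thesis using True by (simp add: log_convex_on_def)
  qed (simp add: log_convex_on_one)
  have lc2: "log_convex_on P2 (\<lambda>y. ext PP v (x, y))" for x
  proof (cases "x \<in> P1")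
    case True
    have "log_convex_on P2 (\<lambda>y. v (x, y))"
      using True by (intro log_convex_on_compose[OF D(3)]) (auto simp: algebra_simps)
    moreover have "(1 - t) *\<^sub>R y + t *\<^sub>R y' \<in> P2" if "y \<in> P2" "y' \<in> P2" "t \<in> {0..1}" for y y' t
      using b2.convex that by (auto simp: convex_alt)
    ultimately show ?thesis using True by (simp add: log_convex_on_def)
  qed (simp add: log_convex_on_one)
  show "marg1 v \<in> M1 P1 mu1"
    unfolding marg1_def[abs_def] b2.V_def
  proof (rule marginal_in_M1[OF b1.body_axioms b2.body_axioms _ D(6) lsc1 lc1])
    show "(\<integral>\<^sup>+x. \<integral>\<^sup>+y. ext PP v (x, y) \<partial>mu2 \<partial>mu1) = ennreal (vol P1 mu1) * ennreal (vol P2 mu2)"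
      using nn_integral_fst'[OF D(5)] D(4) V_eq by (simp add: b1.V_def b2.V_def)
  qed (rule slice_measurable[OF D(5)])+
  show "marg2 v \<in> M1 P2 mu2"
    unfolding marg2_def[abs_def] b1.V_def
  proof (rule marginal_in_M1[OF b2.body_axioms b1.body_axioms _ D(6) lsc2 lc2])
    show "(\<integral>\<^sup>+y. \<integral>\<^sup>+x. ext PP v (x, y) \<partial>mu1 \<partial>mu2) = ennreal (vol P2 mu2) * ennreal (vol P1 mu1)"
      using nn_integral_snd'[OF D(5)] D(4) V_eq by (simp add: b1.V_def b2.V_def mult.commute)
  qed (rule slice_measurable[OF D(5)])+
qed

text \<open>Only almost everywhere: at a point with \<open>x\<close> in \<open>P1\<close> and
  \<open>y\<close> outside \<open>P2\<close> the left side is 1 and the right side is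
  \<open>u1 x\<close>.\<close>

lemma AE_ext_prod: "AE z in mm. ext PP (\<lambda>(x, y). u1 x * u2 y) z = ext P1 u1 (fst z) * ext P2 u2 (snd z)"
  using b.AE_mu by eventually_elim auto

lemma nn_integral_prod:
  assumes "f \<in> borel_measurable borel" "g \<in> borel_measurable borel"
  shows "(\<integral>\<^sup>+z. f (fst z) * g (snd z) \<partial>mm) = (\<integral>\<^sup>+x. f x \<partial>mu1) * (\<integral>\<^sup>+y. g y \<partial>mu2)"
proof -
  have [measurable]: "f \<in> borel_measurable mu1" "g \<in> borel_measurable mu2"
    using assms by (simp_all cong: measurable_cong_sets)
  have "(\<integral>\<^sup>+z. f (fst z) * g (snd z) \<partial>mm) = (\<integral>\<^sup>+x. \<integral>\<^sup>+y. f x * g y \<partial>mu2 \<partial>mu1)"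
    by (subst b2.nn_integral_fst[symmetric]) auto
  also have "\<dots> = (\<integral>\<^sup>+x. f x \<partial>mu1) * (\<integral>\<^sup>+y. g y \<partial>mu2)"
    by (simp add: nn_integral_cmult nn_integral_multc)
  finally show ?thesis .
qed

lemma prod_in_M1:
  assumes u1: "u1 \<in> M1 P1 mu1" and u2: "u2 \<in> M1 P2 mu2"
  shows "(\<lambda>(x, y). u1 x * u2 y) \<in> M1 PP mm"
proof -
  note D1 = b1.M1_D[OF u1] and D2 = b2.M1_D[OF u2]
  have *: "(\<lambda>(x, y). u1 x * u2 y) = (\<lambda>z. u1 (fst z) * u2 (snd z))" by auto
  have lsc: "lsc_on PP (\<lambda>z. u1 (fst z))" "lsc_on PP (\<lambda>z. u2 (snd z))"
    by (intro lsc_on_compose[OF D1(1)] lsc_on_compose[OF D2(1)] continuous_intros; auto)+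
  have lc: "log_convex_on PP (\<lambda>z. u1 (fst z))" "log_convex_on PP (\<lambda>z. u2 (snd z))"
    by (rule log_convex_on_compose[OF D1(3)] log_convex_on_compose[OF D2(3)]; auto)+
  have pos: "\<And>z. z \<in> PP \<Longrightarrow> 0 < u1 (fst z)" "\<And>z. z \<in> PP \<Longrightarrow> 0 < u2 (snd z)"
    using D1(2) D2(2) by auto
  have "lsc_on PP (\<lambda>(x, y). u1 x * u2 y)" "log_convex_on PP (\<lambda>(x, y). u1 x * u2 y)"
    unfolding * by (intro lsc_on_mult log_convex_on_mult lsc lc pos; assumption)+
  moreover have "(\<integral>\<^sup>+z. ext PP (\<lambda>(x, y). u1 x * u2 y) z \<partial>mm) = ennreal b.V"
    using nn_integral_prod[OF D1(5) D2(5)] nn_integral_cong_AE[OF AE_ext_prod]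
    by (simp add: D1(4) D2(4) V_eq(1))
  ultimately show ?thesis
    using D1(2) D2(2) by (auto simp: b.M1_iff ennreal_zero_less_mult_iff)
qed

text \<open>\<open>psi_mult\<close> at \<open>a = u1 x\<close> and \<open>b = u2 y\<close>,
  integrated. In the two mixed terms the integrals factor and the factor without \<open>psi\<close>
  contributes its mass. Of the remaining terms, two on each side equal \<open>b1.V * b2.V\<close>
  and cancel.\<close>

lemma D_prod:
  assumes u1: "u1 \<in> M1 P1 mu1" and u2: "u2 \<in> M1 P2 mu2"
  shows "b.D (\<lambda>(x, y). u1 x * u2 y) = ennreal b2.V * b1.D u1 + ennreal b1.V * b2.D u2"
proof -
  note D1 = b1.M1_D[OF u1] and D2 = b2.M1_D[OF u2]
  note [measurable] = D1(5) D2(5)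
  let ?f = "ext P1 u1" and ?g = "ext P2 u2"
  let ?w = "\<lambda>z. ?f (fst z) * ?g (snd z)"
  have f: "?f \<in> borel_measurable mu1" and g: "?g \<in> borel_measurable mu2"
    using D1(5) D2(5) by (simp_all cong: measurable_cong_sets)
  have m1: "(\<lambda>z. h (?f (fst z))) \<in> borel_measurable mm" and m2: "(\<lambda>z. h (?g (snd z))) \<in> borel_measurable mm"
    if [measurable]: "h \<in> borel_measurable borel" for h :: "ennreal \<Rightarrow> ennreal"
    using f g by measurable
  note m = m1[of "\<lambda>x. x"] m2[of "\<lambda>x. x"] m1[of psi] m2[of psi]
  have [measurable]: "(\<lambda>z. ?f (fst z)) \<in> borel_measurable mm" "(\<lambda>z. ?g (snd z)) \<in> borel_measurable mm"
    using m by auto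
  have D: "b.D (\<lambda>(x, y). u1 x * u2 y) = (\<integral>\<^sup>+z. psi (?w z) \<partial>mm)"
    unfolding b.D_def by (intro nn_integral_cong_AE eventually_mono[OF AE_ext_prod[of u1 u2]]) simp
  have i1: "(\<integral>\<^sup>+z. ?f (fst z) \<partial>mm) = ennreal b1.V * ennreal b2.V"
    using nn_integral_prod[of ?f "\<lambda>_. 1"] by (simp add: D1(4) b2.mu_P)
  have i2: "(\<integral>\<^sup>+z. ?g (snd z) \<partial>mm) = ennreal b1.V * ennreal b2.V"
    using nn_integral_prod[of "\<lambda>_. 1" ?g] by (simp add: D2(4) b1.mu_P)
  have i3: "(\<integral>\<^sup>+z. ?g (snd z) * psi (?f (fst z)) \<partial>mm) = ennreal b2.V * b1.D u1"
    using nn_integral_prod[of "\<lambda>x. psi (?f x)" ?g] by (simp add: D2(4) b1.D_def mult.commute)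
  have i4: "(\<integral>\<^sup>+z. ?f (fst z) * psi (?g (snd z)) \<partial>mm) = ennreal b1.V * b2.D u2"
    using nn_integral_prod[of ?f "\<lambda>x. psi (?g x)"] by (simp add: D1(4) b2.D_def)
  have i5: "(\<integral>\<^sup>+z. ?w z \<partial>mm) = ennreal b1.V * ennreal b2.V"
    using nn_integral_prod[of ?f ?g] by (simp add: D1(4) D2(4))
  have i6: "(\<integral>\<^sup>+z. 1 \<partial>mm) = ennreal b1.V * ennreal b2.V"
    using b.mu_P V_eq by simp
  let ?k = "ennreal b1.V * ennreal b2.V"
  have "b.D (\<lambda>(x, y). u1 x * u2 y) + ?k + ?k = (\<integral>\<^sup>+z. psi (?w z) + ?f (fst z) + ?g (snd z) \<partial>mm)"
    unfolding D by (simp add: nn_integral_add i1 i2)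
  also have "\<dots> = (\<integral>\<^sup>+z. ?g (snd z) * psi (?f (fst z)) + ?f (fst z) * psi (?g (snd z)) + ?w z + 1 \<partial>mm)"
    by (intro nn_integral_cong psi_mult D1(6) D2(6))
  also have "\<dots> = ennreal b2.V * b1.D u1 + ennreal b1.V * b2.D u2 + ?k + ?k"
    by (subst nn_integral_add, measurable)+ (simp only: i3 i4 i5 i6)
  finally have "?k + (?k + b.D (\<lambda>(x, y). u1 x * u2 y)) = ?k + (?k + (ennreal b2.V * b1.D u1 + ennreal b1.V * b2.D u2))"
    by (simp only: ac_simps)
  moreover have "?k \<noteq> top" unfolding V_eq(1)[symmetric] by simp
  ultimately show ?thesis unfolding ennreal_add_left_cancel infinity_ennreal_def by blast
qed

text \<open>Integration against a function of one coordinate sees only the marginal in that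
  coordinate. In \<open>D_marg_le\<close> the weights are \<open>psi b / b\<close> and
  \<open>1 / b\<close> for a marginal \<open>b\<close>.\<close>

lemma int_marg_weight:
  assumes v: "v \<in> M1 PP mm"
  shows "k \<in> borel_measurable borel \<Longrightarrow>
      (\<integral>\<^sup>+z. ext PP v z * k (fst z) \<partial>mm) = ennreal b2.V * (\<integral>\<^sup>+x. marg1 v x * k x \<partial>mu1)"
    and "l \<in> borel_measurable borel \<Longrightarrow>
      (\<integral>\<^sup>+z. ext PP v z * l (snd z) \<partial>mm) = ennreal b1.V * (\<integral>\<^sup>+y. marg2 v y * l y \<partial>mu2)"
proof -
  note D = b.M1_D[OF v]
  have m [measurable]: "ext PP v \<in> borel_measurable (borel \<Otimes>\<^sub>M borel)" using D(5) by (simp add: borel_prod)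
  note [measurable] = slice_measurable[OF D(5)]
  have meas1 [measurable]: "marg1 v \<in> borel_measurable borel"
    using b1.M1_D(5)[OF marg_in_M1(1)[OF v]] by (simp add: ext_marg)
  have meas2 [measurable]: "marg2 v \<in> borel_measurable borel"
    using b2.M1_D(5)[OF marg_in_M1(2)[OF v]] by (simp add: ext_marg)
  show "(\<integral>\<^sup>+z. ext PP v z * k (fst z) \<partial>mm) = ennreal b2.V * (\<integral>\<^sup>+x. marg1 v x * k x \<partial>mu1)"
    if [measurable]: "k \<in> borel_measurable borel"
  proof -
    have "(\<integral>\<^sup>+z. ext PP v z * k (fst z) \<partial>mm) = (\<integral>\<^sup>+x. \<integral>\<^sup>+y. ext PP v (x, y) * k x \<partial>mu2 \<partial>mu1)"
      by (subst nn_integral_fst') (simp_all add: borel_prod[symmetric])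
    also have "\<dots> = (\<integral>\<^sup>+x. ennreal b2.V * (marg1 v x * k x) \<partial>mu1)"
      by (simp add: nn_integral_multc int_marg mult.assoc)
    finally show ?thesis by (simp add: nn_integral_cmult)
  qed
  show "(\<integral>\<^sup>+z. ext PP v z * l (snd z) \<partial>mm) = ennreal b1.V * (\<integral>\<^sup>+y. marg2 v y * l y \<partial>mu2)"
    if [measurable]: "l \<in> borel_measurable borel"
  proof -
    have "(\<integral>\<^sup>+z. ext PP v z * l (snd z) \<partial>mm) = (\<integral>\<^sup>+y. \<integral>\<^sup>+x. ext PP v (x, y) * l y \<partial>mu1 \<partial>mu2)"
      by (subst nn_integral_snd') (simp_all add: borel_prod[symmetric])
    also have "\<dots> = (\<integral>\<^sup>+y. ennreal b1.V * (marg2 v y * l y) \<partial>mu2)"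
      by (simp add: nn_integral_multc int_marg mult.assoc)
    finally show ?thesis by (simp add: nn_integral_cmult)
  qed
qed

text \<open>Subadditivity of entropy, from \<open>psi_gibbs\<close> for the joint density and its
  two marginals. After integration the terms without \<open>psi\<close> amount to three times
  \<open>b1.V * b2.V\<close> on each side and cancel as finite quantities.\<close>

lemma D_marg_le:
  assumes v: "v \<in> M1 PP mm"
  shows "ennreal b2.V * b1.D (marg1 v) + ennreal b1.V * b2.D (marg2 v) \<le> b.D v"
proof -
  note D = b.M1_D[OF v]
  note D1 = b1.M1_D[OF marg_in_M1(1)[OF v], unfolded ext_marg]
  note D2 = b2.M1_D[OF marg_in_M1(2)[OF v], unfolded ext_marg]
  let ?a = "ext PP v" and ?b = "marg1 v" and ?c = "marg2 v"
  let ?k = "ennreal b1.V * ennreal b2.V"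
  note [measurable] = D1(5) D2(5)
  have "AE x in mu1. ?b x \<noteq> \<infinity>"
    by (rule nn_integral_noteq_infinite) (simp_all add: D1)
  then have fin1: "AE x in mu1. 0 < ?b x \<and> ?b x < \<infinity>"
    by eventually_elim (auto simp: D1(6) less_top)
  have "AE x in mu2. ?c x \<noteq> \<infinity>"
    by (rule nn_integral_noteq_infinite) (simp_all add: D2)
  then have fin2: "AE y in mu2. 0 < ?c y \<and> ?c y < \<infinity>"
    by eventually_elim (auto simp: D2(6) less_top)
  have [measurable]: "?a \<in> borel_measurable (mu1 \<Otimes>\<^sub>M mu2)"
    using D(5) by (simp add: measurable_pair_iff)
  have [measurable]: "?b \<in> borel_measurable mu1" "?c \<in> borel_measurable mu2"
    using D1(5) D2(5) by (simp_all cong: measurable_cong_sets)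
  \<comment> \<open>\<open>psi_gibbs\<close> divides by the marginals, so they have to be finite;
    having finite integrals, they are so almost everywhere.\<close>
  have fin: "AE z in mm. (0 < ?b (fst z) \<and> ?b (fst z) < \<infinity>) \<and> (0 < ?c (snd z) \<and> ?c (snd z) < \<infinity>)"
  proof (rule AE_pair_measure)
    show "AE x in mu1. AE y in mu2. (0 < ?b (fst (x, y)) \<and> ?b (fst (x, y)) < \<infinity>) \<and> (0 < ?c (snd (x, y)) \<and> ?c (snd (x, y)) < \<infinity>)"
      using fin1
    proof eventually_elim
      case (elim x)
      show ?case using fin2 by eventually_elim (use elim in simp)
    qed
  qed measurable
  have "(\<integral>\<^sup>+x. ?b x * (psi (?b x) / ?b x) \<partial>mu1) = b1.D ?b"
    unfolding b1.D_def ext_marg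
    by (intro nn_integral_cong_AE eventually_mono[OF fin1])
      (simp add: ennreal_mult_divide_cancel)
  then have r1: "(\<integral>\<^sup>+z. ?a z * (psi (?b (fst z)) / ?b (fst z)) \<partial>mm) = ennreal b2.V * b1.D ?b"
    using int_marg_weight(1)[OF v, of "\<lambda>x. psi (?b x) / ?b x"] by simp
  have "(\<integral>\<^sup>+x. ?c x * (psi (?c x) / ?c x) \<partial>mu2) = b2.D ?c"
    unfolding b2.D_def ext_marg
    by (intro nn_integral_cong_AE eventually_mono[OF fin2])
      (simp add: ennreal_mult_divide_cancel)
  then have r2: "(\<integral>\<^sup>+z. ?a z * (psi (?c (snd z)) / ?c (snd z)) \<partial>mm) = ennreal b1.V * b2.D ?c"
    using int_marg_weight(2)[OF v, of "\<lambda>x. psi (?c x) / ?c x"] by simp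
  have "(\<integral>\<^sup>+x. ?b x * (1 / ?b x) \<partial>mu1) = (\<integral>\<^sup>+x. 1 \<partial>mu1)"
    by (intro nn_integral_cong_AE eventually_mono[OF fin1]) (auto simp: ennreal_times_divide)
  then have l1: "(\<integral>\<^sup>+z. ?a z / ?b (fst z) \<partial>mm) = ?k"
    using int_marg_weight(1)[OF v, of "\<lambda>x. 1 / ?b x"]
    by (simp add: ennreal_times_divide b1.mu_P mult.commute)
  have "(\<integral>\<^sup>+x. ?c x * (1 / ?c x) \<partial>mu2) = (\<integral>\<^sup>+x. 1 \<partial>mu2)"
    by (intro nn_integral_cong_AE eventually_mono[OF fin2]) (auto simp: ennreal_times_divide)
  then have l2: "(\<integral>\<^sup>+z. ?a z / ?c (snd z) \<partial>mm) = ?k"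
    using int_marg_weight(2)[OF v, of "\<lambda>x. 1 / ?c x"]
    by (simp add: ennreal_times_divide b2.mu_P)
  have l3: "(\<integral>\<^sup>+z. ?b (fst z) * ?c (snd z) \<partial>mm) = ?k"
    by (subst nn_integral_prod) (simp_all add: D1(4) D2(4))
  have i6: "(\<integral>\<^sup>+z. 1 \<partial>mm) = ?k" using b.mu_P V_eq by simp
  have r3: "(\<integral>\<^sup>+z. 2 * ?a z \<partial>mm) = 2 * ?k" using D(4) V_eq by (simp add: nn_integral_cmult)
  have ma:
    "(\<lambda>z. ?a z * (psi (?b (fst z)) / ?b (fst z))) \<in> borel_measurable mm"
    "(\<lambda>z. ?a z * (psi (?c (snd z)) / ?c (snd z))) \<in> borel_measurable mm"
    "(\<lambda>z. 2 * ?a z) \<in> borel_measurable mm"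
    "(\<lambda>z. ?b (fst z) * ?c (snd z)) \<in> borel_measurable mm"
    "(\<lambda>z. ?a z / ?b (fst z)) \<in> borel_measurable mm"
    "(\<lambda>z. ?a z / ?c (snd z)) \<in> borel_measurable mm"
    "(\<lambda>z. 1 :: ennreal) \<in> borel_measurable mm"
    "(\<lambda>z. psi (?a z)) \<in> borel_measurable mm"
    by measurable
  have "ennreal b2.V * b1.D ?b + ennreal b1.V * b2.D ?c + 2 * ?k + ?k
    = (\<integral>\<^sup>+z. ?a z * (psi (?b (fst z)) / ?b (fst z)) + ?a z * (psi (?c (snd z)) / ?c (snd z)) + 2 * ?a z + 1 \<partial>mm)"
    using nn_integral_add4[OF ma(1,2,3,7)] by (simp only: r1 r2 r3 i6)
  also have "\<dots> \<le> (\<integral>\<^sup>+z. psi (?a z) + ?b (fst z) * ?c (snd z) + ?a z / ?b (fst z) + ?a z / ?c (snd z) \<partial>mm)"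
    by (intro nn_integral_mono_AE eventually_mono[OF fin] psi_gibbs) auto
  also have "\<dots> = (\<integral>\<^sup>+z. psi (?a z) \<partial>mm) + ?k + ?k + ?k"
    using nn_integral_add4[OF ma(8,4,5,6)] by (simp only: l1 l2 l3)
  finally have "(2 * ?k + ?k) + (ennreal b2.V * b1.D ?b + ennreal b1.V * b2.D ?c) \<le> (?k + ?k + ?k) + b.D v"
    by (simp only: b.D_def ac_simps)
  moreover have "2 * ?k + ?k = ?k + ?k + ?k" by (simp add: mult_2)
  ultimately have "(?k + ?k + ?k) + (ennreal b2.V * b1.D ?b + ennreal b1.V * b2.D ?c) \<le> (?k + ?k + ?k) + b.D v"
    by simp
  moreover have "?k + ?k + ?k \<noteq> top" unfolding V_eq(1)[symmetric] by simp
  ultimately show ?thesis unfolding ennreal_add_left_cancel_le infinity_ennreal_def by blast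
qed

text \<open>The two summands of \<open>comp_sigma\<close> are concentrated on
  \<open>frontier P1 \<times> P2\<close> and \<open>P1 \<times> frontier P2\<close>, both inside the
  frontier of the product. Integrating out the coordinate that runs through a whole body leaves a
  marginal times the volume of that body, and the prefactor \<open>1 / (b1.V * b2.V)\<close> reduces
  to \<open>1 / b1.V\<close> or \<open>1 / b2.V\<close>.\<close>

lemma U_comp:
  assumes s1: "boundary_measure P1 sg1" and s2: "boundary_measure P2 sg2" and v: "v \<in> M1 PP mm"
  shows "internal_energy PP mm (comp_sigma mu1 sg1 mu2 sg2) v
    = internal_energy P1 mu1 sg1 (marg1 v) + internal_energy P2 mu2 sg2 (marg2 v)"
proof -
  interpret g1: finite_measure sg1 using s1 by (simp add: boundary_measure_def)
  interpret g2: finite_measure sg2 using s2 by (simp add: boundary_measure_def)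
  interpret p1: pair_sigma_finite sg1 mu2 ..
  interpret p2: pair_sigma_finite mu1 sg2 ..
  have [measurable_cong]: "sets sg1 = sets borel" "sets sg2 = sets borel"
    using s1 s2 by (simp_all add: boundary_measure_def)
  let ?e = "ext PP v"
  have [measurable]: "?e \<in> borel_measurable (borel \<Otimes>\<^sub>M borel)"
    using b.M1_D(5)[OF v] by (simp add: borel_prod)
  have ms: "sets (sg1 \<Otimes>\<^sub>M mu2) = sets (mu1 \<Otimes>\<^sub>M sg2)"
    using s1 s2 by (intro sets_pair_measure_cong) (simp_all add: boundary_measure_def)
  have sub: "frontier PP \<subseteq> PP" using b.closed by (simp add: frontier_subset_eq)
  have fr: "frontier PP \<in> sets (borel \<Otimes>\<^sub>M borel)" unfolding borel_prod by (intro borel_closed) simp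
  have fr1: "(x, y) \<in> frontier PP" if "x \<in> frontier P1" "y \<in> P2" for x y
    using that b1.closed b2.closed by (auto simp: frontier_def interior_Times closure_Times)
  have fr2: "(x, y) \<in> frontier PP" if "x \<in> P1" "y \<in> frontier P2" for x y
    using that b1.closed b2.closed by (auto simp: frontier_def interior_Times closure_Times)
  let ?h = "\<lambda>z. ?e z * indicator (frontier PP) z"
  have [measurable]: "?h \<in> borel_measurable (borel \<Otimes>\<^sub>M borel)" using fr by measurable
  have I1: "(\<integral>\<^sup>+z. ?h z \<partial>(sg1 \<Otimes>\<^sub>M mu2)) = ennreal b2.V * (\<integral>\<^sup>+x. marg1 v x \<partial>sg1)"
  proof -
    have "(\<integral>\<^sup>+z. ?h z \<partial>(sg1 \<Otimes>\<^sub>M mu2)) = (\<integral>\<^sup>+x. \<integral>\<^sup>+y. ?h (x, y) \<partial>mu2 \<partial>sg1)"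
      by (rule b2.nn_integral_fst[symmetric]) measurable
    also have "\<dots> = (\<integral>\<^sup>+x. \<integral>\<^sup>+y. ?e (x, y) \<partial>mu2 \<partial>sg1)"
      by (intro nn_integral_cong_AE eventually_mono[OF boundary_measure_AE[OF s1]]
          eventually_mono[OF b2.AE_mu]) (simp add: fr1)
    finally show ?thesis using b1.M1_D(5)[OF marg_in_M1(1)[OF v]]
      by (simp add: int_marg nn_integral_cmult ext_marg)
  qed
  have I2: "(\<integral>\<^sup>+z. ?h z \<partial>(mu1 \<Otimes>\<^sub>M sg2)) = ennreal b1.V * (\<integral>\<^sup>+y. marg2 v y \<partial>sg2)"
  proof -
    have "(\<integral>\<^sup>+z. ?h z \<partial>(mu1 \<Otimes>\<^sub>M sg2)) = (\<integral>\<^sup>+y. \<integral>\<^sup>+x. ?h (x, y) \<partial>mu1 \<partial>sg2)"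
      by (rule p2.nn_integral_snd[symmetric]) measurable
    also have "\<dots> = (\<integral>\<^sup>+y. \<integral>\<^sup>+x. ?e (x, y) \<partial>mu1 \<partial>sg2)"
      by (intro nn_integral_cong_AE eventually_mono[OF boundary_measure_AE[OF s2]]
          eventually_mono[OF b1.AE_mu]) (simp add: fr2)
    finally show ?thesis using b2.M1_D(5)[OF marg_in_M1(2)[OF v]]
      by (simp add: int_marg nn_integral_cmult ext_marg)
  qed
  have "(\<integral>\<^sup>+z. v z * indicator (frontier PP) z \<partial>comp_sigma mu1 sg1 mu2 sg2) = (\<integral>\<^sup>+z. ?h z \<partial>comp_sigma mu1 sg1 mu2 sg2)"
    using sub by (intro nn_integral_cong) (auto simp: indicator_def)
  also have "\<dots> = ennreal b2.V * (\<integral>\<^sup>+x. marg1 v x \<partial>sg1) + ennreal b1.V * (\<integral>\<^sup>+y. marg2 v y \<partial>sg2)"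
    unfolding comp_sigma_def by (subst nn_integral_measure_add[OF ms]) (simp_all add: I1 I2)
  finally have "internal_energy PP mm (comp_sigma mu1 sg1 mu2 sg2) v
      = ennreal (1 / b.V) * (ennreal b2.V * (\<integral>\<^sup>+x. marg1 v x \<partial>sg1) + ennreal b1.V * (\<integral>\<^sup>+y. marg2 v y \<partial>sg2))"
    by (simp add: internal_energy_def b.V_def)
  also have "\<dots> = ennreal (1 / b.V * b2.V) * (\<integral>\<^sup>+x. marg1 v x \<partial>sg1) + ennreal (1 / b.V * b1.V) * (\<integral>\<^sup>+y. marg2 v y \<partial>sg2)"
  proof -
    have "ennreal (1 / b.V * b2.V) = ennreal (1 / b.V) * ennreal b2.V"
      "ennreal (1 / b.V * b1.V) = ennreal (1 / b.V) * ennreal b1.V"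
      using b.V_pos by (intro ennreal_mult'; simp)+
    then show ?thesis by (simp only: distrib_left mult.assoc)
  qed
  also have "1 / b.V * b2.V = 1 / b1.V" using V_eq(2) b1.V_pos b2.V_pos by (simp add: field_simps)
  also have "1 / b.V * b1.V = 1 / b2.V" using V_eq(2) b1.V_pos b2.V_pos by (simp add: field_simps)
  finally show ?thesis
    unfolding internal_energy_eq[OF s1 b1.closed] internal_energy_eq[OF s2 b2.closed] ext_marg b1.V_def b2.V_def .
qed

text \<open>An equality on the whole space, since off the bodies both sides are 1.\<close>

lemma marg_prod:
  assumes u1: "u1 \<in> M1 P1 mu1" and u2: "u2 \<in> M1 P2 mu2"
  shows "marg1 (\<lambda>(x, y). u1 x * u2 y) = ext P1 u1" "marg2 (\<lambda>(x, y). u1 x * u2 y) = ext P2 u2"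
proof -
  note D1 = b1.M1_D[OF u1] and D2 = b2.M1_D[OF u2]
  have [measurable]: "ext P1 u1 \<in> borel_measurable mu1" "ext P2 u2 \<in> borel_measurable mu2"
    using D1(5) D2(5) by (simp_all cong: measurable_cong_sets)
  let ?w = "\<lambda>(x, y). u1 x * u2 y"
  show "marg1 ?w = ext P1 u1"
  proof
    fix x
    show "marg1 ?w x = ext P1 u1 x"
    proof (cases "x \<in> P1")
      case True
      have "(\<integral>\<^sup>+y. ext PP ?w (x, y) \<partial>mu2) = (\<integral>\<^sup>+y. u1 x * ext P2 u2 y \<partial>mu2)"
        by (intro nn_integral_cong_AE eventually_mono[OF b2.AE_mu]) (simp add: True)
      then show ?thesis using True b2.V_pos
        by (simp add: marg1_def nn_integral_cmult D2(4) ennreal_mult_divide_eq)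
    next
      case False
      then show ?thesis by (subst ext_marg(1)[symmetric]) simp
    qed
  qed
  show "marg2 ?w = ext P2 u2"
  proof
    fix y
    show "marg2 ?w y = ext P2 u2 y"
    proof (cases "y \<in> P2")
      case True
      have "(\<integral>\<^sup>+x. ext PP ?w (x, y) \<partial>mu1) = (\<integral>\<^sup>+x. ext P1 u1 x * u2 y \<partial>mu1)"
        by (intro nn_integral_cong_AE eventually_mono[OF b1.AE_mu]) (simp add: True)
      then show ?thesis using True b1.V_pos
        by (simp add: marg2_def nn_integral_multc D1(4) ennreal_mult_divide_eq mult.commute[of "ennreal b1.V"])
    next
      case False
      then show ?thesis by (subst ext_marg(2)[symmetric]) simp
    qed
  qed
qed

lemma U_prod:
  assumes s1: "boundary_measure P1 sg1" and s2: "boundary_measure P2 sg2"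
    and u1: "u1 \<in> M1 P1 mu1" and u2: "u2 \<in> M1 P2 mu2"
  shows "internal_energy PP mm (comp_sigma mu1 sg1 mu2 sg2) (\<lambda>(x, y). u1 x * u2 y)
    = internal_energy P1 mu1 sg1 u1 + internal_energy P2 mu2 sg2 u2"
  unfolding U_comp[OF s1 s2 prod_in_M1[OF u1 u2]] marg_prod[OF u1 u2]
    internal_energy_eq[OF s1 b1.closed] internal_energy_eq[OF s2 b2.closed] ext_ext ..

end

section \<open>Finite energy implies finite entropy\<close>

lemma nn_integral_lborel_affine:
  fixes f :: "'a::euclidean_space \<Rightarrow> ennreal"
  assumes [measurable]: "f \<in> borel_measurable borel" and "c \<noteq> 0"
  shows "(\<integral>\<^sup>+x. f x \<partial>lborel) = ennreal (\<bar>c\<bar> ^ DIM('a)) * (\<integral>\<^sup>+x. f (t + c *\<^sub>R x) \<partial>lborel)"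
  by (subst lborel_affine[OF assms(2), of t])
    (simp add: nn_integral_density nn_integral_distr nn_integral_cmult)

lemma nn_integral_lborel_translate:
  fixes f :: "'a::euclidean_space \<Rightarrow> ennreal"
  assumes "f \<in> borel_measurable borel"
  shows "(\<integral>\<^sup>+x. f (t + x) \<partial>lborel) = (\<integral>\<^sup>+x. f x \<partial>lborel)"
  using nn_integral_lborel_affine[OF assms, of 1 t] by simp

text \<open>The affine function \<open>k - t * h\<close> of \<open>t\<close> has speed
  \<open>\<bar>h\<bar>\<close>, so it spends time \<open>d / \<bar>h\<bar>\<close> in an interval of
  length \<open>d\<close>. This is the factor on the left of \<open>cone_inequality\<close>.\<close>

lemma nn_integral_slab_line:
  fixes k h d :: real
  assumes "h \<noteq> 0" "0 \<le> d"
  shows "(\<integral>\<^sup>+t. indicator {0..d} (k - t * h) \<partial>lborel) = ennreal (d / \<bar>h\<bar>)"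
proof -
  have "(\<integral>\<^sup>+t. indicator {0..d} (k - t * h) \<partial>lborel)
    = ennreal \<bar>- (1 / h)\<bar> * (\<integral>\<^sup>+s. indicator {0..d} (k - (k / h + - (1 / h) * s) * h) \<partial>lborel)"
    by (subst nn_integral_real_affine[of _ "- (1 / h)" "k / h"]) (use assms in auto)
  also have "(\<lambda>s. k - (k / h + - (1 / h) * s) * h) = (\<lambda>s. s)"
    using assms by (auto simp: field_simps)
  also have "ennreal \<bar>- (1 / h)\<bar> * (\<integral>\<^sup>+s. indicator {0..d} s \<partial>lborel) = ennreal \<bar>1 / h\<bar> * ennreal d"
    using assms by simp
  also have "\<dots> = ennreal (d / \<bar>h\<bar>)"
    using assms by (simp flip: ennreal_mult)
  finally show ?thesis .
qed

text \<open>Polar coordinates at \<open>x0\<close> over a facet, as an inequality. The facet measure is expressed through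
  the right cylinder over the facet, and translations, dilations and Fubini suffice for the change of variables.\<close>

lemma cone_inequality:
  fixes n x0 :: "'a::euclidean_space" and g :: "'a \<Rightarrow> ennreal"
  assumes n: "norm n = 1" and h: "b - inner n x0 \<noteq> 0" and F: "compact F" "F \<subseteq> {x. inner n x = b}"
    and d: "0 < d" and g [measurable]: "g \<in> borel_measurable borel"
  defines "C \<equiv> (\<lambda>(t, y). x0 + t *\<^sub>R (y - x0)) ` ({d..1} \<times> F)"
    and "p \<equiv> \<lambda>z. z - (inner n z - b) *\<^sub>R n"
  shows "ennreal (d / \<bar>b - inner n x0\<bar>) * (\<integral>\<^sup>+x. g x * indicator C x \<partial>lborel)
    \<le> (\<integral>\<^sup>+z. (\<integral>\<^sup>+t. g (x0 + t *\<^sub>R (p z - x0)) * indicator {d..1} t \<partial>lborel)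
          * (indicator F (p z) * indicator {0..1} (inner n z - b)) \<partial>lborel)"
proof -
  define h where "h = b - inner n x0"
  have h0: "h \<noteq> 0" using h by (simp add: h_def)
  have nn: "inner n n = 1" using n by (simp add: norm_eq_1)
  have "compact C" unfolding C_def using F(1)
    by (intro compact_continuous_image compact_Times) (auto intro!: continuous_intros simp: case_prod_beta)
  then have C [measurable]: "C \<in> sets borel" by (intro borel_closed compact_imp_closed)
  have Fb [measurable]: "F \<in> sets borel" using F(1) by (intro borel_closed compact_imp_closed)
  define gc where "gc x = g x * indicator C x" for x
  have gc [measurable]: "gc \<in> borel_measurable borel" unfolding gc_def by measurable
  have pm [measurable]: "p \<in> borel_measurable borel" unfolding p_def by measurable
  \<comment> \<open>The height above \<open>x0\<close> in direction \<open>n\<close> determines the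
    ray parameter: the slice of \<open>C\<close> at height \<open>t * h\<close> is empty unless
    \<open>d \<le> t \<le> 1\<close>, and otherwise lies in the copy of \<open>F\<close> shrunk
    towards \<open>x0\<close> by the factor \<open>t\<close>.\<close>
  have gcC: "t \<in> {d..1} \<and> x0 + (1 / t) *\<^sub>R (q - x0) \<in> F" if "q \<in> C" "inner n (q - x0) = t * h" for q t
  proof -
    obtain s y where sy: "s \<in> {d..1}" "y \<in> F" "q = x0 + s *\<^sub>R (y - x0)" using \<open>q \<in> C\<close> by (auto simp: C_def)
    have "inner n (q - x0) = s * h" using sy F(2) by (auto simp: h_def inner_diff_right)
    with that(2) h0 have "s = t" by simp
    then show ?thesis using sy d by auto
  qed
  define phi where "phi t z = g (x0 + t *\<^sub>R (p z - x0)) * indicator {d..1} t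
      * (indicator F (p z) * indicator {0..1} (inner n z - b))" for t z
  \<comment> \<open>\<open>chi t\<close> extends the slice of \<open>gc\<close> at height
    \<open>t * h\<close> constantly along \<open>n\<close> over a slab of thickness
    \<open>d\<close>. Dilation by \<open>1 / t\<close> carries this slab to one of thickness
    \<open>d / t \<le> 1\<close>, which fits into the cylinder of height 1 on the right-hand side;
    this is why the thickness and the cutoff are the same \<open>d\<close>.\<close>
  define chi where "chi t x = gc (x0 + x - (inner n x - t * h) *\<^sub>R n) * indicator {0..d} (inner n x - t * h)" for t x
  have phi_m [measurable]: "case_prod phi \<in> borel_measurable (borel \<Otimes>\<^sub>M borel)"
    unfolding phi_def by measurable
  have phi_m1 [measurable]: "phi t \<in> borel_measurable borel" for t unfolding phi_def by measurable
  have chi_m1: "chi t \<in> borel_measurable borel" for t unfolding chi_def by measurable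
  have le: "(\<integral>\<^sup>+x. chi t x \<partial>lborel) \<le> (\<integral>\<^sup>+z. phi t z \<partial>lborel)" for t
  proof (cases "t \<in> {d..1}")
    case False
    have "chi t x = 0" for x
    proof -
      let ?q = "x0 + x - (inner n x - t * h) *\<^sub>R n"
      have "inner n (?q - x0) = t * h" by (simp add: inner_diff_right nn)
      then have "?q \<notin> C" using gcC False by blast
      then show ?thesis by (simp add: chi_def gc_def)
    qed
    then show ?thesis by simp
  next
    case True
    then have t: "0 < t" "d \<le> t" "t \<le> 1" using d by auto
    have "chi t x \<le> phi t (x0 + (1 / t) *\<^sub>R x)" for x
    proof (cases "inner n x - t * h \<in> {0..d} \<and> x0 + x - (inner n x - t * h) *\<^sub>R n \<in> C")
      case T: True
      let ?q = "x0 + x - (inner n x - t * h) *\<^sub>R n" and ?z = "x0 + (1 / t) *\<^sub>R x"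
      have "inner n (?q - x0) = t * h" by (simp add: inner_diff_right nn)
      then have qF: "x0 + (1 / t) *\<^sub>R (?q - x0) \<in> F" using gcC T by blast
      have nz: "inner n ?z - b = (inner n x - t * h) / t"
        using t by (simp add: h_def inner_add_right field_simps)
      have pz: "p ?z = x0 + (1 / t) *\<^sub>R (?q - x0)"
      proof -
        have "(1 / t) * (inner n x - t * h) = (inner n x - t * h) / t" by simp
        then have "(1 / t) *\<^sub>R (?q - x0) = (1 / t) *\<^sub>R x - ((inner n x - t * h) / t) *\<^sub>R n"
          by (simp only: scaleR_diff_right scaleR_scaleR add_diff_cancel_left' add_diff_eq[symmetric])
        then show ?thesis unfolding p_def nz by simp
      qed
      have "x0 + t *\<^sub>R (p ?z - x0) = ?q" unfolding pz using t by simp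
      moreover have "inner n ?z - b \<in> {0..1}" unfolding nz using T t by (auto simp: field_simps)
      ultimately show ?thesis using T True qF unfolding phi_def chi_def gc_def pz by (simp add: add_diff_eq)
    next
      case False
      then show ?thesis by (auto simp: chi_def gc_def)
    qed
    then have "(\<integral>\<^sup>+x. chi t x \<partial>lborel) \<le> (\<integral>\<^sup>+x. phi t (x0 + (1 / t) *\<^sub>R x) \<partial>lborel)"
      by (intro nn_integral_mono)
    \<comment> \<open>The Jacobian of the dilation is at least 1 for \<open>t \<le> 1\<close>, so
      inserting it only enlarges the bound. Here the exact formula for polar coordinates is given up
      for an inequality.\<close>
    also have "\<dots> \<le> ennreal (\<bar>1 / t\<bar> ^ DIM('a)) * (\<integral>\<^sup>+x. phi t (x0 + (1 / t) *\<^sub>R x) \<partial>lborel)"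
    proof -
      have "1 \<le> \<bar>1 / t\<bar> ^ DIM('a)" using t by (intro one_le_power) auto
      then have "ennreal 1 \<le> ennreal (\<bar>1 / t\<bar> ^ DIM('a))" by (rule ennreal_leI)
      from mult_right_mono[OF this, of "\<integral>\<^sup>+x. phi t (x0 + (1 / t) *\<^sub>R x) \<partial>lborel"]
      show ?thesis by simp
    qed
    also have "\<dots> = (\<integral>\<^sup>+z. phi t z \<partial>lborel)"
      using t by (subst nn_integral_lborel_affine[of "phi t" "1 / t" x0]) auto
    finally show ?thesis .
  qed
  \<comment> \<open>The double integral of \<open>chi\<close> is evaluated by alternating
    translations in \<open>x\<close> and in \<open>t\<close> under Fubini, until \<open>gc\<close>
    is taken at \<open>x\<close> itself and \<open>t\<close> occurs only in the slab indicator,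
    whose integral is \<open>d / \<bar>h\<bar>\<close>.\<close>
  have chi1: "(\<integral>\<^sup>+x. chi t x \<partial>lborel)
      = (\<integral>\<^sup>+x. gc (x0 + x + (t * h - inner n x) *\<^sub>R n) * indicator {0..d} (inner n x) \<partial>lborel)" for t
  proof -
    have "chi t ((t * h) *\<^sub>R n + x) = gc (x0 + x + (t * h - inner n x) *\<^sub>R n) * indicator {0..d} (inner n x)" for x
      unfolding chi_def by (simp add: inner_add_right nn algebra_simps)
    then show ?thesis using nn_integral_lborel_translate[OF chi_m1, of t "(t * h) *\<^sub>R n"] by simp
  qed
  have "(\<integral>\<^sup>+t. \<integral>\<^sup>+x. chi t x \<partial>lborel \<partial>lborel)
    = (\<integral>\<^sup>+x. \<integral>\<^sup>+t. gc (x0 + x + (t * h - inner n x) *\<^sub>R n) * indicator {0..d} (inner n x) \<partial>lborel \<partial>lborel)"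
    unfolding chi1 by (rule lborel_pair.Fubini') measurable
  also have "\<dots> = (\<integral>\<^sup>+x. \<integral>\<^sup>+t. gc (x0 + x + (t * h) *\<^sub>R n) * indicator {0..d} (inner n x) \<partial>lborel \<partial>lborel)"
  proof (rule nn_integral_cong)
    fix x
    have "(\<integral>\<^sup>+t. gc (x0 + x + ((inner n x / h + t) * h - inner n x) *\<^sub>R n) * indicator {0..d} (inner n x) \<partial>lborel)
      = (\<integral>\<^sup>+t. gc (x0 + x + (t * h - inner n x) *\<^sub>R n) * indicator {0..d} (inner n x) \<partial>lborel)"
      by (rule nn_integral_lborel_translate[of "\<lambda>t. gc (x0 + x + (t * h - inner n x) *\<^sub>R n) * indicator {0..d} (inner n x)"]) measurable
    moreover have "(inner n x / h + t) * h - inner n x = t * h" for t using h0 by (simp add: field_simps)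
    ultimately show "(\<integral>\<^sup>+t. gc (x0 + x + (t * h - inner n x) *\<^sub>R n) * indicator {0..d} (inner n x) \<partial>lborel)
      = (\<integral>\<^sup>+t. gc (x0 + x + (t * h) *\<^sub>R n) * indicator {0..d} (inner n x) \<partial>lborel)" by simp
  qed
  also have "\<dots> = (\<integral>\<^sup>+t. \<integral>\<^sup>+x. gc (x0 + x + (t * h) *\<^sub>R n) * indicator {0..d} (inner n x) \<partial>lborel \<partial>lborel)"
    by (rule lborel_pair.Fubini') measurable
  also have "\<dots> = (\<integral>\<^sup>+t. \<integral>\<^sup>+x. gc x * indicator {0..d} ((inner n x - inner n x0) - t * h) \<partial>lborel \<partial>lborel)"
  proof (rule nn_integral_cong)
    fix t
    let ?f = "\<lambda>x. gc x * indicator {0..d} ((inner n x - inner n x0) - t * h)"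
    have "(\<integral>\<^sup>+x. ?f ((x0 + (t * h) *\<^sub>R n) + x) \<partial>lborel) = (\<integral>\<^sup>+x. ?f x \<partial>lborel)"
      by (rule nn_integral_lborel_translate) measurable
    moreover have "?f ((x0 + (t * h) *\<^sub>R n) + x) = gc (x0 + x + (t * h) *\<^sub>R n) * indicator {0..d} (inner n x)" for x
      by (simp add: inner_add_right nn algebra_simps)
    ultimately show "(\<integral>\<^sup>+x. gc (x0 + x + (t * h) *\<^sub>R n) * indicator {0..d} (inner n x) \<partial>lborel) = (\<integral>\<^sup>+x. ?f x \<partial>lborel)"
      by simp
  qed
  also have "\<dots> = (\<integral>\<^sup>+x. \<integral>\<^sup>+t. gc x * indicator {0..d} ((inner n x - inner n x0) - t * h) \<partial>lborel \<partial>lborel)"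
    by (rule lborel_pair.Fubini') measurable
  also have "\<dots> = (\<integral>\<^sup>+x. gc x * ennreal (d / \<bar>h\<bar>) \<partial>lborel)"
    using nn_integral_slab_line[OF h0, of d] d by (simp add: nn_integral_cmult)
  also have "\<dots> = ennreal (d / \<bar>h\<bar>) * (\<integral>\<^sup>+x. gc x \<partial>lborel)"
    by (simp add: nn_integral_multc mult.commute)
  finally have "ennreal (d / \<bar>h\<bar>) * (\<integral>\<^sup>+x. gc x \<partial>lborel) = (\<integral>\<^sup>+t. \<integral>\<^sup>+x. chi t x \<partial>lborel \<partial>lborel)" ..
  also have "\<dots> \<le> (\<integral>\<^sup>+t. \<integral>\<^sup>+z. phi t z \<partial>lborel \<partial>lborel)"
    by (intro nn_integral_mono le)
  also have "\<dots> = (\<integral>\<^sup>+z. \<integral>\<^sup>+t. phi t z \<partial>lborel \<partial>lborel)"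
    by (rule lborel_pair.Fubini') measurable
  also have "\<dots> = (\<integral>\<^sup>+z. (\<integral>\<^sup>+t. g (x0 + t *\<^sub>R (p z - x0)) * indicator {d..1} t \<partial>lborel)
          * (indicator F (p z) * indicator {0..1} (inner n z - b)) \<partial>lborel)"
    unfolding phi_def by (simp add: nn_integral_multc)
  finally show ?thesis by (simp add: gc_def h_def)
qed

lemma nn_integral_powr_ln_le:
  assumes "1 \<le> (b::real)"
  shows "(\<integral>\<^sup>+t. ennreal (b powr t * ln b) * indicator {0..1} t \<partial>lborel) \<le> ennreal (b - 1)"
proof -
  have "(\<integral>\<^sup>+t. ennreal (b powr t * ln b) * indicator {0..1} t \<partial>lborel) = ennreal (b powr 1 - b powr 0)"
  proof (rule nn_integral_FTC_Icc)
    fix t :: real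
    show "((\<lambda>t. b powr t) has_real_derivative b powr t * ln b) (at t)"
      using assms by (auto simp: powr_def intro!: derivative_eq_intros)
  qed (use assms in auto)
  then show ?thesis using assms by simp
qed

text \<open>\<open>r ln r\<close> is at most 0 on [0, 1] and increasing beyond, so at
  \<open>r \<le> m\<close> it is at most \<open>m * ln m\<close> when \<open>m \<ge> 1\<close>; the
  term \<open>- r\<close> is dropped.\<close>

lemma psi_le:
  assumes "a \<le> ennreal m" "1 \<le> m"
  shows "psi a \<le> ennreal (m * ln m + 1)"
proof -
  obtain r where r: "a = ennreal r" "0 \<le> r" using assms by (cases a) (auto simp: top_unique)
  have rm: "r \<le> m" using assms r by simp
  have "r * ln r \<le> m * ln m"
  proof (cases "r \<le> 1")
    case True
    then have "r * ln r \<le> 0" using r by (cases "r = 0") (auto intro: mult_nonneg_nonpos)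
    also have "0 \<le> m * ln m" using assms(2) by simp
    finally show ?thesis .
  next
    case False
    then show ?thesis using rm by (intro mult_mono) auto
  qed
  then show ?thesis using r by (auto simp: psi_ennreal intro!: ennreal_leI)
qed

text \<open>Log-convexity along a ray: the integral of \<open>b powr t * ln b\<close> over the unit interval is only \<open>b - 1\<close>,
  so no logarithm of the boundary value survives.\<close>

lemma psi_ray:
  assumes K: "1 \<le> K" and d: "0 < d" and [measurable]: "f \<in> borel_measurable borel"
    and f: "\<And>t. t \<in> {d..1} \<Longrightarrow> f t \<le> epow (ennreal K) (1 - t) * epow B t"
  shows "(\<integral>\<^sup>+t. psi (f t) * indicator {d..1} t \<partial>lborel) \<le> ennreal (K * ln K + K + 1) * (1 + B)"
proof (cases B)
  case (real b)
  \<comment> \<open>Raising \<open>b\<close> to at least 1 makes \<open>ln b'\<close> nonnegative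
    and \<open>b' powr t\<close> nondecreasing in \<open>t\<close>, and costs at most 1.\<close>
  define b' where "b' = max 1 b"
  have b': "1 \<le> b'" "b \<le> b'" "b' \<le> 1 + b" using real by (auto simp: b'_def)
  have "psi (f t) * indicator {d..1} t
      \<le> ennreal (K * ln K * b' + 1) * indicator {0..1} t + ennreal K * (ennreal (b' powr t * ln b') * indicator {0..1} t)" for t
  proof (cases "t \<in> {d..1}")
    case True
    then have t: "0 < t" "t \<le> 1" using d by auto
    define m where "m = K * b' powr t"
    have bt: "1 \<le> b' powr t" "b' powr t \<le> b'" using b' t ge_one_powr_ge_zero[of b' t] powr_mono[of t 1 b'] by auto
    have "1 * 1 \<le> K * b' powr t" using K bt by (intro mult_mono) auto
    then have m1: "1 \<le> m" by (simp add: m_def)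
    have "K powr (1 - t) \<le> K" using K t powr_mono[of "1 - t" 1 K] by simp
    moreover have "b powr t \<le> b' powr t" using real b' t by (intro powr_mono2) auto
    ultimately have "K powr (1 - t) * b powr t \<le> m" unfolding m_def using K by (intro mult_mono) auto
    then have "f t \<le> ennreal m"
      using f[OF True] real K by (auto simp: epow_ennreal ennreal_mult[symmetric] intro: order_trans ennreal_leI)
    then have "psi (f t) \<le> ennreal (m * ln m + 1)" using m1 by (rule psi_le)
    \<comment> \<open>The critical term is \<open>t * ln b'\<close> with weight
      \<open>b' powr t\<close>; bounding the factor \<open>t\<close> by 1 leaves the integrand of
      \<open>nn_integral_powr_ln_le\<close>.\<close>
    also have "m * ln m = K * ln K * b' powr t + K * (t * (b' powr t * ln b'))"
      using K b' unfolding m_def by (simp add: ln_mult ln_powr algebra_simps)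
    also have "ennreal (K * ln K * b' powr t + K * (t * (b' powr t * ln b')) + 1)
       \<le> ennreal ((K * ln K * b' + 1) + K * (b' powr t * ln b'))"
    proof (rule ennreal_leI)
      have "K * ln K * b' powr t \<le> K * ln K * b'" using bt K by (intro mult_left_mono) auto
      moreover have "t * (b' powr t * ln b') \<le> 1 * (b' powr t * ln b')" using t b' by (intro mult_right_mono) auto
      then have "K * (t * (b' powr t * ln b')) \<le> K * (b' powr t * ln b')" using K by (intro mult_left_mono) auto
      ultimately show "K * ln K * b' powr t + K * (t * (b' powr t * ln b')) + 1 \<le> (K * ln K * b' + 1) + K * (b' powr t * ln b')"
        by linarith
    qed
    also have "\<dots> = ennreal (K * ln K * b' + 1) + ennreal K * ennreal (b' powr t * ln b')"
      using K b' by (subst ennreal_plus) (auto simp: ennreal_mult')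
    finally show ?thesis using True t by simp
  qed simp
  then have "(\<integral>\<^sup>+t. psi (f t) * indicator {d..1} t \<partial>lborel)
    \<le> (\<integral>\<^sup>+t. ennreal (K * ln K * b' + 1) * indicator {0..1} t + ennreal K * (ennreal (b' powr t * ln b') * indicator {0..1} t) \<partial>lborel)"
    by (rule nn_integral_mono)
  also have "\<dots> = ennreal (K * ln K * b' + 1) + ennreal K * (\<integral>\<^sup>+t. ennreal (b' powr t * ln b') * indicator {0..1} t \<partial>lborel)"
    by (simp add: nn_integral_add nn_integral_cmult nn_integral_cmult_indicator)
  also have "\<dots> \<le> ennreal (K * ln K * b' + 1) + ennreal K * ennreal (b' - 1)"
    by (intro add_left_mono mult_left_mono nn_integral_powr_ln_le b') auto
  also have "\<dots> = ennreal (K * ln K * b' + 1 + K * (b' - 1))"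
    using K b' by (subst ennreal_plus) (auto simp: ennreal_mult')
  \<comment> \<open>Origin of the constant: \<open>K * ln K\<close> and \<open>K\<close> are the
    coefficients of \<open>b'\<close>, and the extra 1 absorbs the constant term because
    \<open>b' \<ge> 1\<close>; finally \<open>b' \<le> 1 + b\<close>.\<close>
  also have "\<dots> \<le> ennreal ((K * ln K + K + 1) * (1 + b))"
  proof (rule ennreal_leI)
    have "K * ln K * b' + 1 + K * (b' - 1) \<le> (K * ln K + K + 1) * b'"
      using K b' by (simp add: algebra_simps)
    also have "\<dots> \<le> (K * ln K + K + 1) * (1 + b)" using K b' by (intro mult_left_mono) auto
    finally show "K * ln K * b' + 1 + K * (b' - 1) \<le> (K * ln K + K + 1) * (1 + b)" .
  qed
  also have "\<dots> = ennreal (K * ln K + K + 1) * (1 + B)"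
    using K real by (simp add: ennreal_mult'' ennreal_plus)
  finally show ?thesis .
next
  case top
  have "0 < K * ln K + K + 1" using K by (simp add: add_nonneg_pos)
  then have "ennreal (K * ln K + K + 1) * (1 + B) = top" using top by (simp add: ennreal_mult_top)
  then show ?thesis by simp
qed

section \<open>Lebesgue measure on hyperplanes and facets\<close>

lemma unit_normal:
  assumes "a \<noteq> 0" "H = {x. inner a x = b}"
  obtains b' where "norm (unit_normal H) = 1" "H = {x. inner (unit_normal H) x = b'}"
proof -
  have "{x. inner a x = b} = {x. inner ((1 / norm a) *\<^sub>R a) x = b / norm a}"
    using assms(1) by (auto simp: field_simps)
  moreover have "norm ((1 / norm a) *\<^sub>R a) = 1" using assms(1) by simp
  ultimately have "\<exists>n. norm n = 1 \<and> (\<exists>b. H = {x. inner n x = b})" using assms(2) by blast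
  then have "norm (unit_normal H) = 1 \<and> (\<exists>b. H = {x. inner (unit_normal H) x = b})"
    unfolding unit_normal_def by (rule someI_ex)
  then show ?thesis using that by blast
qed

text \<open>Each point is its orthogonal projection to the hyperplane plus a multiple of
  \<open>n\<close>, so the cylinder is a preimage under projection and height. In this form it is
  Borel for Borel \<open>A\<close>, and set operations on \<open>A\<close> pass to the
  cylinders.\<close>

lemma cylinder_eq:
  assumes "norm n = 1" "A \<subseteq> {x. inner n x = b}"
  shows "cylinder n A = {z. z - (inner n z - b) *\<^sub>R n \<in> A \<and> inner n z - b \<in> {0..1}}"
proof -
  have nn: "inner n n = 1" using assms(1) by (simp add: norm_eq_1)
  show ?thesis
  proof (intro equalityI subsetI)
    fix z assume "z \<in> cylinder n A"
    then obtain x t where xt: "z = x + t *\<^sub>R n" "x \<in> A" "t \<in> {0..1}" by (auto simp: cylinder_def)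
    then have "inner n z - b = t" using assms(2) nn by (auto simp: inner_add_right)
    then show "z \<in> {z. z - (inner n z - b) *\<^sub>R n \<in> A \<and> inner n z - b \<in> {0..1}}" using xt by simp
  next
    fix z assume z: "z \<in> {z. z - (inner n z - b) *\<^sub>R n \<in> A \<and> inner n z - b \<in> {0..1}}"
    show "z \<in> cylinder n A"
      unfolding cylinder_def
      by (rule image_eqI[of _ _ "(z - (inner n z - b) *\<^sub>R n, inner n z - b)"]) (use z in auto)
  qed
qed

text \<open>\<open>measure_of\<close> takes the prescribed values only after its sets are shown to
  form a sigma-algebra on which these values are countably additive. Both hold because forming
  cylinders commutes with unions and with complements relative to the cylinder over
  \<open>H\<close>, and keeps disjoint sets disjoint.\<close>

lemma emeasure_hyperplane_measure:
  assumes a: "a \<noteq> 0" "H = {x. inner a x = b}" and A: "A \<in> sets borel" "A \<subseteq> H"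
  shows "emeasure (hyperplane_measure H) A = emeasure lborel (cylinder (unit_normal H) A)"
proof -
  let ?n = "unit_normal H"
  obtain b' where n: "norm ?n = 1" and H: "H = {x. inner ?n x = b'}" by (rule unit_normal[OF a])
  define S where "S = {A. A \<subseteq> H \<and> cylinder ?n A \<in> sets lebesgue}"
  define p where "p z = z - (inner ?n z - b') *\<^sub>R ?n" for z
  have cyl: "cylinder ?n A = {z. p z \<in> A \<and> inner ?n z - b' \<in> {0..1}}" if "A \<subseteq> H" for A
    using cylinder_eq[OF n, of A b'] that H by (simp add: p_def)
  have pm [measurable]: "p \<in> borel_measurable borel" unfolding p_def by measurable
  have borel: "cylinder ?n B \<in> sets borel" if "B \<in> sets borel" "B \<subseteq> H" for B
  proof -
    have "cylinder ?n B = (p -` B \<inter> space borel) \<inter> ((\<lambda>z. inner ?n z - b') -` {0..1} \<inter> space borel)"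
      unfolding cyl[OF that(2)] by auto
    moreover have "p -` B \<inter> space borel \<in> sets borel" using that(1) pm by (rule measurable_sets[rotated])
    moreover have "(\<lambda>z. inner ?n z - b') -` {0..1} \<inter> space borel \<in> sets borel"
      by (rule measurable_sets[of _ borel borel]) auto
    ultimately show ?thesis by simp
  qed
  have "closed H" using closed_hyperplane[of a b] a(2) by simp
  then have HS: "cylinder ?n H \<in> sets lebesgue" using borel[of H] by auto
  have sa: "sigma_algebra H S"
    unfolding sigma_algebra_iff2
  proof (intro conjI ballI allI impI)
    show "S \<subseteq> Pow H" "{} \<in> S" by (auto simp: S_def cylinder_def)
    fix B assume B: "B \<in> S"
    then have "cylinder ?n (H - B) = cylinder ?n H - cylinder ?n B"
      using cyl[of H] cyl[of B] cyl[of "H - B"] by (auto simp: S_def)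
    then show "H - B \<in> S" using B HS by (auto simp: S_def)
  next
    fix B :: "nat \<Rightarrow> 'a set" assume B: "range B \<subseteq> S"
    then have "cylinder ?n (\<Union>i. B i) = (\<Union>i. cylinder ?n (B i))" by (auto simp: cylinder_def)
    moreover have "(\<Union>i. cylinder ?n (B i)) \<in> sets lebesgue"
      using B by (intro sets.countable_UN) (auto simp: S_def)
    ultimately show "(\<Union>i. B i) \<in> S" using B by (auto simp: S_def)
  qed
  then have sets: "sets (hyperplane_measure H) = S"
    unfolding hyperplane_measure_def S_def[symmetric]
    by (simp add: sigma_algebra.sets_measure_of_eq)
  have "emeasure (hyperplane_measure H) A = emeasure lebesgue (cylinder ?n A)"
  proof (rule emeasure_measure_of[OF hyperplane_measure_def])
    show "{A. A \<subseteq> H \<and> cylinder ?n A \<in> sets lebesgue} \<subseteq> Pow H" by auto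
    show "positive (sets (hyperplane_measure H)) (\<lambda>A. emeasure lebesgue (cylinder ?n A))"
      by (auto simp: positive_def cylinder_def)
    show "A \<in> sets (hyperplane_measure H)" using A borel[OF A] by (auto simp: sets S_def)
    show "countably_additive (sets (hyperplane_measure H)) (\<lambda>A. emeasure lebesgue (cylinder ?n A))"
    proof (rule countably_additiveI)
      fix B :: "nat \<Rightarrow> 'a set"
      assume B: "range B \<subseteq> sets (hyperplane_measure H)" "disjoint_family B"
      then have BS: "B i \<subseteq> H" "cylinder ?n (B i) \<in> sets lebesgue" for i by (auto simp: sets S_def)
      have "disjoint_family (\<lambda>i. cylinder ?n (B i))"
        using B(2) unfolding disjoint_family_on_def cyl[OF BS(1)] by blast
      moreover have "cylinder ?n (\<Union>i. B i) = (\<Union>i. cylinder ?n (B i))" by (auto simp: cylinder_def)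
      ultimately show "(\<Sum>i. emeasure lebesgue (cylinder ?n (B i))) = emeasure lebesgue (cylinder ?n (\<Union>i. B i))"
        using BS suminf_emeasure[of "\<lambda>i. cylinder ?n (B i)" lebesgue] by (simp only: image_subset_iff) blast
    qed
  qed
  then show ?thesis using borel[OF A] by (simp add: emeasure_completion)
qed

text \<open>On \<open>F\<close> the measure \<open>sg\<close> is \<open>w\<close> times the
  push-forward, under the orthogonal projection \<open>p\<close>, of Lebesgue measure on the
  cylinder over \<open>F\<close>, since both agree on Borel sets. This produces the right-hand side
  of \<open>cone_inequality\<close>.\<close>

lemma facet_integral:
  fixes F :: "'a::euclidean_space set"
  assumes sg: "sets sg = sets borel" and a: "a \<noteq> 0" "H = {x. inner a x = b}"
    and n: "n = unit_normal H" "H = {x. inner n x = b'}" "norm n = 1"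
    and F: "F \<in> sets borel" "F \<subseteq> H"
    and w: "\<And>A. A \<in> sets borel \<Longrightarrow> A \<subseteq> F \<Longrightarrow> emeasure sg A = ennreal w * emeasure (hyperplane_measure H) A"
    and G: "G \<in> borel_measurable borel"
  defines "p \<equiv> \<lambda>z. z - (inner n z - b') *\<^sub>R n"
  shows "(\<integral>\<^sup>+y. G y * indicator F y \<partial>sg)
    = ennreal w * (\<integral>\<^sup>+z. G (p z) * (indicator F (p z) * indicator {0..1} (inner n z - b')) \<partial>lborel)"
proof -
  note [measurable] = F(1) G
  note [measurable_cong] = sg
  define k :: "'a \<Rightarrow> ennreal" where "k z = ennreal w * (indicator F (p z) * indicator {0..1} (inner n z - b'))" for z
  have pm [measurable]: "p \<in> borel_measurable borel" unfolding p_def by measurable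
  have km [measurable]: "k \<in> borel_measurable borel" unfolding k_def by measurable
  have eq: "density sg (indicator F) = distr (density lborel k) borel p"
  proof (rule measure_eqI)
    fix A assume "A \<in> sets (density sg (indicator F))"
    then have A [measurable]: "A \<in> sets borel" using sg by simp
    have FA: "F \<inter> A \<in> sets borel" "F \<inter> A \<subseteq> H" using F by auto
    have "emeasure (density sg (indicator F)) A = emeasure sg (F \<inter> A)"
      using F(1) A sg by (subst emeasure_density) (auto simp: indicator_inter_arith[symmetric] simp flip: nn_integral_indicator)
    also have "\<dots> = ennreal w * emeasure lborel (cylinder n (F \<inter> A))"
      using w[of "F \<inter> A"] emeasure_hyperplane_measure[OF a FA] FA n(1) by auto
    also have "cylinder n (F \<inter> A) = {z. p z \<in> F \<inter> A \<and> inner n z - b' \<in> {0..1}}"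
      using cylinder_eq[OF n(3), of "F \<inter> A" b'] FA n(2) by (auto simp: p_def)
    also have "ennreal w * emeasure lborel \<dots> = (\<integral>\<^sup>+z. k z * indicator (p -` A) z \<partial>lborel)"
    proof -
      have "{z. p z \<in> F \<inter> A \<and> inner n z - b' \<in> {0..1}} \<in> sets borel" by measurable
      then have "ennreal w * emeasure lborel {z. p z \<in> F \<inter> A \<and> inner n z - b' \<in> {0..1}}
        = (\<integral>\<^sup>+z. ennreal w * indicator {z. p z \<in> F \<inter> A \<and> inner n z - b' \<in> {0..1}} z \<partial>lborel)"
        by (subst nn_integral_cmult_indicator) auto
      also have "\<dots> = (\<integral>\<^sup>+z. k z * indicator (p -` A) z \<partial>lborel)"
        by (rule nn_integral_cong) (auto simp: k_def indicator_def)
      finally show ?thesis .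
    qed
    also have "\<dots> = emeasure (distr (density lborel k) borel p) A"
    proof -
      have "p -` A \<in> sets borel" using measurable_sets[OF pm A] by simp
      then show ?thesis using A by (simp add: emeasure_distr emeasure_density)
    qed
    finally show "emeasure (density sg (indicator F)) A = emeasure (distr (density lborel k) borel p) A" .
  qed (simp add: sg)
  have "(\<integral>\<^sup>+y. G y * indicator F y \<partial>sg) = (\<integral>\<^sup>+y. G y \<partial>density sg (indicator F))"
    by (subst nn_integral_density) (auto simp: mult.commute)
  also have "\<dots> = (\<integral>\<^sup>+z. k z * G (p z) \<partial>lborel)"
    unfolding eq by (simp add: nn_integral_distr nn_integral_density)
  also have "\<dots> = (\<integral>\<^sup>+z. ennreal w * (G (p z) * (indicator F (p z) * indicator {0..1} (inner n z - b'))) \<partial>lborel)"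
    by (simp add: k_def ac_simps)
  finally show ?thesis by (simp add: nn_integral_cmult)
qed

lemma facet_hyperplane:
  fixes P :: "'a::euclidean_space set"
  assumes P: "polytope P" "interior P \<noteq> {}" and F: "F facet_of P"
  obtains a b where "a \<noteq> 0" "affine hull F = {x. inner a x = b}"
    "\<And>x. x \<in> interior P \<Longrightarrow> x \<notin> affine hull F" "compact F" "F \<subseteq> P"
proof -
  have aff: "aff_dim P = DIM('a)" using P(2) by (rule aff_dim_nonempty_interior)
  then have "aff_dim F = DIM('a) - 1" using F by (simp add: facet_of_def)
  then have "\<exists>a b. a \<noteq> 0 \<and> affine hull F = {x. inner a x = b}"
    unfolding aff_dim_eq_hyperplane .
  then obtain a b where ab: "a \<noteq> 0" "affine hull F = {x. inner a x = b}" by blast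
  have face: "F face_of P" using F by (simp add: facet_of_def)
  have "F \<noteq> P" using F by (auto simp: facet_of_def)
  then have dis: "F \<inter> interior P = {}" by (rule face_of_disjoint_interior[OF face])
  \<comment> \<open>The affine hull of a face meets the polytope only in that face. Hence interior
    points lie off the hyperplane, and the height \<open>b - inner n x0\<close> in
    \<open>cone_inequality\<close> is nonzero.\<close>
  have eq: "affine hull F \<inter> P = F"
    using face_of_imp_eq_affine_Int[OF _ face] P(1) polytope_imp_convex by auto
  show ?thesis
  proof (rule that[OF ab])
    show "x \<notin> affine hull F" if "x \<in> interior P" for x
      using that dis eq interior_subset[of P] by blast
    show "compact F" using face P(1) polytope_imp_compact polytope_imp_convex face_of_imp_compact by blast
    show "F \<subseteq> P" using face by (rule face_of_imp_subset)
  qed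
qed

lemma frontier_polytope:
  fixes P :: "'a::euclidean_space set"
  assumes "polytope P" "interior P \<noteq> {}"
  shows "frontier P = \<Union>{F. F facet_of P}" "finite {F. F facet_of P}"
proof -
  have "rel_frontier P = frontier P" using assms(2) by (rule rel_frontier_nonempty_interior)
  then show "frontier P = \<Union>{F. F facet_of P}"
    using rel_frontier_of_polyhedron[OF polytope_imp_polyhedron[OF assms(1)]] by simp
  show "finite {F. F facet_of P}" using assms(1) by (rule finite_polytope_facets)
qed

lemma is_system_body:
  assumes "is_system P mu sg"
  obtains c where "body P mu c"
proof -
  from assms obtain c where "0 < c" "mu = density lborel (\<lambda>x. ennreal c * indicator P x)"
    and P: "polytope P" "interior P \<noteq> {}"
    by (auto simp: is_system_def simple_polytope_def)
  then have "body P mu c"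
    by unfold_locales (auto intro: polytope_imp_compact polytope_imp_convex)
  then show ?thesis by (rule that)
qed

text \<open>Facets are compact, so the cylinders over them are bounded and of finite measure;
  finitely many facets cover the frontier.\<close>

lemma is_system_boundary_measure:
  fixes P :: "'a::euclidean_space set"
  assumes "is_system P mu sg"
  shows "boundary_measure P sg"
proof -
  have P: "polytope P" "interior P \<noteq> {}" and sg: "sets sg = sets borel" "emeasure sg (- frontier P) = 0"
    and w: "\<And>F. F facet_of P \<Longrightarrow> \<exists>w>0. \<forall>A. A \<in> sets borel \<longrightarrow> A \<subseteq> F \<longrightarrow>
            emeasure sg A = ennreal w * emeasure (hyperplane_measure (affine hull F)) A"
    using assms by (auto simp: is_system_def simple_polytope_def)
  have fin: "F \<in> sets sg \<and> emeasure sg F \<noteq> top" if F: "F facet_of P" for F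
  proof -
    obtain a b where ab: "a \<noteq> 0" "affine hull F = {x. inner a x = b}" "compact F"
      using facet_hyperplane[OF P F] by metis
    have Fb: "F \<in> sets borel" using ab(3) by (intro borel_closed compact_imp_closed)
    obtain w where w: "emeasure sg F = ennreal w * emeasure (hyperplane_measure (affine hull F)) F"
      using w[OF F] Fb by blast
    have "emeasure (hyperplane_measure (affine hull F)) F = emeasure lborel (cylinder (unit_normal (affine hull F)) F)"
      using Fb by (intro emeasure_hyperplane_measure[OF ab(1,2)] hull_subset)
    also have "emeasure lborel (cylinder (unit_normal (affine hull F)) F) < \<infinity>"
    proof -
      have "compact (cylinder (unit_normal (affine hull F)) F)"
        unfolding cylinder_def using ab(3)
        by (intro compact_continuous_image compact_Times) (auto intro!: continuous_intros simp: case_prod_beta)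
      then show ?thesis by (intro emeasure_bounded_finite compact_imp_bounded)
    qed
    finally have "emeasure sg F < top" unfolding w by (simp add: ennreal_mult_less_top)
    then show ?thesis using Fb sg by simp
  qed
  have "emeasure sg (frontier P) \<le> (\<Sum>F\<in>{F. F facet_of P}. emeasure sg F)"
    unfolding frontier_polytope(1)[OF P] using frontier_polytope(2)[OF P] fin
    using emeasure_subadditive_finite[of "{F. F facet_of P}" "\<lambda>F. F" sg] by auto
  also have "\<dots> < top" using fin by (auto simp: less_top[symmetric] frontier_polytope(2)[OF P])
  finally have 1: "emeasure sg (frontier P) < top" .
  have "frontier P \<in> sets sg" "- frontier P \<in> sets sg"
    using sg(1) by (auto intro: borel_closed borel_open)
  then have "emeasure sg (frontier P \<union> - frontier P) \<le> emeasure sg (frontier P) + emeasure sg (- frontier P)"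
    by (intro emeasure_subadditive)
  then have "emeasure sg UNIV < top" using 1 sg(2) by (simp add: Un_commute)
  moreover have "space sg = UNIV" using sets_eq_imp_space_eq[OF sg(1)] by simp
  ultimately have "finite_measure sg" by (intro finite_measureI) auto
  then show ?thesis using sg by (simp add: boundary_measure_def)
qed

text \<open>The factor \<open>d\<close> in \<open>cone_inequality\<close> keeps the cones away from
  their apex \<open>x0\<close>. A ball around \<open>x0\<close> on which \<open>u\<close> is bounded
  covers the missing part and the truncated cones over the facets cover the rest of
  \<open>P\<close>; overlaps are harmless in an upper bound.\<close>

lemma finite_D:
  fixes P :: "'a::euclidean_space set"
  assumes sys: "is_system P mu sg" and body: "body P mu c" and u: "u \<in> M1 P mu"
    and U: "internal_energy P mu sg u < top"
  shows "body.D P mu u < top"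
proof -
  interpret body P mu c by fact
  have P: "polytope P" "interior P \<noteq> {}" and sg: "sets sg = sets borel"
    and w: "\<And>F. F facet_of P \<Longrightarrow> \<exists>w>0. \<forall>A. A \<in> sets borel \<longrightarrow> A \<subseteq> F \<longrightarrow>
            emeasure sg A = ennreal w * emeasure (hyperplane_measure (affine hull F)) A"
    using sys by (auto simp: is_system_def simple_polytope_def)
  note bm = is_system_boundary_measure[OF sys]
  note [measurable] = M1_D(5)[OF u]
  note [measurable_cong] = sg
  have "(\<integral>\<^sup>+x. ext P u x \<partial>sg) < top"
    using U V_pos unfolding internal_energy_eq[OF bm closed] V_def[symmetric]
    by (auto simp: ennreal_mult_less_top)
  moreover have "emeasure sg (space sg) < top"
    using bm finite_measure.emeasure_finite[of sg "space sg"] by (auto simp: boundary_measure_def less_top)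
  ultimately have fin_sg: "(\<integral>\<^sup>+x. 1 + ext P u x \<partial>sg) < top"
    by (subst nn_integral_add) auto
  obtain K e x0 where K: "1 \<le> (K::real)" "0 < e" "cball x0 e \<subseteq> P" "\<And>x. x \<in> cball x0 e \<Longrightarrow> u x \<le> ennreal K"
    using M1_bounded_on_ball[OF u] by metis
  have x0: "x0 \<in> interior P" using K(2,3) by (auto simp: mem_interior_cball)
  then have x0P: "x0 \<in> P" using interior_subset by blast
  have "bounded P" using compact by (rule compact_imp_bounded)
  then obtain R0 where "\<forall>x\<in>P. dist x0 x \<le> R0" unfolding bounded_any_center[where a = x0] by blast
  then have "0 < max R0 1" "\<And>x. x \<in> P \<Longrightarrow> dist x0 x \<le> max R0 1" by force+
  then obtain R where R: "0 < R" "\<And>x. x \<in> P \<Longrightarrow> dist x0 x \<le> R" by blast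
  \<comment> \<open>\<open>R\<close> bounds the distances from \<open>x0\<close> within
    \<open>P\<close>, so a point of \<open>P\<close> outside the ball divides its segment from
    \<open>x0\<close> to the frontier at a ratio of at least \<open>e / R\<close>.\<close>
  define d where "d = e / R"
  have d: "0 < d" using K R by (simp add: d_def)
  define g where "g x = psi (ext P u x)" for x
  have [measurable]: "g \<in> borel_measurable borel" unfolding g_def by measurable
  define C where "C F = (\<lambda>(t, y). x0 + t *\<^sub>R (y - x0)) ` ({d..1} \<times> F)" for F
  have cover: "x \<in> cball x0 e \<or> (\<exists>F. F facet_of P \<and> x \<in> C F)" if x: "x \<in> P" for x
  proof (cases "x \<in> cball x0 e")
    case False
    then have xx0: "x - x0 \<noteq> 0" using K(2) by auto
    obtain s where s: "0 < s" "x0 + s *\<^sub>R (x - x0) \<in> frontier P"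
      "\<And>r. 0 \<le> r \<Longrightarrow> r < s \<Longrightarrow> x0 + r *\<^sub>R (x - x0) \<in> interior P"
      using ray_to_frontier[OF \<open>bounded P\<close> x0 xx0] by metis
    define y where "y = x0 + s *\<^sub>R (x - x0)"
    \<comment> \<open>If the ray met the frontier before \<open>x\<close>, the meeting point would
      lie strictly between the interior point \<open>x0\<close> and \<open>x \<in> P\<close>, hence
      in the interior.\<close>
    have s1: "1 \<le> s"
    proof (rule ccontr)
      assume "\<not> 1 \<le> s"
      then have "s < 1" by simp
      then have "x - (1 - s) *\<^sub>R (x - x0) \<in> interior P"
        using s(1) by (intro mem_interior_convex_shrink convex x0 x) auto
      moreover have "x - (1 - s) *\<^sub>R (x - x0) = x0 + s *\<^sub>R (x - x0)" by (simp add: algebra_simps)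
      ultimately show False using s(2) by (simp add: frontier_def)
    qed
    have "y \<in> P" using s(2) closed frontier_subset_eq unfolding y_def by blast
    have "y \<in> frontier P" using s(2) by (simp add: y_def)
    then obtain F where F: "F facet_of P" "y \<in> F" unfolding frontier_polytope(1)[OF P] by blast
    have xy: "x = x0 + (1 / s) *\<^sub>R (y - x0)" using s(1) by (simp add: y_def)
    have "d \<le> 1 / s"
    proof -
      have "dist x0 y = s * dist x0 x" using s(1) by (simp add: y_def dist_norm norm_minus_commute)
      then have "s * dist x0 x \<le> R" using R(2)[OF \<open>y \<in> P\<close>] by simp
      moreover have "s * e \<le> s * dist x0 x" using False s(1) by (intro mult_left_mono) auto
      ultimately have "s * e \<le> R" by linarith
      then show ?thesis using s(1) R(1) by (simp add: d_def field_simps)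
    qed
    then have "x \<in> C F" unfolding C_def using F(2) s1
      by (intro image_eqI[of _ _ "(1 / s, y)"]) (auto simp: xy[symmetric])
    then show ?thesis using F by blast
  qed simp
  have cone: "(\<integral>\<^sup>+x. g x * indicator (C F) x \<partial>lborel) < top" if F: "F facet_of P" for F
  proof -
    obtain a b where ab: "a \<noteq> 0" "affine hull F = {x. inner a x = b}"
      and out: "\<And>x. x \<in> interior P \<Longrightarrow> x \<notin> affine hull F" and cF: "compact F" and FP: "F \<subseteq> P"
      using facet_hyperplane[OF P F] by metis
    define n where "n = unit_normal (affine hull F)"
    obtain b' where n: "norm n = 1" "affine hull F = {x. inner n x = b'}"
      unfolding n_def by (rule unit_normal[OF ab])
    have Fb [measurable]: "F \<in> sets borel" using cF by (intro borel_closed compact_imp_closed)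
    have FH: "F \<subseteq> affine hull F" by (rule hull_subset)
    then have FH': "F \<subseteq> {x. inner n x = b'}" using n(2) by simp
    have h: "b' - inner n x0 \<noteq> 0" using out[OF x0] n(2) by auto
    obtain ww where ww: "0 < ww" "\<And>A. A \<in> sets borel \<Longrightarrow> A \<subseteq> F \<Longrightarrow>
            emeasure sg A = ennreal ww * emeasure (hyperplane_measure (affine hull F)) A"
      using w[OF F] by blast
    define G where "G y = (\<integral>\<^sup>+t. g (x0 + t *\<^sub>R (y - x0)) * indicator {d..1} t \<partial>lborel)" for y
    have [measurable]: "G \<in> borel_measurable borel" unfolding G_def by measurable
    have G_le: "G y \<le> ennreal (K * ln K + K + 1) * (1 + ext P u y)" if "y \<in> F" for y
      unfolding G_def g_def
    proof (rule psi_ray[OF K(1) d])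
      have yP: "y \<in> P" using that FP by blast
      fix t assume t: "t \<in> {d..1}"
      have "x0 + t *\<^sub>R (y - x0) = (1 - t) *\<^sub>R x0 + t *\<^sub>R y" by (simp add: algebra_simps)
      moreover have "\<dots> \<in> P" using convex x0P yP t d unfolding convex_alt by auto
      ultimately have "ext P u (x0 + t *\<^sub>R (y - x0)) = u ((1 - t) *\<^sub>R x0 + t *\<^sub>R y)" by simp
      also have "\<dots> \<le> epow (u x0) (1 - t) * epow (u y) t"
        using t d by (intro log_convex_onD[OF M1_D(3)[OF u] x0P yP]) auto
      also have "\<dots> \<le> epow (ennreal K) (1 - t) * epow (ext P u y) t"
      \<comment> \<open>\<open>epow_mono\<close> needs a positive exponent, and \<open>1 - t\<close>
        vanishes at \<open>t = 1\<close>. There both powers are 1, because \<open>u x0\<close> and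
        \<open>K\<close> are nonzero.\<close>
      proof (cases "t = 1")
        case True
        then show ?thesis using M1_D(2)[OF u x0P] K yP by (simp add: zero_less_iff_neq_zero)
      next
        case False
        then show ?thesis using t d K yP by (intro mult_mono epow_mono K(4)) auto
      qed
      finally show "ext P u (x0 + t *\<^sub>R (y - x0)) \<le> epow (ennreal K) (1 - t) * epow (ext P u y) t" .
    qed measurable
    let ?J = "\<integral>\<^sup>+z. G (z - (inner n z - b') *\<^sub>R n) * (indicator F (z - (inner n z - b') *\<^sub>R n) * indicator {0..1} (inner n z - b')) \<partial>lborel"
    have "ennreal ww * ?J = (\<integral>\<^sup>+y. G y * indicator F y \<partial>sg)"
      using Fb FH ww(2)
      by (intro facet_integral[OF sg ab n_def n(2,1), symmetric]) auto
    also have "\<dots> \<le> (\<integral>\<^sup>+y. ennreal (K * ln K + K + 1) * (1 + ext P u y) \<partial>sg)"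
      using G_le by (intro nn_integral_mono) (auto simp: indicator_def)
    also have "\<dots> = ennreal (K * ln K + K + 1) * (\<integral>\<^sup>+y. 1 + ext P u y \<partial>sg)"
      by (rule nn_integral_cmult) measurable
    also have "\<dots> < top" using fin_sg by (simp add: ennreal_mult_less_top)
    finally have "?J < top" using ww(1) by (auto simp: ennreal_mult_less_top)
    moreover have "ennreal (d / \<bar>b' - inner n x0\<bar>) * (\<integral>\<^sup>+x. g x * indicator (C F) x \<partial>lborel) \<le> ?J"
      unfolding C_def G_def by (rule cone_inequality[OF n(1) h cF FH' d]) measurable
    ultimately have "ennreal (d / \<bar>b' - inner n x0\<bar>) * (\<integral>\<^sup>+x. g x * indicator (C F) x \<partial>lborel) < top"
      by (rule le_less_trans[rotated])
    moreover have "0 < d / \<bar>b' - inner n x0\<bar>" using d h by simp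
    then have "ennreal (d / \<bar>b' - inner n x0\<bar>) \<noteq> 0" by (simp only: ennreal_eq_0_iff not_le)
    ultimately show ?thesis unfolding ennreal_mult_less_top by auto
  qed
  have Cb: "C F \<in> sets borel" if "F facet_of P" for F
  proof -
    have "compact F" using facet_hyperplane[OF P that] by metis
    then have "compact (C F)" unfolding C_def
      by (intro compact_continuous_image compact_Times) (auto intro!: continuous_intros simp: case_prod_beta)
    then show ?thesis by (intro borel_closed compact_imp_closed)
  qed
  let ?FF = "{F. F facet_of P}"
  let ?L = "ennreal (K * ln K + 1)"
  have "(\<integral>\<^sup>+x. g x * indicator P x \<partial>lborel)
    \<le> (\<integral>\<^sup>+x. ?L * indicator (cball x0 e) x + (\<Sum>F\<in>?FF. g x * indicator (C F) x) \<partial>lborel)"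
  proof (rule nn_integral_mono)
    fix x
    show "g x * indicator P x \<le> ?L * indicator (cball x0 e) x + (\<Sum>F\<in>?FF. g x * indicator (C F) x)"
    proof (cases "x \<in> P")
      case True
      from cover[OF True] show ?thesis
      proof (elim disjE exE conjE)
        assume xb: "x \<in> cball x0 e"
        then have "g x \<le> ?L" unfolding g_def using True by (simp add: psi_le[OF K(4)[OF xb] K(1)])
        then show ?thesis using True xb by (simp add: add_increasing2)
      next
        fix F assume F: "F facet_of P" "x \<in> C F"
        have "g x * indicator P x = g x * indicator (C F) x" using F True by simp
        also have "\<dots> \<le> (\<Sum>F\<in>?FF. g x * indicator (C F) x)"
          using F(1) frontier_polytope(2)[OF P] by (intro member_le_sum) auto
        finally show ?thesis by (simp add: add_increasing)
      qed
    qed simp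
  qed
  also have "\<dots> = ?L * emeasure lborel (cball x0 e) + (\<Sum>F\<in>?FF. \<integral>\<^sup>+x. g x * indicator (C F) x \<partial>lborel)"
  proof -
    have cb: "cball x0 e \<in> sets lborel" by (simp add: borel_closed)
    then have m1: "(\<lambda>x. ?L * indicator (cball x0 e) x) \<in> borel_measurable lborel" by measurable
    have m2: "(\<lambda>x. g x * indicator (C F) x) \<in> borel_measurable lborel" if "F \<in> ?FF" for F
    proof -
      have [measurable]: "C F \<in> sets borel" using that by (intro Cb) simp
      show ?thesis by measurable
    qed
    then have m3: "(\<lambda>x. \<Sum>F\<in>?FF. g x * indicator (C F) x) \<in> borel_measurable lborel"
      by (rule borel_measurable_sum)
    show ?thesis
      unfolding nn_integral_add[OF m1 m3] nn_integral_cmult_indicator[OF cb]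
      by (subst nn_integral_sum) (use m2 in auto)
  qed
  also have "\<dots> < top"
    using cone emeasure_bounded_finite[of "cball x0 e"] frontier_polytope(2)[OF P]
    by (auto simp: ennreal_mult_less_top ennreal_add_less_top)
  finally have "ennreal c * (\<integral>\<^sup>+x. g x * indicator P x \<partial>lborel) < top" by (simp add: ennreal_mult_less_top)
  then show ?thesis unfolding D_def g_def[symmetric] by (subst nn_integral_mu) auto
qed

section \<open>Canonical distributions of the composite system\<close>

context body
begin

text \<open>The constant density is the competitor that makes the minimal energy and the minimal
  free energy finite.\<close>

lemma internal_energy_one:
  assumes "boundary_measure P sg"
  shows "internal_energy P mu sg (\<lambda>_. 1) < top"
proof -
  interpret s: finite_measure sg using assms by (simp add: boundary_measure_def)
  have "emeasure sg (space sg) < top" using s.emeasure_finite[of "space sg"] by (simp only: less_top[symmetric] not_False_eq_True)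
  moreover have "ext P (\<lambda>_. 1) = (\<lambda>_. 1)" by (auto simp: ext_def)
  ultimately show ?thesis
    unfolding internal_energy_eq[OF assms closed] by (simp add: ennreal_mult_less_top)
qed

lemma canonical_in_M1: "is_canonical P mu sg T u \<Longrightarrow> u \<in> M1 P mu"
  by (simp add: is_canonical_def)

lemma canonical_0_internal_energy_finite:
  assumes "boundary_measure P sg" "is_canonical P mu sg 0 u"
  shows "internal_energy P mu sg u < top"
  using assms(2) one_in_M1 internal_energy_one[OF assms(1)]
  unfolding is_canonical_0_iff by (meson le_less_trans)

end

context two_bodies
begin

text \<open>The energy is affine, so the midpoint argument loses nothing in this term and all
  strictness comes from \<open>b.D\<close>.\<close>

lemma internal_energy_comp_mid:
  assumes s1: "boundary_measure P1 sg1" and s2: "boundary_measure P2 sg2"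
    and v: "v \<in> M1 PP mm" and w: "w \<in> M1 PP mm"
  defines "U \<equiv> internal_energy PP mm (comp_sigma mu1 sg1 mu2 sg2)"
  shows "2 * U (b.mid v w) = U v + U w"
proof -
  have s: "sets sg1 = sets borel" "sets sg2 = sets borel"
    using s1 s2 by (simp_all add: boundary_measure_def)
  have [measurable_cong]: "sets (comp_sigma mu1 sg1 mu2 sg2) = sets borel"
  proof -
    have "sets (comp_sigma mu1 sg1 mu2 sg2) = sets (sg1 \<Otimes>\<^sub>M mu2)"
      unfolding comp_sigma_def measure_add_def
      by (rule sets.sets_measure_of_eq)
    also have "\<dots> = sets (borel \<Otimes>\<^sub>M borel)" using s by (intro sets_pair_measure_cong) auto
    finally show ?thesis unfolding borel_prod .
  qed
  note [measurable] = b.M1_D(5)[OF v] b.M1_D(5)[OF w]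
  have fr [measurable]: "frontier PP \<in> sets borel" by (intro borel_closed) simp
  have sub: "frontier PP \<subseteq> PP" using b.closed by (simp add: frontier_subset_eq)
  define I where "I f = (\<integral>\<^sup>+z. f z * indicator (frontier PP) z \<partial>comp_sigma mu1 sg1 mu2 sg2)" for f
  have ext: "I f = I (ext PP f)" for f
    unfolding I_def using sub by (intro nn_integral_cong) (auto simp: indicator_def)
  have half: "2 * ((a + b) / 2 * c) = a * c + b * c" for a b c :: ennreal
  proof -
    have "2 * ((a + b) / 2) = a + b" by (intro ennreal_mult_divide_cancel) auto
    then show ?thesis by (simp only: mult.assoc[symmetric] distrib_right)
  qed
  have "2 * I (b.mid v w) = (\<integral>\<^sup>+z. 2 * (ext PP (b.mid v w) z * indicator (frontier PP) z) \<partial>comp_sigma mu1 sg1 mu2 sg2)"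
    unfolding ext[of "b.mid v w"] unfolding I_def b.ext_mid by (rule nn_integral_cmult[symmetric]) measurable
  also have "\<dots> = I (ext PP v) + I (ext PP w)"
    unfolding b.ext_mid half I_def by (rule nn_integral_add) measurable
  finally have "2 * I (b.mid v w) = I v + I w" unfolding ext[symmetric] .
  then show ?thesis
    unfolding U_def internal_energy_def I_def
    by (metis (no_types, lifting) distrib_left mult.left_commute)
qed

text \<open>With \<open>b.V = b1.V * b2.V\<close>, division by the volume removes the weights in
  \<open>D_prod\<close> and \<open>D_marg_le\<close>, so that free energies add at a common
  temperature.\<close>

lemma D_scaled:
  assumes "0 \<le> T"
  shows "ennreal (T / b.V) * (ennreal b2.V * x + ennreal b1.V * y) = ennreal (T / b1.V) * x + ennreal (T / b2.V) * y"
proof -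
  have pos: "0 < b1.V" "0 < b2.V" "0 < b.V" by (fact b1.V_pos b2.V_pos b.V_pos)+
  have "ennreal (T / b.V) * ennreal b2.V = ennreal (T / b.V * b2.V)"
    "ennreal (T / b.V) * ennreal b1.V = ennreal (T / b.V * b1.V)"
    using pos assms by (simp_all only: ennreal_mult divide_nonneg_nonneg less_imp_le)
  moreover have "T / b.V * b2.V = T / b1.V" "T / b.V * b1.V = T / b2.V"
    using V_eq(2) pos by (simp_all add: field_simps)
  ultimately show ?thesis by (simp only: distrib_left mult.assoc[symmetric])
qed

text \<open>Minimality is the chain \<open>J w = J1 u1 + J2 u2 \<le> J1 (marg1 v) + J2 (marg2 v)
  \<le> J v\<close>; in its last step the energies agree and only the entropy term can grow.\<close>

lemma product_canonical_pos:
  assumes s1: "boundary_measure P1 sg1" and s2: "boundary_measure P2 sg2" and T: "0 < T"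
    and c1: "is_canonical P1 mu1 sg1 T u1" and c2: "is_canonical P2 mu2 sg2 T u2"
  defines "w \<equiv> \<lambda>(x, y). u1 x * u2 y" and "sg \<equiv> comp_sigma mu1 sg1 mu2 sg2"
  shows "is_canonical PP mm sg T w"
    and "is_canonical PP mm sg T v \<Longrightarrow> z \<in> PP \<Longrightarrow> v z = w z"
proof -
  have u1: "u1 \<in> M1 P1 mu1" and u2: "u2 \<in> M1 P2 mu2"
    using c1 c2 by (auto simp: is_canonical_def)
  have w: "w \<in> M1 PP mm" unfolding w_def by (rule prod_in_M1[OF u1 u2])
  define J where "J v = internal_energy PP mm sg v + ennreal (T / b.V) * b.D v" for v
  define J1 where "J1 v = internal_energy P1 mu1 sg1 v + ennreal (T / b1.V) * b1.D v" for v
  define J2 where "J2 v = internal_energy P2 mu2 sg2 v + ennreal (T / b2.V) * b2.D v" for v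
  have min1: "J1 u1 \<le> J1 v" if "v \<in> M1 P1 mu1" for v
    using c1 that by (simp add: b1.is_canonical_pos_iff[OF T] J1_def)
  have min2: "J2 u2 \<le> J2 v" if "v \<in> M1 P2 mu2" for v
    using c2 that by (simp add: b2.is_canonical_pos_iff[OF T] J2_def)
  have Jw: "J w = J1 u1 + J2 u2"
    unfolding J_def w_def sg_def U_prod[OF s1 s2 u1 u2] D_prod[OF u1 u2] D_scaled[OF less_imp_le[OF T]]
    by (simp add: J1_def J2_def ac_simps)
  have Jv: "J1 (marg1 v) + J2 (marg2 v) \<le> J v" if v: "v \<in> M1 PP mm" for v
  proof -
    have "J1 (marg1 v) + J2 (marg2 v) = internal_energy PP mm sg v
        + ennreal (T / b.V) * (ennreal b2.V * b1.D (marg1 v) + ennreal b1.V * b2.D (marg2 v))"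
      unfolding sg_def U_comp[OF s1 s2 v] D_scaled[OF less_imp_le[OF T]] by (simp add: J1_def J2_def ac_simps)
    also have "\<dots> \<le> J v" unfolding J_def by (intro add_left_mono mult_left_mono D_marg_le v) simp
    finally show ?thesis .
  qed
  have min: "J w \<le> J v" if v: "v \<in> M1 PP mm" for v
  proof -
    have "J w \<le> J1 (marg1 v) + J2 (marg2 v)"
      unfolding Jw by (intro add_mono min1 min2 marg_in_M1 v)
    then show ?thesis using Jv[OF v] by (rule order_trans)
  qed
  then show "is_canonical PP mm sg T w" using w by (simp add: b.is_canonical_pos_iff[OF T] J_def)
  show "v z = w z" if v: "is_canonical PP mm sg T v" and z: "z \<in> PP"
  proof -
    have vM: "v \<in> M1 PP mm" using v by (simp add: is_canonical_def)
    have "J1 (\<lambda>_. 1) < top" using b1.internal_energy_one[OF s1] by (simp add: J1_def b1.D_one)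
    then have "J1 u1 < top" using min1[OF b1.one_in_M1] by (rule le_less_trans[rotated])
    moreover have "J2 (\<lambda>_. 1) < top" using b2.internal_energy_one[OF s2] by (simp add: J2_def b2.D_one)
    then have "J2 u2 < top" using min2[OF b2.one_in_M1] by (rule le_less_trans[rotated])
    ultimately have fw: "J w < top" unfolding Jw by simp
    have vw: "J v \<le> J w" using v w by (simp add: b.is_canonical_pos_iff[OF T] J_def)
    then have fv: "J v < top" using fw by (rule le_less_trans)
    let ?m = "b.mid v w" and ?U = "internal_energy PP mm sg" and ?k = "ennreal (T / b.V)"
    have m: "?m \<in> M1 PP mm" by (rule b.mid_in_M1[OF vM w])
    have k0: "?k \<noteq> 0" using divide_pos_pos[OF T b.V_pos] by (simp only: ennreal_eq_0_iff not_le)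
    have finU: "?U v + ?U w \<noteq> top" and finD: "b.D v + b.D w < top"
      using fv fw k0 by (auto simp: J_def ennreal_mult_less_top less_top)
    have U: "2 * ?U ?m = ?U v + ?U w"
      unfolding sg_def by (rule internal_energy_comp_mid[OF s1 s2 vM w])
    \<comment> \<open>Minimality against the midpoint gives the reverse of \<open>D_mid(1)\<close>,
      once the equal and finite energies are cancelled and the factor \<open>?k\<close>, nonzero by
      \<open>T > 0\<close>, is removed.\<close>
    have "J v + J w \<le> J ?m + J ?m" using min[OF m] vw by (intro add_mono) auto
    then have "(?U v + ?U w) + ?k * (b.D v + b.D w) \<le> 2 * ?U ?m + ?k * (2 * b.D ?m)"
      by (simp add: J_def mult_2 distrib_left ac_simps)
    then have "?k * (b.D v + b.D w) \<le> ?k * (2 * b.D ?m)"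
      unfolding U ennreal_add_left_cancel_le using finU by simp
    then have "b.D v + b.D w \<le> 2 * b.D ?m"
      using k0 by (subst (asm) ennreal_mult_le_mult_iff) auto
    then have "2 * b.D ?m = b.D v + b.D w" using b.D_mid(1)[OF vM w] by (intro antisym)
    then show ?thesis using b.D_mid(2)[OF vM w _ finD z] by simp
  qed
qed

text \<open>The entropy comparison is available only among minimisers of the energy. If
  \<open>v\<close> minimises the total energy, its marginal energies sum to at most
  \<open>?U1 u1 + ?U2 u2\<close> while each is at least its minimum; these minima are finite and can
  be cancelled, so both marginals are minimisers and may be compared with \<open>u1\<close> and
  \<open>u2\<close> in entropy.\<close>

lemma product_canonical_0:
  assumes s1: "boundary_measure P1 sg1" and s2: "boundary_measure P2 sg2"
    and c1: "is_canonical P1 mu1 sg1 0 u1" and c2: "is_canonical P2 mu2 sg2 0 u2"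
    and D1: "b1.D u1 < top" and D2: "b2.D u2 < top"
  defines "w \<equiv> \<lambda>(x, y). u1 x * u2 y" and "sg \<equiv> comp_sigma mu1 sg1 mu2 sg2"
  shows "is_canonical PP mm sg 0 w"
    and "is_canonical PP mm sg 0 v \<Longrightarrow> z \<in> PP \<Longrightarrow> v z = w z"
proof -
  have u1: "u1 \<in> M1 P1 mu1" and u2: "u2 \<in> M1 P2 mu2"
    using c1 c2 by (auto simp: is_canonical_def)
  have w: "w \<in> M1 PP mm" unfolding w_def by (rule prod_in_M1[OF u1 u2])
  let ?U = "internal_energy PP mm sg" and ?U1 = "internal_energy P1 mu1 sg1" and ?U2 = "internal_energy P2 mu2 sg2"
  have min1: "?U1 u1 \<le> ?U1 v" if "v \<in> M1 P1 mu1" for v using c1 that by (simp add: b1.is_canonical_0_iff)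
  have min2: "?U2 u2 \<le> ?U2 v" if "v \<in> M1 P2 mu2" for v using c2 that by (simp add: b2.is_canonical_0_iff)
  have fin1: "?U1 u1 < top" by (rule b1.canonical_0_internal_energy_finite[OF s1 c1])
  have fin2: "?U2 u2 < top" by (rule b2.canonical_0_internal_energy_finite[OF s2 c2])
  have Uw: "?U w = ?U1 u1 + ?U2 u2" unfolding sg_def w_def by (rule U_prod[OF s1 s2 u1 u2])
  have Uv: "?U v = ?U1 (marg1 v) + ?U2 (marg2 v)" if "v \<in> M1 PP mm" for v
    unfolding sg_def by (rule U_comp[OF s1 s2 that])
  have min: "?U w \<le> ?U v" if v: "v \<in> M1 PP mm" for v
    unfolding Uw Uv[OF v] by (intro add_mono min1 min2 marg_in_M1 v)
  have Dw: "b.D w = ennreal b2.V * b1.D u1 + ennreal b1.V * b2.D u2"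
    unfolding w_def by (rule D_prod[OF u1 u2])
  have Dmin: "b.D w \<le> b.D v" if v: "v \<in> M1 PP mm" and Umin: "?U v \<le> ?U w" for v
  proof -
    note m = marg_in_M1[OF v]
    have le: "?U1 (marg1 v) + ?U2 (marg2 v) \<le> ?U1 u1 + ?U2 u2" using Umin by (simp only: Uw Uv[OF v])
    have "?U1 (marg1 v) + ?U2 u2 \<le> ?U1 (marg1 v) + ?U2 (marg2 v)" by (intro add_left_mono min2 m)
    also note le
    finally have "?U2 u2 + ?U1 (marg1 v) \<le> ?U2 u2 + ?U1 u1" by (simp only: add.commute)
    then have e1: "?U1 (marg1 v) \<le> ?U1 u1" using fin2 unfolding ennreal_add_left_cancel_le by auto
    have "?U1 u1 + ?U2 (marg2 v) \<le> ?U1 (marg1 v) + ?U2 (marg2 v)" by (intro add_right_mono min1 m)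
    also note le
    finally have e2: "?U2 (marg2 v) \<le> ?U2 u2" using fin1 unfolding ennreal_add_left_cancel_le by auto
    have "\<forall>u\<in>M1 P1 mu1. ?U1 (marg1 v) \<le> ?U1 u" using e1 min1 order_trans by blast
    then have d1: "b1.D u1 \<le> b1.D (marg1 v)" using c1 m(1) by (simp add: b1.is_canonical_0_iff)
    have "\<forall>u\<in>M1 P2 mu2. ?U2 (marg2 v) \<le> ?U2 u" using e2 min2 order_trans by blast
    then have d2: "b2.D u2 \<le> b2.D (marg2 v)" using c2 m(2) by (simp add: b2.is_canonical_0_iff)
    have "b.D w \<le> ennreal b2.V * b1.D (marg1 v) + ennreal b1.V * b2.D (marg2 v)"
      unfolding Dw by (intro add_mono mult_left_mono d1 d2) auto
    also have "\<dots> \<le> b.D v" by (rule D_marg_le[OF v])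
    finally show ?thesis .
  qed
  show "is_canonical PP mm sg 0 w"
    unfolding b.is_canonical_0_iff using w min Dmin by blast
  show "v z = w z" if v: "is_canonical PP mm sg 0 v" and z: "z \<in> PP"
  proof -
    have vM: "v \<in> M1 PP mm" using v by (simp add: is_canonical_def)
    have Uvw: "?U v \<le> ?U w" using v w by (simp add: b.is_canonical_0_iff)
    have Dvw: "b.D v \<le> b.D w" using v w min unfolding b.is_canonical_0_iff by blast
    have Dfin: "b.D w < top" unfolding Dw using D1 D2 by (simp add: ennreal_mult_less_top)
    then have finD: "b.D v + b.D w < top" using Dvw by (simp add: le_less_trans)
    let ?m = "b.mid v w"
    have m: "?m \<in> M1 PP mm" by (rule b.mid_in_M1[OF vM w])
    \<comment> \<open>The midpoint of two minimisers of the energy is again a minimiser, so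
      \<open>Dmin\<close> applies to it.\<close>
    have "2 * ?U ?m = ?U v + ?U w"
      unfolding sg_def by (rule internal_energy_comp_mid[OF s1 s2 vM w])
    also have "\<dots> \<le> 2 * ?U w" using Uvw by (simp add: mult_2 add_right_mono)
    finally have "?U ?m \<le> ?U w" by (subst (asm) ennreal_mult_le_mult_iff) auto
    then have Dm: "b.D w \<le> b.D ?m" by (rule Dmin[OF m])
    have "b.D v + b.D w \<le> b.D ?m + b.D ?m" using Dm Dvw by (intro add_mono) auto
    then have "b.D v + b.D w \<le> 2 * b.D ?m" by (simp add: mult_2)
    then have "2 * b.D ?m = b.D v + b.D w" using b.D_mid(1)[OF vM w] by (intro antisym)
    then show ?thesis using b.D_mid(2)[OF vM w _ finD z] by simp
  qed
qed

end

theorem mainTheorem17: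
  fixes P1 :: "'a::euclidean_space set" and mu1 sg1 :: "'a measure"
    and P2 :: "'b::euclidean_space set" and mu2 sg2 :: "'b measure"
    and T :: real and u1 :: "'a \<Rightarrow> ennreal" and u2 :: "'b \<Rightarrow> ennreal"
  assumes "is_system P1 mu1 sg1" and "is_system P2 mu2 sg2"
    and "T \<ge> 0"
    and "is_canonical P1 mu1 sg1 T u1"
    and "is_canonical P2 mu2 sg2 T u2"
  shows "is_canonical (comp_set P1 P2) (comp_mu mu1 mu2) (comp_sigma mu1 sg1 mu2 sg2) T
           (\<lambda>(x, y). u1 x * u2 y)
       \<and> (\<forall>v. is_canonical (comp_set P1 P2) (comp_mu mu1 mu2) (comp_sigma mu1 sg1 mu2 sg2) T v
              \<longrightarrow> (\<forall>z\<in>comp_set P1 P2. v z = (\<lambda>(x, y). u1 x * u2 y) z))"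
proof -
  obtain k1 where b1: "body P1 mu1 k1" by (rule is_system_body[OF assms(1)])
  obtain k2 where b2: "body P2 mu2 k2" by (rule is_system_body[OF assms(2)])
  interpret two_bodies P1 mu1 k1 P2 mu2 k2
    using b1 b2 by (simp add: two_bodies_def)
  note s1 = is_system_boundary_measure[OF assms(1)] and s2 = is_system_boundary_measure[OF assms(2)]
  show ?thesis
  proof (cases "T = 0")
    case False
    then have T: "0 < T" using assms(3) by simp
    show ?thesis
      unfolding comp_set_def comp_mu_def
      using product_canonical_pos[OF s1 s2 T assms(4,5)] by blast
  next
    case True
    have c: "is_canonical P1 mu1 sg1 0 u1" "is_canonical P2 mu2 sg2 0 u2"
      using assms(4,5) True by simp_all
    have "b1.D u1 < top"
      by (rule finite_D[OF assms(1) b1 b1.canonical_in_M1[OF c(1)] b1.canonical_0_internal_energy_finite[OF s1 c(1)]])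
    moreover have "b2.D u2 < top"
      by (rule finite_D[OF assms(2) b2 b2.canonical_in_M1[OF c(2)] b2.canonical_0_internal_energy_finite[OF s2 c(2)]])
    ultimately show ?thesis
      unfolding comp_set_def comp_mu_def True
      using product_canonical_0[OF s1 s2 c] by blast
  qed
qed

end
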